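(* Let $(\Omega,\mathcal{F})$ be a measurable space, $\mathcal{P}$ a nonempty set of probability measures on $(\Omega,\mathcal{F})$ and $c(A)=\sup_{P\in\mathcal{P}}P(A)$. Assume that $ca_c^\ast=L^\infty_c$. Let $f:L^\infty_c\to(-\infty,\infty]$ be a quasiconvex (resp. convex), monotone non-decreasing ($X\le Y$ $\mathcal{P}$-q.s. implies $f(X)\le f(Y)$) and $\mathcal{P}$-sensitive function. The following are equivalent: (i) $f$ is $\sigma(L^\infty_c,ca_c)$-lower semicontinuous. (ii) $f$ has the Fatou property: for any norm bounded sequence $(X_n)_{n\in\mathbb{N}}\subset L^\infty_c$ converging $\mathcal{P}$-q.s. to $X\in L^\infty_c$ we have $f(X)\le\liminf_{n\to\infty}f(X_n)$. (iii) For any sequence $(X_n)_{n\in\mathbb{N}}\subset L^\infty_c$ and $X\in L^\infty_c$ such that $X_n\uparrow X$ $\mathcal{P}$-q.s. we have $f(X_n)\uparrow f(X)$. (iv) $f$ admits the following bidual representation. In the quasiconvex case, $$f(X)=\sup_{P\in ca_c\cap\mathcal{M}_1}R(E_P[X],P),\quad X\in L^\infty_c,$$ where, for $t\in\mathbb{R}$ and $\mu\in ca_c$, $$R(t,\mu):=\sup_{t'<t}\ \inf_{Y\in L^\infty_c}\left\{f(Y)\ \middle|\ \int Y\,d\mu=t'\right\};$$ in the convex case, $$f(X)=\sup_{\mu\in(ca_c)_+}\left\{\int X\,d\mu-f^\ast(\mu)\right\},\quad X\in L^\infty_c,$$ where, for $\mu\in ca_c$, $$f^\ast(\mu):=\sup_{Y\in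 L^\infty_c}\left\{\int Y\,d\mu-f(Y)\right\}.$$ In addition, if $f(X+m)=f(X)+m$ for every $X\in L^\infty_c$ and $m\in\mathbb{R}$, then $f$ is necessarily convex, and (under the equivalent conditions (i)-(iv)) $$f(X)=\sup_{P\in ca_c\cap\mathcal{M}_1}\left\{E_P[X]-f^\ast(P)\right\},\quad X\in L^\infty_c.$$
   Context: $\mathcal{M}_1$ is the set of all probability measures on $(\Omega,\mathcal{F})$. A statement holds $\mathcal{P}$-q.s. if it holds $P$-almost surely for every $P\in\mathcal{P}$. $ca$ is the space of all $\sigma$-additive $\mu:\mathcal{F}\to\mathbb{R}$ (finite signed measures) with the total variation norm; $ca_c=\{\mu\in ca\mid c(A)=0\Rightarrow\mu(A)=0 \text{ for all } A\in\mathcal{F}\}$, with the same norm; $(ca_c)_+$ is the set of nonnegative measures in $ca_c$. $L^\infty_c$ is the space of bounded $\mathcal{F}$-measurable functions $\Omega\to\mathbb{R}$ modulo $\mathcal{P}$-q.s. equality, with norm $\|X\|_{c,\infty}=\inf\{m\mid \forall P\in\mathcal{P}: P(|X|\le m)=1\}$ and order $X\le Y$ iff $X\le Y$ $\mathcal{P}$-q.s. The topology $\sigma(L^\infty_c,ca_c)$ is the weak topology on $L^\infty_c$ induced by the functionals $X\mapsto\int X\,d\mu$, $\mu\in ca_c$. $ca_c^\ast$ is the norm dual of $ca_c$. Every $X\in L^\infty_c$ defines an element of $ca_c^\ast$ by $\mu\mapsto\int X\,d\mu$; $ca_c^\ast=L^\infty_c$ means that every element of $ca_c^\ast$ is of this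 form. For $\mathcal{Q}\subset\mathcal{M}_1$, $\mathcal{Q}\ll\mathcal{P}$ means: for all $A\in\mathcal{F}$, $c(A)=0$ implies $Q(A)=0$ for all $Q\in\mathcal{Q}$. For $Q\in\mathcal{M}_1$ with $\{Q\}\ll\mathcal{P}$, $j_Q:L^\infty_c\to L^\infty_Q:=L^\infty(\Omega,\mathcal{F},Q)$ maps $X$ to the $Q$-a.s. equivalence class of any representative of $X$. A set $\mathcal{A}\subset L^\infty_c$ is $\mathcal{P}$-sensitive if there is $\mathcal{Q}\subset\mathcal{M}_1$ with $\mathcal{Q}\ll\mathcal{P}$ such that $\mathcal{A}=\bigcap_{Q\in\mathcal{Q}}j_Q^{-1}(j_Q(\mathcal{A}))$. A function $f:L^\infty_c\to(-\infty,\infty]$ is quasiconvex if $f(\lambda X+(1-\lambda)Y)\le\max\{f(X),f(Y)\}$ for all $\lambda\in[0,1]$ and $X,Y\in L^\infty_c$; convexity is defined as usual. It is $\tau$-lower semicontinuous for a topology $\tau$ if all lower level sets $\{X\in L^\infty_c\mid f(X)\le a\}$, $a\in\mathbb{R}$, are $\tau$-closed, and $\mathcal{P}$-sensitive if all these lower level sets, $a\in\mathbb{R}$, are $\mathcal{P}$-sensitive. $R$ and $f^\ast$ are understood as extended real valued, with $\inf\emptyset=+\infty$. *)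

theory Defs
  imports "HOL-Probability.Probability"
begin

text \<open>The measurable space \<open>(\<Omega>, \<F>)\<close> is a measure \<open>M\<close> of which only \<^term>\<open>space M\<close> and
  \<^term>\<open>sets M\<close> are used.\<close>

definition prob_measures :: "'a measure \<Rightarrow> 'a measure set" where
  "prob_measures M = {P. prob_space P \<and> sets P = sets M}"

definition capacity :: "'a measure set \<Rightarrow> 'a set \<Rightarrow> real" where
  "capacity \<P> A = (SUP P\<in>\<P>. measure P A)"

definition dominated :: "'a measure \<Rightarrow> 'a measure set \<Rightarrow> 'a measure set \<Rightarrow> bool" where
  "dominated M \<Q> \<P> \<longleftrightarrow> (\<forall>A\<in>sets M. capacity \<P> A = 0 \<longrightarrow> (\<forall>Q\<in>\<Q>. measure Q A = 0))"

definition qs :: "'a measure set \<Rightarrow> ('a \<Rightarrow> bool) \<Rightarrow> bool" where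
  "qs \<P> \<phi> \<longleftrightarrow> (\<forall>P\<in>\<P>. AE \<omega> in P. \<phi> \<omega>)"


subsection \<open>Signed measures\<close>

text \<open>A signed measure is a set function that vanishes off \<^term>\<open>sets M\<close> (as \<^term>\<open>measure P\<close> does),
  so that equal measures are equal functions.  The series condition gives \<open>\<mu> {} = 0\<close>.\<close>

definition ca :: "'a measure \<Rightarrow> ('a set \<Rightarrow> real) set" where
  "ca M = {\<mu>. (\<forall>A. A \<notin> sets M \<longrightarrow> \<mu> A = 0) \<and>
     (\<forall>A :: nat \<Rightarrow> 'a set. range A \<subseteq> sets M \<longrightarrow> disjoint_family A \<longrightarrow>
        (\<lambda>n. \<mu> (A n)) sums \<mu> (\<Union>n. A n))}"

definition ca_c :: "'a measure \<Rightarrow> 'a measure set \<Rightarrow> ('a set \<Rightarrow> real) set" where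
  "ca_c M \<P> = {\<mu> \<in> ca M. \<forall>A\<in>sets M. capacity \<P> A = 0 \<longrightarrow> \<mu> A = 0}"

definition ca_c_pos :: "'a measure \<Rightarrow> 'a measure set \<Rightarrow> ('a set \<Rightarrow> real) set" where
  "ca_c_pos M \<P> = {\<mu> \<in> ca_c M \<P>. \<forall>A\<in>sets M. 0 \<le> \<mu> A}"

text \<open>\<open>ca\<^sub>c \<inter> \<M>\<^sub>1\<close>, as a set of library measures: a probability measure \<open>P\<close> is the element
  \<^term>\<open>measure P\<close> of \<^term>\<open>ca M\<close>.\<close>

definition ca_c_prob :: "'a measure \<Rightarrow> 'a measure set \<Rightarrow> 'a measure set" where
  "ca_c_prob M \<P> = {P \<in> prob_measures M. measure P \<in> ca_c M \<P>}"

text \<open>The supremum is over a bounded set, since a real-valued \<open>\<sigma>\<close>-additive set function has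
  finite total variation.\<close>

definition tv_norm :: "'a measure \<Rightarrow> ('a set \<Rightarrow> real) \<Rightarrow> real" where
  "tv_norm M \<mu> =
     (SUP D\<in>{D. finite D \<and> D \<subseteq> sets M \<and> partition_on (space M) D}. \<Sum>A\<in>D. \<bar>\<mu> A\<bar>)"

text \<open>Jordan decomposition: \<open>\<mu>\<^sup>+(A) = sup {\<mu>(B) | B \<subseteq> A}\<close> and \<open>\<mu>\<^sup>- = (-\<mu>)\<^sup>+\<close>.
  Truncation by \<^const>\<open>ennreal\<close> is harmless, as \<open>B = {}\<close> contributes 0 to the supremum.\<close>

definition pos_variation :: "'a measure \<Rightarrow> ('a set \<Rightarrow> real) \<Rightarrow> 'a measure" where
  "pos_variation M \<mu> =
     measure_of (space M) (sets M) (\<lambda>A. SUP B\<in>{B \<in> sets M. B \<subseteq> A}. ennreal (\<mu> B))"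

definition signed_integral :: "'a measure \<Rightarrow> ('a set \<Rightarrow> real) \<Rightarrow> ('a \<Rightarrow> real) \<Rightarrow> real" where
  "signed_integral M \<mu> X =
     integral\<^sup>L (pos_variation M \<mu>) X - integral\<^sup>L (pos_variation M (\<lambda>A. - \<mu> A)) X"

definition ca_c_dual :: "'a measure \<Rightarrow> 'a measure set \<Rightarrow> (('a set \<Rightarrow> real) \<Rightarrow> real) set" where
  "ca_c_dual M \<P> = {\<phi>.
     (\<forall>\<mu>\<in>ca_c M \<P>. \<forall>\<nu>\<in>ca_c M \<P>. \<forall>a b. \<phi> (\<lambda>A. a * \<mu> A + b * \<nu> A) = a * \<phi> \<mu> + b * \<phi> \<nu>) \<and>
     (\<exists>K. \<forall>\<mu>\<in>ca_c M \<P>. \<bar>\<phi> \<mu>\<bar> \<le> K * tv_norm M \<mu>)}"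


subsection \<open>The space \<open>L\<^sup>\<infinity>\<^sub>c\<close>\<close>

definition bmeas :: "'a measure \<Rightarrow> ('a \<Rightarrow> real) set" where
  "bmeas M = {X \<in> borel_measurable M. \<exists>K. \<forall>\<omega>\<in>space M. \<bar>X \<omega>\<bar> \<le> K}"

definition qs_rel :: "'a measure \<Rightarrow> 'a measure set \<Rightarrow> (('a \<Rightarrow> real) \<times> ('a \<Rightarrow> real)) set" where
  "qs_rel M \<P> = {(X, Y). X \<in> bmeas M \<and> Y \<in> bmeas M \<and> qs \<P> (\<lambda>\<omega>. X \<omega> = Y \<omega>)}"

definition Linf :: "'a measure \<Rightarrow> 'a measure set \<Rightarrow> ('a \<Rightarrow> real) set set" where
  "Linf M \<P> = bmeas M // qs_rel M \<P>"

text \<open>Elements of \<^term>\<open>Linf M \<P>\<close> are written \<^term>\<open>cls M \<P> X\<close> with \<^term>\<open>X \<in> bmeas M\<close>; operations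
  on classes are expressed through representatives.\<close>

definition cls :: "'a measure \<Rightarrow> 'a measure set \<Rightarrow> ('a \<Rightarrow> real) \<Rightarrow> ('a \<Rightarrow> real) set" where
  "cls M \<P> X = qs_rel M \<P> `` {X}"

definition Linf_norm :: "'a measure set \<Rightarrow> ('a \<Rightarrow> real) \<Rightarrow> real" where
  "Linf_norm \<P> X = Inf {m. \<forall>P\<in>\<P>. measure P {\<omega> \<in> space P. \<bar>X \<omega>\<bar> \<le> m} = 1}"

definition dual_is_Linf :: "'a measure \<Rightarrow> 'a measure set \<Rightarrow> bool" where
  "dual_is_Linf M \<P> \<longleftrightarrow>
     (\<forall>\<phi>\<in>ca_c_dual M \<P>. \<exists>X\<in>bmeas M. \<forall>\<mu>\<in>ca_c M \<P>. \<phi> \<mu> = signed_integral M \<mu> X)"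

text \<open>\<open>\<sigma>(L\<^sup>\<infinity>\<^sub>c, ca\<^sub>c)\<close>: the subbasic sets are the preimages of open sets of reals under
  \<open>X \<mapsto> \<integral>X d\<mu>\<close>.\<close>

definition weak_top :: "'a measure \<Rightarrow> 'a measure set \<Rightarrow> ('a \<Rightarrow> real) set topology" where
  "weak_top M \<P> = topology_generated_by
     {cls M \<P> ` {X \<in> bmeas M. signed_integral M \<mu> X \<in> U} | \<mu> U. \<mu> \<in> ca_c M \<P> \<and> open U}"

text \<open>For a single \<open>Q\<close>, \<open>L\<^sup>\<infinity>\<^sub>Q\<close> is \<^term>\<open>Linf M {Q}\<close>.  The choice of representative is
  immaterial when \<^term>\<open>dominated M {Q} \<P>\<close>.\<close>

definition jmap :: "'a measure \<Rightarrow> 'a measure \<Rightarrow> ('a \<Rightarrow> real) set \<Rightarrow> ('a \<Rightarrow> real) set" where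
  "jmap M Q Z = cls M {Q} (SOME X. X \<in> Z)"

definition sensitive_set :: "'a measure \<Rightarrow> 'a measure set \<Rightarrow> ('a \<Rightarrow> real) set set \<Rightarrow> bool" where
  "sensitive_set M \<P> \<A> \<longleftrightarrow>
     (\<exists>\<Q> \<subseteq> prob_measures M. dominated M \<Q> \<P> \<and>
        \<A> = {Z \<in> Linf M \<P>. \<forall>Q\<in>\<Q>. jmap M Q Z \<in> jmap M Q ` \<A>})"


subsection \<open>Functions on \<open>L\<^sup>\<infinity>\<^sub>c\<close>\<close>

definition level_set ::
  "'a measure \<Rightarrow> 'a measure set \<Rightarrow> (('a \<Rightarrow> real) set \<Rightarrow> ereal) \<Rightarrow> real \<Rightarrow> ('a \<Rightarrow> real) set set" where
  "level_set M \<P> f a = {Z \<in> Linf M \<P>. f Z \<le> ereal a}"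

definition quasiconvex_fun ::
  "'a measure \<Rightarrow> 'a measure set \<Rightarrow> (('a \<Rightarrow> real) set \<Rightarrow> ereal) \<Rightarrow> bool" where
  "quasiconvex_fun M \<P> f \<longleftrightarrow> (\<forall>X\<in>bmeas M. \<forall>Y\<in>bmeas M. \<forall>l\<in>{0..1}.
     f (cls M \<P> (\<lambda>\<omega>. l * X \<omega> + (1 - l) * Y \<omega>)) \<le> max (f (cls M \<P> X)) (f (cls M \<P> Y)))"

definition convex_fun ::
  "'a measure \<Rightarrow> 'a measure set \<Rightarrow> (('a \<Rightarrow> real) set \<Rightarrow> ereal) \<Rightarrow> bool" where
  "convex_fun M \<P> f \<longleftrightarrow> (\<forall>X\<in>bmeas M. \<forall>Y\<in>bmeas M. \<forall>l\<in>{0..1}.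
     f (cls M \<P> (\<lambda>\<omega>. l * X \<omega> + (1 - l) * Y \<omega>))
       \<le> ereal l * f (cls M \<P> X) + ereal (1 - l) * f (cls M \<P> Y))"

definition monotone_fun ::
  "'a measure \<Rightarrow> 'a measure set \<Rightarrow> (('a \<Rightarrow> real) set \<Rightarrow> ereal) \<Rightarrow> bool" where
  "monotone_fun M \<P> f \<longleftrightarrow> (\<forall>X\<in>bmeas M. \<forall>Y\<in>bmeas M.
     qs \<P> (\<lambda>\<omega>. X \<omega> \<le> Y \<omega>) \<longrightarrow> f (cls M \<P> X) \<le> f (cls M \<P> Y))"

definition sensitive_fun ::
  "'a measure \<Rightarrow> 'a measure set \<Rightarrow> (('a \<Rightarrow> real) set \<Rightarrow> ereal) \<Rightarrow> bool" where
  "sensitive_fun M \<P> f \<longleftrightarrow> (\<forall>a. sensitive_set M \<P> (level_set M \<P> f a))"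

definition cash_additive ::
  "'a measure \<Rightarrow> 'a measure set \<Rightarrow> (('a \<Rightarrow> real) set \<Rightarrow> ereal) \<Rightarrow> bool" where
  "cash_additive M \<P> f \<longleftrightarrow> (\<forall>X\<in>bmeas M. \<forall>m :: real.
     f (cls M \<P> (\<lambda>\<omega>. X \<omega> + m)) = f (cls M \<P> X) + ereal m)"

definition weak_lsc ::
  "'a measure \<Rightarrow> 'a measure set \<Rightarrow> (('a \<Rightarrow> real) set \<Rightarrow> ereal) \<Rightarrow> bool" where
  "weak_lsc M \<P> f \<longleftrightarrow> (\<forall>a. closedin (weak_top M \<P>) (level_set M \<P> f a))"

definition fatou_property ::
  "'a measure \<Rightarrow> 'a measure set \<Rightarrow> (('a \<Rightarrow> real) set \<Rightarrow> ereal) \<Rightarrow> bool" where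
  "fatou_property M \<P> f \<longleftrightarrow> (\<forall>(X :: nat \<Rightarrow> 'a \<Rightarrow> real) Y.
     (\<forall>n. X n \<in> bmeas M) \<longrightarrow> Y \<in> bmeas M \<longrightarrow> (\<exists>K. \<forall>n. Linf_norm \<P> (X n) \<le> K) \<longrightarrow>
     qs \<P> (\<lambda>\<omega>. (\<lambda>n. X n \<omega>) \<longlonglongrightarrow> Y \<omega>) \<longrightarrow>
     f (cls M \<P> Y) \<le> liminf (\<lambda>n. f (cls M \<P> (X n))))"

definition continuous_from_below ::
  "'a measure \<Rightarrow> 'a measure set \<Rightarrow> (('a \<Rightarrow> real) set \<Rightarrow> ereal) \<Rightarrow> bool" where
  "continuous_from_below M \<P> f \<longleftrightarrow> (\<forall>(X :: nat \<Rightarrow> 'a \<Rightarrow> real) Y.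
     (\<forall>n. X n \<in> bmeas M) \<longrightarrow> Y \<in> bmeas M \<longrightarrow>
     qs \<P> (\<lambda>\<omega>. incseq (\<lambda>n. X n \<omega>) \<and> (\<lambda>n. X n \<omega>) \<longlonglongrightarrow> Y \<omega>) \<longrightarrow>
     incseq (\<lambda>n. f (cls M \<P> (X n))) \<and> (\<lambda>n. f (cls M \<P> (X n))) \<longlonglongrightarrow> f (cls M \<P> Y))"

definition R_fun ::
  "'a measure \<Rightarrow> 'a measure set \<Rightarrow> (('a \<Rightarrow> real) set \<Rightarrow> ereal) \<Rightarrow> real \<Rightarrow> ('a set \<Rightarrow> real) \<Rightarrow> ereal"
where
  "R_fun M \<P> f t \<mu> =
     (SUP t'\<in>{..<t}. INF Y\<in>{Y \<in> bmeas M. signed_integral M \<mu> Y = t'}. f (cls M \<P> Y))"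

definition fstar ::
  "'a measure \<Rightarrow> 'a measure set \<Rightarrow> (('a \<Rightarrow> real) set \<Rightarrow> ereal) \<Rightarrow> ('a set \<Rightarrow> real) \<Rightarrow> ereal" where
  "fstar M \<P> f \<mu> = (SUP Y\<in>bmeas M. ereal (signed_integral M \<mu> Y) - f (cls M \<P> Y))"

definition quasiconvex_representation ::
  "'a measure \<Rightarrow> 'a measure set \<Rightarrow> (('a \<Rightarrow> real) set \<Rightarrow> ereal) \<Rightarrow> bool" where
  "quasiconvex_representation M \<P> f \<longleftrightarrow> (\<forall>X\<in>bmeas M.
     f (cls M \<P> X) = (SUP P\<in>ca_c_prob M \<P>. R_fun M \<P> f (integral\<^sup>L P X) (measure P)))"

definition convex_representation ::
  "'a measure \<Rightarrow> 'a measure set \<Rightarrow> (('a \<Rightarrow> real) set \<Rightarrow> ereal) \<Rightarrow> bool" where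
  "convex_representation M \<P> f \<longleftrightarrow> (\<forall>X\<in>bmeas M.
     f (cls M \<P> X) = (SUP \<mu>\<in>ca_c_pos M \<P>. ereal (signed_integral M \<mu> X) - fstar M \<P> f \<mu>))"

definition cash_additive_representation ::
  "'a measure \<Rightarrow> 'a measure set \<Rightarrow> (('a \<Rightarrow> real) set \<Rightarrow> ereal) \<Rightarrow> bool" where
  "cash_additive_representation M \<P> f \<longleftrightarrow> (\<forall>X\<in>bmeas M.
     f (cls M \<P> X) = (SUP P\<in>ca_c_prob M \<P>. ereal (integral\<^sup>L P X) - fstar M \<P> f (measure P)))"

end

theory Submission
  imports Defs
begin

text \<open>Fix a level set \<open>A\<close> and \<open>X0 \<notin> A\<close>; everything follows once a single probability measure in
  \<open>ca\<^sub>c\<close> strictly separates \<open>X0\<close> from \<open>A\<close>.  Continuity from below and monotonicity make \<open>A\<close> closed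
  under bounded pointwise limits.  By sensitivity some \<open>Q\<close> distinguishes \<open>X0\<close> from \<open>A\<close>, and the nearest
  point in \<open>L\<^sup>2(Q)\<close> of an order-bounded piece of \<open>A\<close> separates \<open>X0\<close> from that piece.  The pieces are
  glued by the Krein--Smulian argument: as \<open>ca\<^sub>c\<^sup>* = L\<^sup>\<infinity>\<^sub>c\<close>, order intervals are weak-star compact, so
  there are finite sets \<open>F\<^sub>n\<close> of probability measures and \<open>r\<^sub>n \<rightarrow> \<infinity>\<close> such that, after translating \<open>X0\<close>
  to \<open>0\<close>, the sublinear functional \<open>sup {E\<^sub>P[X\<^sup>-] / r\<^sub>n | P \<in> F\<^sub>n}\<close> is at least \<open>1\<close> on \<open>A\<close>.
  A linear functional below it that is still at least \<open>1\<close> on \<open>A\<close> is \<open>\<sigma>\<close>-additive on sets because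
  \<open>r\<^sub>n \<rightarrow> \<infinity>\<close>.\<close>

subsection \<open>The Hahn--Banach theorem on spaces of functions\<close>

text \<open>No single measure need dominate \<P>, so a level set cannot be closed up by almost sure
  subsequences under one reference measure. Sensitivity removes the obstacle one point at a time:
  excluding a given \<open>X0\<close> involves a single \<open>Q\<close>, and limits are needed only
  along one minimising sequence under that \<open>Q\<close>. Downward closedness accounts for the
  one-sided objects. Members of the translated set may be cut off at 0 from above, so only lower
  bounds matter and the gauge involves negative parts only; the negative of a functional below it is
  therefore positive and normalises to a probability measure. The radii come from the constraints
  \<open>-r \<le> E_P[X]\<close>: imposed for all \<open>P\<close> together, they say exactly that
  \<open>X \<ge> -r\<close> q.s., and by weak-star compactness finitely many of them suffice at each
  stage. The convex case needs no second separation in the product with the reals. Once a level set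
  is separated by \<open>P\<close>, an affine minorant is found by a one-dimensional argument in the
  variable \<open>E_P[X]\<close>.\<close>

definition fun_subspace :: "('a \<Rightarrow> real) set \<Rightarrow> bool" where
  "fun_subspace V \<longleftrightarrow> (\<lambda>_. 0) \<in> V \<and> (\<forall>x\<in>V. \<forall>y\<in>V. (\<lambda>w. x w + y w) \<in> V) \<and>
     (\<forall>x\<in>V. \<forall>c. (\<lambda>w. c * x w) \<in> V)"

definition sublinear_on :: "('a \<Rightarrow> real) set \<Rightarrow> (('a \<Rightarrow> real) \<Rightarrow> real) \<Rightarrow> bool" where
  "sublinear_on V p \<longleftrightarrow> (\<forall>x\<in>V. \<forall>y\<in>V. p (\<lambda>w. x w + y w) \<le> p x + p y) \<and>
     (\<forall>x\<in>V. \<forall>c\<ge>0. p (\<lambda>w. c * x w) \<le> c * p x)"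

definition linear_on_funs :: "('a \<Rightarrow> real) set \<Rightarrow> (('a \<Rightarrow> real) \<Rightarrow> real) \<Rightarrow> bool" where
  "linear_on_funs V \<phi> \<longleftrightarrow> (\<forall>x\<in>V. \<forall>y\<in>V. \<phi> (\<lambda>w. x w + y w) = \<phi> x + \<phi> y) \<and>
     (\<forall>x\<in>V. \<forall>c. \<phi> (\<lambda>w. c * x w) = c * \<phi> x)"

definition convex_funs :: "('a \<Rightarrow> real) set \<Rightarrow> bool" where
  "convex_funs A \<longleftrightarrow>
     (\<forall>x\<in>A. \<forall>y\<in>A. \<forall>l\<in>{0..1}. (\<lambda>w. l * x w + (1 - l) * y w) \<in> A)"

lemma fun_subspaceD:
  assumes "fun_subspace V"
  shows "(\<lambda>_. 0) \<in> V" "x \<in> V \<Longrightarrow> y \<in> V \<Longrightarrow> (\<lambda>w. x w + y w) \<in> V"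
    "x \<in> V \<Longrightarrow> (\<lambda>w. c * x w) \<in> V" "x \<in> V \<Longrightarrow> (\<lambda>w. - x w) \<in> V"
    "x \<in> V \<Longrightarrow> y \<in> V \<Longrightarrow> (\<lambda>w. x w - y w) \<in> V"
proof -
  show 1: "(\<lambda>_. 0) \<in> V" and 2: "x \<in> V \<Longrightarrow> y \<in> V \<Longrightarrow> (\<lambda>w. x w + y w) \<in> V"
    and 3: "x \<in> V \<Longrightarrow> (\<lambda>w. c * x w) \<in> V" for x y c
    using assms unfolding fun_subspace_def by auto
  show 4: "x \<in> V \<Longrightarrow> (\<lambda>w. - x w) \<in> V" for x using 3[of x "-1"] by simp
  show "x \<in> V \<Longrightarrow> y \<in> V \<Longrightarrow> (\<lambda>w. x w - y w) \<in> V"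
    using 2[of x "\<lambda>w. - y w"] 4[of y] by simp
qed

lemma sublinear_onD:
  assumes "sublinear_on V p"
  shows "x \<in> V \<Longrightarrow> y \<in> V \<Longrightarrow> p (\<lambda>w. x w + y w) \<le> p x + p y"
    "x \<in> V \<Longrightarrow> c \<ge> 0 \<Longrightarrow> p (\<lambda>w. c * x w) \<le> c * p x"
  using assms unfolding sublinear_on_def by auto

lemma sublinear_on_zero:
  assumes V: "fun_subspace V" and p: "sublinear_on V p"
  shows "p (\<lambda>_. 0) = 0"
  using sublinear_onD(1)[OF p fun_subspaceD(1)[OF V] fun_subspaceD(1)[OF V]]
    sublinear_onD(2)[OF p fun_subspaceD(1)[OF V], of 0] by simp

lemma sublinear_on_scale:
  assumes V: "fun_subspace V" and p: "sublinear_on V p" and "x \<in> V" "c \<ge> 0"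
  shows "p (\<lambda>w. c * x w) = c * p x"
proof (cases "c = 0")
  case True
  then show ?thesis using sublinear_on_zero[OF V p] by simp
next
  case False
  then have "c > 0" using assms by simp
  then have "p (\<lambda>w. 1 / c * (c * x w)) \<le> 1 / c * p (\<lambda>w. c * x w)"
    using sublinear_onD(2)[OF p fun_subspaceD(3)[OF V \<open>x \<in> V\<close>, of c], of "1 / c"] by simp
  then have "p x \<le> p (\<lambda>w. c * x w) / c" using \<open>c > 0\<close> by simp
  then have "c * p x \<le> p (\<lambda>w. c * x w)" using \<open>c > 0\<close> by (simp add: field_simps)
  then show ?thesis using sublinear_onD(2)[OF p \<open>x \<in> V\<close> \<open>c \<ge> 0\<close>] by simp
qed

lemma le_cInf_add:
  fixes S T :: "real set"
  assumes "S \<noteq> {}" "T \<noteq> {}" "\<And>s t. s \<in> S \<Longrightarrow> t \<in> T \<Longrightarrow> c \<le> s + t"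
  shows "c \<le> Inf S + Inf T"
proof -
  have "c - t \<le> Inf S" if "t \<in> T" for t
    using assms that by (intro cInf_greatest) (auto simp: algebra_simps)
  then have "c - Inf S \<le> Inf T"
    using assms by (intro cInf_greatest) (auto simp: algebra_simps)
  then show ?thesis by simp
qed

text \<open>The new functional is \<open>q x = inf {p (x + t a) - t \<beta>}\<close> over
  \<open>a\<close> in \<open>A\<close> and \<open>t \<ge> 0\<close>. Convexity of \<open>A\<close>
  makes the multiples \<open>t a\<close> a convex cone, hence \<open>q\<close> subadditive. A linear
  functional below \<open>q\<close> is at most \<open>-\<beta>\<close> at \<open>-a\<close>, that
  is, at least \<beta> at \<open>a\<close>.\<close>

lemma sublinear_on_lower:
  assumes V: "fun_subspace V" and p: "sublinear_on V p"
    and A: "A \<subseteq> V" "convex_funs A" "A \<noteq> {}" and \<beta>: "\<And>a. a \<in> A \<Longrightarrow> \<beta> \<le> p a"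
  shows "\<exists>q. sublinear_on V q \<and> (\<forall>x\<in>V. q x \<le> p x) \<and> (\<forall>a\<in>A. q (\<lambda>w. - a w) \<le> - \<beta>)"
proof -
  define S where "S x = {p (\<lambda>w. x w + t * a w) - t * \<beta> | a t. a \<in> A \<and> t \<ge> 0}" for x
  define q where "q x = Inf (S x)" for x
  have ne: "S x \<noteq> {}" for x using A(3) unfolding S_def by force
  \<comment> \<open>A lower bound independent of \<open>a\<close> and \<open>t\<close>, so the
    infimum is finite. This is where \<open>\<beta> \<le> p a\<close> enters.\<close>
  have "- p (\<lambda>w. - x w) \<le> s" if x: "x \<in> V" "s \<in> S x" for x s
  proof -
    obtain a t where s: "s = p (\<lambda>w. x w + t * a w) - t * \<beta>" "a \<in> A" "t \<ge> 0"
      using x(2) unfolding S_def by blast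
    have aV: "a \<in> V" using A s by auto
    have "t * \<beta> \<le> p (\<lambda>w. t * a w)"
      using \<beta>[OF s(2)] s(3) sublinear_on_scale[OF V p aV s(3)] mult_left_mono by metis
    also have "\<dots> = p (\<lambda>w. (x w + t * a w) + - x w)" by simp
    also have "\<dots> \<le> p (\<lambda>w. x w + t * a w) + p (\<lambda>w. - x w)"
      by (intro sublinear_onD(1)[OF p] fun_subspaceD[OF V] x aV)
    finally show ?thesis using s by simp
  qed
  then have bdd: "bdd_below (S x)" if "x \<in> V" for x using that by (intro bdd_belowI[where m = "- p (\<lambda>w. - x w)"]) auto
  have upper: "q x \<le> p (\<lambda>w. x w + t * a w) - t * \<beta>" if "x \<in> V" "a \<in> A" "t \<ge> 0" for x a t
    unfolding q_def by (intro cInf_lower bdd that) (use that in \<open>auto simp: S_def\<close>)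
  have sum: "q (\<lambda>w. x w + y w) \<le> q x + q y" if xy: "x \<in> V" "y \<in> V" for x y
    unfolding q_def[of x] q_def[of y]
  proof (rule le_cInf_add[OF ne ne])
    fix s s' assume "s \<in> S x" "s' \<in> S y"
    then obtain a t b r where s: "s = p (\<lambda>w. x w + t * a w) - t * \<beta>" "a \<in> A" "t \<ge> 0"
      and s': "s' = p (\<lambda>w. y w + r * b w) - r * \<beta>" "b \<in> A" "r \<ge> 0"
      unfolding S_def by blast
    have aV: "a \<in> V" "b \<in> V" using A s s' by auto
    show "q (\<lambda>w. x w + y w) \<le> s + s'"
    proof (cases "t + r = 0")
      case True
      then have "t = 0" "r = 0" using s s' by auto
      then show ?thesis
        using upper[of "\<lambda>w. x w + y w" a 0] s s' sublinear_onD(1)[OF p xy]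
        fun_subspaceD(2)[OF V xy] by auto
    next
      case False
      \<comment> \<open>The weight for which \<open>(t + r) d = t a + r b\<close>, so that the two
        cone elements add up to one multiple of a point of \<open>A\<close>.\<close>
      define l where "l = t / (t + r)"
      define d where "d = (\<lambda>w. l * a w + (1 - l) * b w)"
      have l: "l \<in> {0..1}" "1 - l = r / (t + r)"
        using s s' False by (auto simp: l_def field_simps)
      have d: "d \<in> A" using A(2) s(2) s'(2) l(1) unfolding convex_funs_def d_def by blast
      have eq: "(t + r) * d w = t * a w + r * b w" for w
      proof -
        have "(t + r) * l = t" "(t + r) * (1 - l) = r"
          unfolding l(2) unfolding l_def using False by simp_all
        moreover have "(t + r) * d w = ((t + r) * l) * a w + ((t + r) * (1 - l)) * b w"
          unfolding d_def by (simp only: distrib_left mult.assoc)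
        ultimately show ?thesis by simp
      qed
      have "q (\<lambda>w. x w + y w) \<le> p (\<lambda>w. (x w + y w) + (t + r) * d w) - (t + r) * \<beta>"
        using s s' by (intro upper d fun_subspaceD(2)[OF V] xy) auto
      also have "\<dots> = p (\<lambda>w. (x w + t * a w) + (y w + r * b w)) - (t + r) * \<beta>"
        unfolding eq by (simp add: algebra_simps)
      also have "\<dots> \<le> s + s'"
        using sublinear_onD(1)[OF p fun_subspaceD(2)[OF V xy(1) fun_subspaceD(3)[OF V aV(1)]]
            fun_subspaceD(2)[OF V xy(2) fun_subspaceD(3)[OF V aV(2)]], of t r]
        unfolding s s' by (simp add: algebra_simps)
      finally show ?thesis .
    qed
  qed
  have scale: "q (\<lambda>w. c * x w) \<le> c * q x" if x: "x \<in> V" and c: "c \<ge> 0" for x c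
  proof (cases "c = 0")
    case True
    obtain a where "a \<in> A" using A by auto
    then show ?thesis using upper[of "\<lambda>_. 0" a 0] True fun_subspaceD(1)[OF V] sublinear_on_zero[OF V p]
      by simp
  next
    case False
    then have c: "c > 0" using c by simp
    have "q (\<lambda>w. c * x w) / c \<le> s" if "s \<in> S x" for s
    proof -
      obtain a t where s: "s = p (\<lambda>w. x w + t * a w) - t * \<beta>" "a \<in> A" "t \<ge> 0"
        using \<open>s \<in> S x\<close> unfolding S_def by auto
      have aV: "a \<in> V" using A s by auto
      have "q (\<lambda>w. c * x w) \<le> p (\<lambda>w. c * x w + (c * t) * a w) - (c * t) * \<beta>"
        by (rule upper) (use s c fun_subspaceD(3)[OF V x] in auto)
      also have "(\<lambda>w. c * x w + (c * t) * a w) = (\<lambda>w. c * (x w + t * a w))"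
        by (simp add: algebra_simps)
      also have "p \<dots> \<le> c * p (\<lambda>w. x w + t * a w)"
        using c by (intro sublinear_onD(2)[OF p] fun_subspaceD[OF V] x aV) auto
      finally have "q (\<lambda>w. c * x w) \<le> c * s" unfolding s by (simp add: algebra_simps)
      then show ?thesis using c by (simp add: field_simps)
    qed
    then have "q (\<lambda>w. c * x w) / c \<le> q x"
      unfolding q_def[of x] by (intro cInf_greatest ne)
    then show ?thesis using c by (simp add: field_simps)
  qed
  show ?thesis
  proof (intro exI[of _ q] conjI ballI)
    show "sublinear_on V q" unfolding sublinear_on_def using sum scale by blast
    show "q x \<le> p x" if "x \<in> V" for x
      using A(3) upper[OF that, of _ 0] by auto
    show "q (\<lambda>w. - a w) \<le> - \<beta>" if "a \<in> A" for a
    proof -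
      have "(\<lambda>w. - a w) \<in> V" using that A fun_subspaceD(4)[OF V] by blast
      from upper[OF this that, of 1] show ?thesis using sublinear_on_zero[OF V p] by simp
    qed
  qed
qed

text \<open>Members of the chain are bounded below at \<open>x\<close> by \<open>-p (-x)\<close>.
  Subadditivity survives the infimum because two members always have one of them below both.\<close>

lemma sublinear_on_chain_Inf:
  assumes V: "fun_subspace V" and p: "sublinear_on V p" and "C \<noteq> {}"
    and C: "\<And>q. q \<in> C \<Longrightarrow> sublinear_on V q \<and> (\<forall>x\<in>V. q x \<le> p x)"
    and chain: "\<And>q r. q \<in> C \<Longrightarrow> r \<in> C \<Longrightarrow> (\<forall>x\<in>V. q x \<le> r x) \<or> (\<forall>x\<in>V. r x \<le> q x)"
  shows "sublinear_on V (\<lambda>x. INF q\<in>C. q x)" and "\<And>q x. q \<in> C \<Longrightarrow> x \<in> V \<Longrightarrow> (INF q\<in>C. q x) \<le> q x"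
proof -
  have "- p (\<lambda>w. - x w) \<le> q x" if "q \<in> C" "x \<in> V" for q x
  proof -
    have q: "sublinear_on V q" using C that by auto
    have "0 \<le> q x + q (\<lambda>w. - x w)"
      using sublinear_onD(1)[OF q that(2) fun_subspaceD(4)[OF V that(2)]]
        sublinear_on_zero[OF V q] by simp
    moreover have "q (\<lambda>w. - x w) \<le> p (\<lambda>w. - x w)"
      using C that fun_subspaceD(4)[OF V that(2)] by auto
    ultimately show ?thesis by simp
  qed
  then have bdd: "bdd_below ((\<lambda>q. q x) ` C)" if "x \<in> V" for x
    using that by (intro bdd_belowI2[where m = "- p (\<lambda>w. - x w)"]) auto
  show le: "(INF q\<in>C. q x) \<le> q x" if "q \<in> C" "x \<in> V" for q x
    using bdd that by (intro cINF_lower) auto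
  show "sublinear_on V (\<lambda>x. INF q\<in>C. q x)"
    unfolding sublinear_on_def
  proof (intro conjI ballI allI impI)
    fix x y assume xy: "x \<in> V" "y \<in> V"
    show "(INF q\<in>C. q (\<lambda>w. x w + y w)) \<le> (INF q\<in>C. q x) + (INF q\<in>C. q y)"
    proof (rule le_cInf_add)
      fix s t assume "s \<in> (\<lambda>q. q x) ` C" "t \<in> (\<lambda>q. q y) ` C"
      then obtain q r where qr: "q \<in> C" "r \<in> C" "s = q x" "t = r y" by auto
      obtain m where m: "m \<in> C" "\<forall>x\<in>V. m x \<le> q x" "\<forall>x\<in>V. m x \<le> r x"
        using chain[OF qr(1,2)] qr by auto
      have "(INF q\<in>C. q (\<lambda>w. x w + y w)) \<le> m (\<lambda>w. x w + y w)"
        using m xy fun_subspaceD(2)[OF V] by (intro le) auto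
      also have "\<dots> \<le> m x + m y" using C m xy sublinear_onD(1) by blast
      finally show "(INF q\<in>C. q (\<lambda>w. x w + y w)) \<le> s + t" using m qr xy by fastforce
    qed (use \<open>C \<noteq> {}\<close> in auto)
  next
    fix x and c :: real assume x: "x \<in> V" and c: "0 \<le> c"
    have *: "(INF q\<in>C. q (\<lambda>w. c * x w)) \<le> c * q x" if "q \<in> C" for q
      using le[OF that fun_subspaceD(3)[OF V x], of c] C that x c sublinear_onD(2) by fastforce
    show "(INF q\<in>C. q (\<lambda>w. c * x w)) \<le> c * (INF q\<in>C. q x)"
    proof (cases "c = 0")
      case True
      then show ?thesis using * \<open>C \<noteq> {}\<close> by auto
    next
      case False
      then have "(INF q\<in>C. q (\<lambda>w. c * x w)) / c \<le> (INF q\<in>C. q x)"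
        using * c \<open>C \<noteq> {}\<close> by (intro cINF_greatest) (auto simp: field_simps)
      then show ?thesis using False c by (simp add: field_simps)
    qed
  qed
qed

text \<open>Zorn's lemma. Candidates are normalised to 0 outside \<open>V\<close>; otherwise values
  there could be lowered for ever and nothing would be minimal.\<close>

lemma exists_minimal_sublinear:
  assumes V: "fun_subspace V" and p: "sublinear_on V p"
  shows "\<exists>m. sublinear_on V m \<and> (\<forall>x\<in>V. m x \<le> p x) \<and>
    (\<forall>q. sublinear_on V q \<longrightarrow> (\<forall>x\<in>V. q x \<le> m x) \<longrightarrow> (\<forall>x\<in>V. q x = m x))"
proof -
  define A where "A = {q. (\<forall>x. x \<notin> V \<longrightarrow> q x = 0) \<and> sublinear_on V q \<and> (\<forall>x\<in>V. q x \<le> p x)}"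
  \<comment> \<open>The order is reversed, so that a maximal element for \<open>?P\<close> is a
    minimal functional.\<close>
  let ?P = "\<lambda>q r :: ('a \<Rightarrow> real) \<Rightarrow> real. r \<le> q"
  let ?ext = "\<lambda>q x. if x \<in> V then q x else (0::real)"
  have ext: "sublinear_on V (?ext q)" if "sublinear_on V q" for q
    using that fun_subspaceD(2,3)[OF V] unfolding sublinear_on_def by auto
  have "\<exists>m\<in>A. \<forall>a\<in>A. ?P m a \<longrightarrow> a = m"
  proof (rule predicate_Zorn)
    show "partial_order_on A (relation_of ?P A)"
      by (rule partial_order_on_relation_ofI) auto
    fix C assume "C \<in> Chains (relation_of ?P A)"
    then have C: "C \<subseteq> A" "\<And>q r. q \<in> C \<Longrightarrow> r \<in> C \<Longrightarrow> q \<le> r \<or> r \<le> q"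
      unfolding Chains_def relation_of_def by auto
    show "\<exists>u\<in>A. \<forall>a\<in>C. ?P a u"
    proof (cases "C = {}")
      case True
      have "?ext p \<in> A" unfolding A_def using ext[OF p] by auto
      then show ?thesis using True by blast
    next
      case False
      let ?u = "\<lambda>x. INF q\<in>C. q x"
      have CA: "sublinear_on V q \<and> (\<forall>x\<in>V. q x \<le> p x)" if "q \<in> C" for q
        using C(1) that unfolding A_def by auto
      have ch: "(\<forall>x\<in>V. q x \<le> r x) \<or> (\<forall>x\<in>V. r x \<le> q x)" if "q \<in> C" "r \<in> C" for q r
        using C(2)[OF that] unfolding le_fun_def by auto
      have u: "sublinear_on V ?u" "\<And>q x. q \<in> C \<Longrightarrow> x \<in> V \<Longrightarrow> ?u x \<le> q x"
        by (rule sublinear_on_chain_Inf[OF V p False CA ch]; assumption)+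
      obtain q where "q \<in> C" using False by auto
      then have "?u x \<le> p x" if "x \<in> V" for x
        using u(2)[OF \<open>q \<in> C\<close> that] CA[OF \<open>q \<in> C\<close>] that by fastforce
      then have "?ext ?u \<in> A" unfolding A_def using ext[OF u(1)] by simp
      moreover have "?ext ?u \<le> q" if "q \<in> C" for q
        using u(2)[OF that] C(1) that unfolding A_def le_fun_def by auto
      ultimately show ?thesis by (intro bexI[of _ "?ext ?u"] ballI)
    qed
  qed
  then obtain m where m: "m \<in> A" "\<And>a. a \<in> A \<Longrightarrow> a \<le> m \<Longrightarrow> a = m" by blast
  show ?thesis
  proof (intro exI[of _ m] conjI allI impI ballI)
    show "sublinear_on V m" "\<And>x. x \<in> V \<Longrightarrow> m x \<le> p x" using m(1) unfolding A_def by auto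
    fix q x assume q: "sublinear_on V q" "\<forall>x\<in>V. q x \<le> m x" and x: "x \<in> V"
    have "q x \<le> p x" if "x \<in> V" for x
      using q(2) m(1) that unfolding A_def by fastforce
    then have "?ext q \<in> A" using ext[OF q(1)] unfolding A_def by simp
    moreover have "?ext q \<le> m" using q(2) m(1) unfolding A_def le_fun_def by auto
    ultimately have "?ext q = m" by (rule m(2))
    then have "?ext q x = m x" by (rule fun_cong)
    then show "q x = m x" using x by simp
  qed
qed

text \<open>A minimal sublinear \<open>m\<close> is linear: lowering it by
  \<open>sublinear_on_lower\<close> with the set \<open>{y}\<close> and \<open>\<beta> = m y\<close>
  changes nothing, hence \<open>m (-y) \<le> -m y\<close>, and oddness together with subadditivity
  gives additivity.\<close>

lemma dominated_linear_functional:
  assumes V: "fun_subspace V" and p: "sublinear_on V p"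
  obtains \<phi> where "linear_on_funs V \<phi>" "\<And>x. x \<in> V \<Longrightarrow> \<phi> x \<le> p x"
proof -
  obtain m where m: "sublinear_on V m" "\<And>x. x \<in> V \<Longrightarrow> m x \<le> p x"
    and min: "\<And>q x. sublinear_on V q \<Longrightarrow> \<forall>x\<in>V. q x \<le> m x \<Longrightarrow> x \<in> V \<Longrightarrow> q x = m x"
    using exists_minimal_sublinear[OF V p] by blast
  have neg: "m (\<lambda>w. - y w) = - m y" if y: "y \<in> V" for y
  proof -
    have "convex_funs {y}" unfolding convex_funs_def by (auto simp: algebra_simps)
    then obtain q where q: "sublinear_on V q" "\<forall>x\<in>V. q x \<le> m x" "q (\<lambda>w. - y w) \<le> - m y"
      using sublinear_on_lower[OF V m(1), of "{y}" "m y"] y by auto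
    have "m (\<lambda>w. - y w) \<le> - m y" using min[OF q(1,2) fun_subspaceD(4)[OF V y]] q(3) by simp
    moreover have "0 \<le> m y + m (\<lambda>w. - y w)"
      using sublinear_onD(1)[OF m(1) y fun_subspaceD(4)[OF V y]] sublinear_on_zero[OF V m(1)] by simp
    ultimately show ?thesis by simp
  qed
  have "linear_on_funs V m"
    unfolding linear_on_funs_def
  proof (intro conjI ballI allI)
    fix x y assume xy: "x \<in> V" "y \<in> V"
    have "m x \<le> m (\<lambda>w. x w + y w) + m (\<lambda>w. - y w)"
      using sublinear_onD(1)[OF m(1) fun_subspaceD(2)[OF V xy] fun_subspaceD(4)[OF V xy(2)]] by simp
    then show "m (\<lambda>w. x w + y w) = m x + m y"
      using neg[OF xy(2)] sublinear_onD(1)[OF m(1) xy] by simp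
  next
    fix x and c :: real assume x: "x \<in> V"
    show "m (\<lambda>w. c * x w) = c * m x"
    proof (cases "c \<ge> 0")
      case True
      then show ?thesis using sublinear_on_scale[OF V m(1) x] by simp
    next
      case False
      then have "m (\<lambda>w. - c * x w) = - c * m x"
        using sublinear_on_scale[OF V m(1) x, of "- c"] by simp
      then show ?thesis using neg[OF fun_subspaceD(3)[OF V x, of c]] by simp
    qed
  qed
  then show thesis using m(2) that by blast
qed

lemma linear_on_funs_neg:
  assumes "linear_on_funs V \<phi>" "x \<in> V"
  shows "\<phi> (\<lambda>w. - x w) = - \<phi> x"
proof -
  have "\<phi> (\<lambda>w. (- 1) * x w) = (- 1) * \<phi> x" using assms unfolding linear_on_funs_def by blast
  then show ?thesis by simp
qed

text \<open>This is the Mazur--Orlicz form of Hahn--Banach: the bound on \<open>A\<close> is first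
  absorbed into the sublinear functional, then any linear functional below the result works.\<close>

theorem Hahn_Banach_separation:
  assumes V: "fun_subspace V" and p: "sublinear_on V p"
    and A: "A \<subseteq> V" "convex_funs A" "A \<noteq> {}" and \<beta>: "\<And>a. a \<in> A \<Longrightarrow> \<beta> \<le> p a"
  obtains \<phi> where "linear_on_funs V \<phi>" "\<And>x. x \<in> V \<Longrightarrow> \<phi> x \<le> p x" "\<And>a. a \<in> A \<Longrightarrow> \<beta> \<le> \<phi> a"
proof -
  obtain q where q: "sublinear_on V q" "\<And>x. x \<in> V \<Longrightarrow> q x \<le> p x"
    "\<And>a. a \<in> A \<Longrightarrow> q (\<lambda>w. - a w) \<le> - \<beta>"
    using sublinear_on_lower[OF V p A \<beta>] by blast
  obtain \<phi> where \<phi>: "linear_on_funs V \<phi>" "\<And>x. x \<in> V \<Longrightarrow> \<phi> x \<le> q x"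
    by (rule dominated_linear_functional[OF V q(1)], rule that, assumption+)
  show thesis
  proof
    show "\<phi> x \<le> p x" if "x \<in> V" for x using \<phi>(2) q(2) that order_trans by blast
    show "\<beta> \<le> \<phi> a" if "a \<in> A" for a
    proof -
      have "a \<in> V" using A that by auto
      then show ?thesis
        using \<phi>(2)[OF fun_subspaceD(4)[OF V \<open>a \<in> V\<close>]] q(3)[OF that] linear_on_funs_neg[OF \<phi>(1)]
        by fastforce
    qed
  qed (rule \<phi>(1))
qed

subsection \<open>Signed measures and their integrals\<close>

lemma caD:
  assumes "\<mu> \<in> ca M"
  shows "A \<notin> sets M \<Longrightarrow> \<mu> A = 0"
    "range B \<subseteq> sets M \<Longrightarrow> disjoint_family B \<Longrightarrow> (\<lambda>n. \<mu> (B n)) sums \<mu> (\<Union>n::nat. B n)"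
  using assms unfolding ca_def by auto

lemma ca_empty: assumes "\<mu> \<in> ca M" shows "\<mu> {} = 0"
proof -
  have "(\<lambda>n::nat. \<mu> {}) sums \<mu> (\<Union>n::nat. {})"
    using caD(2)[OF assms, of "\<lambda>_. {}"] by (auto simp: disjoint_family_on_def)
  then have "(\<lambda>n::nat. \<mu> {}) \<longlonglongrightarrow> 0" by (intro summable_LIMSEQ_zero sums_summable)
  then show ?thesis by (simp add: LIMSEQ_const_iff)
qed

lemma ca_Un:
  assumes \<mu>: "\<mu> \<in> ca M" and AB: "A \<in> sets M" "B \<in> sets M" "A \<inter> B = {}"
  shows "\<mu> (A \<union> B) = \<mu> A + \<mu> B"
proof -
  have "(\<lambda>n. \<mu> (binaryset A B n)) sums \<mu> (\<Union>n. binaryset A B n)"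
    using AB by (intro caD(2)[OF \<mu>]) (auto simp: range_binaryset_eq disjoint_family_on_def binaryset_def)
  moreover have "(\<lambda>n. \<mu> (binaryset A B n)) sums (\<mu> A + \<mu> B)"
    using binaryset_sums[where f = \<mu>, OF ca_empty[OF \<mu>]] .
  ultimately show ?thesis by (metis UN_binaryset_eq sums_unique2)
qed

lemma ca_Diff:
  assumes \<mu>: "\<mu> \<in> ca M" and AB: "A \<in> sets M" "B \<in> sets M" "B \<subseteq> A"
  shows "\<mu> (A - B) = \<mu> A - \<mu> B"
proof -
  have "\<mu> (B \<union> (A - B)) = \<mu> B + \<mu> (A - B)"
    using AB by (intro ca_Un[OF \<mu>]) auto
  moreover have "B \<union> (A - B) = A" using AB by auto
  ultimately show ?thesis by simp
qed

lemma ca_uminus: "\<mu> \<in> ca M \<Longrightarrow> (\<lambda>A. - \<mu> A) \<in> ca M"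
  unfolding ca_def using sums_minus by auto

lemma ca_lincomb:
  "\<mu> \<in> ca M \<Longrightarrow> \<nu> \<in> ca M \<Longrightarrow> (\<lambda>A. a * \<mu> A + b * \<nu> A) \<in> ca M"
  unfolding ca_def by (auto intro!: sums_add sums_mult)

lemma measure_in_ca:
  assumes "finite_measure Q" "sets Q = sets M"
  shows "measure Q \<in> ca M"
proof -
  interpret finite_measure Q by fact
  show ?thesis
    unfolding ca_def using assms by (auto simp: measure_notin_sets intro: finite_measure_UNION)
qed

text \<open>If \<mu> is unbounded on subsets of \<open>A\<close>, choose \<open>B\<close> with
  \<open>\<bar>\<mu> B\<bar> > \<bar>\<mu> A\<bar> + 1\<close>. Then \<open>B\<close> and
  \<open>A - B\<close> both carry more than 1 in absolute value, and \<mu> stays unbounded on at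
  least one of them; that one is kept.\<close>

lemma ca_unbounded_split:
  assumes \<mu>: "\<mu> \<in> ca M" and A: "A \<in> sets M"
    and unb: "\<And>K. \<exists>B\<in>sets M. B \<subseteq> A \<and> K < \<bar>\<mu> B\<bar>"
  shows "\<exists>B\<in>sets M. B \<subseteq> A \<and> 1 < \<bar>\<mu> (A - B)\<bar> \<and> (\<forall>K. \<exists>C\<in>sets M. C \<subseteq> B \<and> K < \<bar>\<mu> C\<bar>)"
proof -
  obtain B where B: "B \<in> sets M" "B \<subseteq> A" "\<bar>\<mu> A\<bar> + 1 < \<bar>\<mu> B\<bar>" using unb by blast
  have D: "\<mu> (A - B) = \<mu> A - \<mu> B" by (rule ca_Diff[OF \<mu> A B(1,2)])
  show ?thesis
  proof (cases "\<forall>K. \<exists>C\<in>sets M. C \<subseteq> B \<and> K < \<bar>\<mu> C\<bar>")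
    case True
    then show ?thesis using B D by (intro bexI[of _ B]) auto
  next
    case False
    then obtain K where K: "\<And>C. C \<in> sets M \<Longrightarrow> C \<subseteq> B \<Longrightarrow> \<bar>\<mu> C\<bar> \<le> K" by (meson linorder_not_less)
    have "\<exists>C\<in>sets M. C \<subseteq> A - B \<and> L < \<bar>\<mu> C\<bar>" for L
    proof -
      obtain E where E: "E \<in> sets M" "E \<subseteq> A" "L + K < \<bar>\<mu> E\<bar>" using unb by blast
      have "\<mu> ((E \<inter> B) \<union> (E - B)) = \<mu> (E \<inter> B) + \<mu> (E - B)"
        using E B by (intro ca_Un[OF \<mu>]) auto
      moreover have "(E \<inter> B) \<union> (E - B) = E" by auto
      moreover have "\<bar>\<mu> (E \<inter> B)\<bar> \<le> K" using E B by (intro K) auto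
      ultimately have "L < \<bar>\<mu> (E - B)\<bar>"
        using E(3) abs_triangle_ineq[of "\<mu> (E \<inter> B)" "\<mu> (E - B)"] by simp
      then show ?thesis using E B by (intro bexI[of _ "E - B"]) auto
    qed
    moreover have "A - (A - B) = B" using B by auto
    ultimately show ?thesis using B A by (intro bexI[of _ "A - B"]) auto
  qed
qed

text \<open>Iterated splitting gives a decreasing sequence whose successive differences are disjoint
  and have values above 1 in modulus, so their series cannot converge. The bound makes the suprema
  defining the variations finite.\<close>

lemma ca_bounded:
  assumes \<mu>: "\<mu> \<in> ca M"
  shows "\<exists>K. \<forall>B. \<bar>\<mu> B\<bar> \<le> K"
proof -
  have "\<exists>K. \<forall>B\<in>sets M. \<bar>\<mu> B\<bar> \<le> K"
  proof (rule ccontr)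
    assume "\<not> ?thesis"
    then have unb: "\<exists>B\<in>sets M. K < \<bar>\<mu> B\<bar>" for K by (meson linorder_not_less)
    define U where "U A \<longleftrightarrow> A \<in> sets M \<and> (\<forall>K. \<exists>C\<in>sets M. C \<subseteq> A \<and> K < \<bar>\<mu> C\<bar>)" for A
    have "\<exists>A. \<forall>n. U (A n) \<and> (A (Suc n) \<subseteq> A n \<and> 1 < \<bar>\<mu> (A n - A (Suc n))\<bar>)"
    proof (rule dependent_nat_choice)
      have "U (space M)" unfolding U_def using unb sets.sets_into_space by (meson sets.top)
      then show "\<exists>x. U x" ..
      fix A :: "'a set" and n :: nat assume "U A"
      then show "\<exists>B. U B \<and> (B \<subseteq> A \<and> 1 < \<bar>\<mu> (A - B)\<bar>)"
        using ca_unbounded_split[OF \<mu>, of A] unfolding U_def by blast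
    qed
    then obtain A where A: "\<And>n. A n \<in> sets M" "\<And>n. A (Suc n) \<subseteq> A n"
      "\<And>n. 1 < \<bar>\<mu> (A n - A (Suc n))\<bar>" unfolding U_def by blast
    have anti: "m \<le> n \<Longrightarrow> A n \<subseteq> A m" for m n using lift_Suc_antimono_le[of A] A(2) by blast
    have "disjoint_family (\<lambda>n. A n - A (Suc n))"
    proof (unfold disjoint_family_on_def, intro ballI impI)
      fix m n :: nat assume "m \<noteq> n"
      then show "(A m - A (Suc m)) \<inter> (A n - A (Suc n)) = {}"
        using anti[of "Suc m" n] anti[of "Suc n" m] by (cases m n rule: linorder_cases) auto
    qed
    then have "(\<lambda>n. \<mu> (A n - A (Suc n))) sums \<mu> (\<Union>n. A n - A (Suc n))"
      using A(1) by (intro caD(2)[OF \<mu>]) auto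
    then have "(\<lambda>n. \<mu> (A n - A (Suc n))) \<longlonglongrightarrow> 0" by (intro summable_LIMSEQ_zero sums_summable)
    then have "\<forall>\<^sub>F n in sequentially. \<bar>\<mu> (A n - A (Suc n))\<bar> < 1"
      using order_tendstoD(2)[OF tendsto_rabs_zero, of _ _ 1] by simp
    then show False using A(3) by (auto simp: eventually_sequentially) (meson less_asym order_refl)
  qed
  then obtain K where K: "\<And>B. B \<in> sets M \<Longrightarrow> \<bar>\<mu> B\<bar> \<le> K" by blast
  have "\<bar>\<mu> B\<bar> \<le> max K 0" for B using K[of B] caD(1)[OF \<mu>, of B] by (cases "B \<in> sets M") auto
  then show ?thesis by blast
qed

text \<open>The real-valued counterpart of the supremum inside \<open>pos_variation\<close>.
  Additivity and the Jordan identity are proved here, where subtraction is available, and then moved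
  to extended nonnegative reals.\<close>

definition pos_var :: "'a measure \<Rightarrow> ('a set \<Rightarrow> real) \<Rightarrow> 'a set \<Rightarrow> real" where
  "pos_var M \<mu> A = (SUP B\<in>{B \<in> sets M. B \<subseteq> A}. \<mu> B)"

lemma pos_var_upper:
  assumes \<mu>: "\<mu> \<in> ca M" and "B \<in> sets M" "B \<subseteq> A"
  shows "\<mu> B \<le> pos_var M \<mu> A"
proof -
  obtain K where K: "\<And>B. \<bar>\<mu> B\<bar> \<le> K" using ca_bounded[OF \<mu>] by blast
  have "\<mu> B \<le> K" for B using K[of B] by simp
  then show ?thesis unfolding pos_var_def using assms by (intro cSUP_upper bdd_aboveI2[of _ _ K]) auto
qed

lemma pos_var_least: "(\<And>B. B \<in> sets M \<Longrightarrow> B \<subseteq> A \<Longrightarrow> \<mu> B \<le> c) \<Longrightarrow> pos_var M \<mu> A \<le> c"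
  unfolding pos_var_def by (intro cSUP_least) auto

lemma pos_var_nonneg: "\<mu> \<in> ca M \<Longrightarrow> 0 \<le> pos_var M \<mu> A"
  using pos_var_upper[of \<mu> M "{}" A] ca_empty by fastforce

lemma pos_var_approx:
  assumes "e > 0"
  obtains B where "B \<in> sets M" "B \<subseteq> A" "pos_var M \<mu> A - e < \<mu> B"
proof (rule ccontr)
  assume "\<not> thesis"
  then have "pos_var M \<mu> A \<le> pos_var M \<mu> A - e" using that by (intro pos_var_least) fastforce
  then show False using assms by simp
qed

lemma pos_var_Un:
  assumes \<mu>: "\<mu> \<in> ca M" and AB: "A \<in> sets M" "B \<in> sets M" "A \<inter> B = {}"
  shows "pos_var M \<mu> (A \<union> B) = pos_var M \<mu> A + pos_var M \<mu> B"
proof (rule antisym)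
  show "pos_var M \<mu> (A \<union> B) \<le> pos_var M \<mu> A + pos_var M \<mu> B"
  proof (rule pos_var_least)
    fix C assume C: "C \<in> sets M" "C \<subseteq> A \<union> B"
    have "\<mu> ((C \<inter> A) \<union> (C \<inter> B)) = \<mu> (C \<inter> A) + \<mu> (C \<inter> B)"
      using C AB by (intro ca_Un[OF \<mu>]) auto
    moreover have "(C \<inter> A) \<union> (C \<inter> B) = C" using C by auto
    moreover have "\<mu> (C \<inter> A) \<le> pos_var M \<mu> A" "\<mu> (C \<inter> B) \<le> pos_var M \<mu> B"
      using C AB by (auto intro!: pos_var_upper[OF \<mu>])
    ultimately show "\<mu> C \<le> pos_var M \<mu> A + pos_var M \<mu> B" by simp
  qed
  show "pos_var M \<mu> A + pos_var M \<mu> B \<le> pos_var M \<mu> (A \<union> B)"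
  proof (rule field_le_epsilon)
    fix e :: real assume "e > 0"
    then have e: "e / 2 > 0" by simp
    obtain C where C: "C \<in> sets M" "C \<subseteq> A" "pos_var M \<mu> A - e / 2 < \<mu> C" by (rule pos_var_approx[OF e])
    obtain D where D: "D \<in> sets M" "D \<subseteq> B" "pos_var M \<mu> B - e / 2 < \<mu> D" by (rule pos_var_approx[OF e])
    have "\<mu> (C \<union> D) = \<mu> C + \<mu> D" using C D AB by (intro ca_Un[OF \<mu>]) auto
    moreover have "\<mu> (C \<union> D) \<le> pos_var M \<mu> (A \<union> B)" using C D by (intro pos_var_upper[OF \<mu>]) auto
    ultimately show "pos_var M \<mu> A + pos_var M \<mu> B \<le> pos_var M \<mu> (A \<union> B) + e"
      using C D by (simp add: field_simps)
  qed
qed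

lemma pos_var_mono: "\<mu> \<in> ca M \<Longrightarrow> A \<subseteq> B \<Longrightarrow> pos_var M \<mu> A \<le> pos_var M \<mu> B"
  by (intro pos_var_least pos_var_upper) auto

lemma pos_var_sums:
  assumes \<mu>: "\<mu> \<in> ca M" and A: "range A \<subseteq> sets M" "disjoint_family (A :: nat \<Rightarrow> _)"
  shows "(\<lambda>n. pos_var M \<mu> (A n)) sums pos_var M \<mu> (\<Union>n. A n)"
proof -
  have fin: "(\<Sum>i<n. pos_var M \<mu> (A i)) = pos_var M \<mu> (\<Union>i<n. A i)" for n
  proof (induction n)
    case 0
    have "pos_var M \<mu> {} \<le> 0" using ca_empty[OF \<mu>] by (intro pos_var_least) auto
    then show ?case using pos_var_nonneg[OF \<mu>, of "{}"] by auto
  next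
    case (Suc n)
    have "A i \<inter> A n = {}" if "i < n" for i
      using disjoint_family_onD[OF A(2), of i n] that by simp
    then have "(\<Union>i<n. A i) \<inter> A n = {}" by blast
    then have "pos_var M \<mu> ((\<Union>i<n. A i) \<union> A n) = pos_var M \<mu> (\<Union>i<n. A i) + pos_var M \<mu> (A n)"
      using A(1) by (intro pos_var_Un[OF \<mu>] sets.finite_UN) auto
    moreover have "(\<Union>i<n. A i) \<union> A n = (\<Union>i<Suc n. A i)" by (auto simp: lessThan_Suc)
    ultimately show ?case using Suc by simp
  qed
  have bound: "(\<Sum>i<n. pos_var M \<mu> (A i)) \<le> pos_var M \<mu> (\<Union>n. A n)" for n
    unfolding fin by (intro pos_var_mono[OF \<mu>]) auto
  have summ: "summable (\<lambda>n. pos_var M \<mu> (A n))"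
    by (rule summableI_nonneg_bounded[OF pos_var_nonneg[OF \<mu>] bound])
  moreover have "(\<Sum>n. pos_var M \<mu> (A n)) = pos_var M \<mu> (\<Union>n. A n)"
  proof (rule antisym)
    show "(\<Sum>n. pos_var M \<mu> (A n)) \<le> pos_var M \<mu> (\<Union>n. A n)"
      using summ bound by (intro suminf_le_const) auto
    show "pos_var M \<mu> (\<Union>n. A n) \<le> (\<Sum>n. pos_var M \<mu> (A n))"
    proof (rule pos_var_least)
      fix B assume B: "B \<in> sets M" "B \<subseteq> (\<Union>n. A n)"
      have "(\<lambda>n. \<mu> (B \<inter> A n)) sums \<mu> (\<Union>n. B \<inter> A n)"
        using A B by (intro caD(2)[OF \<mu>]) (auto simp: disjoint_family_on_def)
      moreover have "(\<Union>n. B \<inter> A n) = B" using B by auto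
      ultimately have s: "(\<lambda>n. \<mu> (B \<inter> A n)) sums \<mu> B" by simp
      show "\<mu> B \<le> (\<Sum>n. pos_var M \<mu> (A n))"
        using A B by (intro sums_le[OF _ s summable_sums[OF summ]] pos_var_upper[OF \<mu>]) auto
    qed
  qed
  ultimately show ?thesis by (simp add: sums_iff)
qed

text \<open>For \<open>B \<subseteq> A\<close> one has
  \<open>\<mu> B = \<mu> A - \<mu> (A - B)\<close>, which is at most \<mu> A plus the negative
  variation. The supremum over \<open>B\<close> gives one inequality and the same for
  \<open>-\<mu>\<close> the other, so a Hahn decomposition is avoided.\<close>

lemma pos_var_diff:
  assumes \<mu>: "\<mu> \<in> ca M" and A: "A \<in> sets M"
  shows "pos_var M \<mu> A - pos_var M (\<lambda>A. - \<mu> A) A = \<mu> A"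
proof -
  have le: "pos_var M \<mu> A \<le> \<mu> A + pos_var M (\<lambda>A. - \<mu> A) A" if \<mu>: "\<mu> \<in> ca M" for \<mu>
  proof (rule pos_var_least)
    fix B assume B: "B \<in> sets M" "B \<subseteq> A"
    have "- \<mu> (A - B) \<le> pos_var M (\<lambda>A. - \<mu> A) A"
      using A B by (intro pos_var_upper[OF ca_uminus[OF \<mu>]]) auto
    then show "\<mu> B \<le> \<mu> A + pos_var M (\<lambda>A. - \<mu> A) A" using ca_Diff[OF \<mu> A B] by simp
  qed
  show ?thesis using le[OF \<mu>] le[OF ca_uminus[OF \<mu>]] by simp
qed

text \<open>\<open>measure_of\<close> returns the intended values only once its set function is
  known to be countably additive; that comes from \<open>pos_var_sums\<close>, after the truncated
  supremum has been identified with \<open>pos_var\<close>.\<close>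

lemma pos_variation:
  assumes \<mu>: "\<mu> \<in> ca M"
  shows sets_pos_variation: "sets (pos_variation M \<mu>) = sets M"
    and space_pos_variation: "space (pos_variation M \<mu>) = space M"
    and emeasure_pos_variation:
      "A \<in> sets M \<Longrightarrow> emeasure (pos_variation M \<mu>) A = ennreal (pos_var M \<mu> A)"
    and finite_pos_variation: "finite_measure (pos_variation M \<mu>)"
proof -
  obtain K where K: "\<And>B. \<bar>\<mu> B\<bar> \<le> K" using ca_bounded[OF \<mu>] by blast
  have "\<mu> B \<le> K" for B using K[of B] by simp
  then have bdd: "bdd_above (\<mu> ` {B \<in> sets M. B \<subseteq> A})" for A by (intro bdd_aboveI2[of _ _ K]) auto
  have eq: "(SUP B\<in>{B \<in> sets M. B \<subseteq> A}. ennreal (\<mu> B)) = ennreal (pos_var M \<mu> A)" for A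
  proof (rule antisym)
    show "(SUP B\<in>{B \<in> sets M. B \<subseteq> A}. ennreal (\<mu> B)) \<le> ennreal (pos_var M \<mu> A)"
      by (intro SUP_least ennreal_leI pos_var_upper[OF \<mu>]) auto
    show "ennreal (pos_var M \<mu> A) \<le> (SUP B\<in>{B \<in> sets M. B \<subseteq> A}. ennreal (\<mu> B))"
    proof (rule ennreal_le_epsilon)
      fix e :: real assume e: "0 < e"
      obtain B where B: "B \<in> sets M" "B \<subseteq> A" "pos_var M \<mu> A - e < \<mu> B" by (rule pos_var_approx[OF e])
      have "ennreal (pos_var M \<mu> A) \<le> ennreal (max 0 (\<mu> B) + e)" using B by (intro ennreal_leI) auto
      also have "\<dots> = ennreal (\<mu> B) + ennreal e"
        using e by (subst ennreal_plus) (auto simp: max_def ennreal_neg)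
      also have "\<dots> \<le> (SUP B\<in>{B \<in> sets M. B \<subseteq> A}. ennreal (\<mu> B)) + ennreal e"
        using B by (intro add_right_mono SUP_upper) auto
      finally show "ennreal (pos_var M \<mu> A) \<le> (SUP B\<in>{B \<in> sets M. B \<subseteq> A}. ennreal (\<mu> B)) + ennreal e" .
    qed
  qed
  show 1: "sets (pos_variation M \<mu>) = sets M" and 2: "space (pos_variation M \<mu>) = space M"
    unfolding pos_variation_def by (simp_all add: sets.space_closed sets_measure_of_conv space_measure_of_conv sets.sigma_sets_eq)
  show 3: "emeasure (pos_variation M \<mu>) A = ennreal (pos_var M \<mu> A)" if "A \<in> sets M" for A
  proof (rule emeasure_measure_of[OF _ _ _ _ that[folded 1]])
    show "pos_variation M \<mu> = measure_of (space M) (sets M) (\<lambda>A. ennreal (pos_var M \<mu> A))"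
      unfolding pos_variation_def eq ..
    show "sets M \<subseteq> Pow (space M)" by (rule sets.space_closed)
    have "pos_var M \<mu> {} \<le> 0" using ca_empty[OF \<mu>] by (intro pos_var_least) auto
    then show "positive (sets (pos_variation M \<mu>)) (\<lambda>A. ennreal (pos_var M \<mu> A))"
      unfolding positive_def by (simp add: ennreal_neg)
    show "countably_additive (sets (pos_variation M \<mu>)) (\<lambda>A. ennreal (pos_var M \<mu> A))"
      unfolding 1
    proof (rule countably_additiveI)
      fix A :: "nat \<Rightarrow> 'a set" assume "range A \<subseteq> sets M" "disjoint_family A"
      from pos_var_sums[OF \<mu> this] pos_var_nonneg[OF \<mu>]
      show "(\<Sum>i. ennreal (pos_var M \<mu> (A i))) = ennreal (pos_var M \<mu> (\<Union>i. A i))"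
        by (intro suminf_ennreal_eq) auto
    qed
  qed
  show "finite_measure (pos_variation M \<mu>)"
    by (rule finite_measureI) (simp add: 2 3)
qed

lemma measure_pos_variation:
  "\<mu> \<in> ca M \<Longrightarrow> A \<in> sets M \<Longrightarrow> measure (pos_variation M \<mu>) A = pos_var M \<mu> A"
  by (simp add: measure_def emeasure_pos_variation pos_var_nonneg)

section \<open>Bounded measurable functions\<close>

lemma bmeasI: "X \<in> borel_measurable M \<Longrightarrow> (\<And>w. w \<in> space M \<Longrightarrow> \<bar>X w\<bar> \<le> K) \<Longrightarrow> X \<in> bmeas M"
  unfolding bmeas_def by blast

lemma bmeas_measurable: "X \<in> bmeas M \<Longrightarrow> X \<in> borel_measurable M"
  unfolding bmeas_def by blast

lemma bmeas_bound:
  assumes "X \<in> bmeas M"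
  obtains K where "K > 0" "\<And>w. w \<in> space M \<Longrightarrow> \<bar>X w\<bar> \<le> K"
proof -
  obtain K where "\<And>w. w \<in> space M \<Longrightarrow> \<bar>X w\<bar> \<le> K" using assms unfolding bmeas_def by blast
  then show thesis by (intro that[of "\<bar>K\<bar> + 1"]) force+
qed

lemma bmeas_const: "(\<lambda>_. c) \<in> bmeas M"
  by (rule bmeasI[of _ _ "\<bar>c\<bar>"]) auto

lemma bmeas_indicator: "A \<in> sets M \<Longrightarrow> indicator A \<in> bmeas M"
  by (rule bmeasI[of _ _ 1]) (auto simp: indicator_def)

lemma bmeas_add:
  assumes "X \<in> bmeas M" "Y \<in> bmeas M" shows "(\<lambda>w. X w + Y w) \<in> bmeas M"
proof -
  obtain K where K: "\<And>w. w \<in> space M \<Longrightarrow> \<bar>X w\<bar> \<le> K" using bmeas_bound[OF assms(1)] by blast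
  obtain L where L: "\<And>w. w \<in> space M \<Longrightarrow> \<bar>Y w\<bar> \<le> L" using bmeas_bound[OF assms(2)] by blast
  show ?thesis using bmeas_measurable[OF assms(1)] bmeas_measurable[OF assms(2)] K L
    by (intro bmeasI[of _ _ "K + L"]) (auto intro: abs_triangle_ineq[THEN order_trans] add_mono)
qed

lemma bmeas_scale:
  assumes "X \<in> bmeas M" shows "(\<lambda>w. c * X w) \<in> bmeas M"
proof -
  obtain K where K: "\<And>w. w \<in> space M \<Longrightarrow> \<bar>X w\<bar> \<le> K" using bmeas_bound[OF assms(1)] by blast
  show ?thesis using bmeas_measurable[OF assms(1)] K
    by (intro bmeasI[of _ _ "\<bar>c\<bar> * K"]) (auto simp: abs_mult intro: mult_left_mono)
qed

lemma fun_subspace_bmeas: "fun_subspace (bmeas M)"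
  unfolding fun_subspace_def using bmeas_const bmeas_add bmeas_scale by blast

lemma bmeas_uminus: "X \<in> bmeas M \<Longrightarrow> (\<lambda>w. - X w) \<in> bmeas M"
  and bmeas_diff: "X \<in> bmeas M \<Longrightarrow> Y \<in> bmeas M \<Longrightarrow> (\<lambda>w. X w - Y w) \<in> bmeas M"
  by (fact fun_subspaceD[OF fun_subspace_bmeas])+

lemma bmeas_min:
  assumes "X \<in> bmeas M" "Y \<in> bmeas M" shows "(\<lambda>w. min (X w) (Y w)) \<in> bmeas M"
proof -
  obtain K where K: "\<And>w. w \<in> space M \<Longrightarrow> \<bar>X w\<bar> \<le> K" using bmeas_bound[OF assms(1)] by blast
  obtain L where L: "\<And>w. w \<in> space M \<Longrightarrow> \<bar>Y w\<bar> \<le> L" using bmeas_bound[OF assms(2)] by blast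
  have "\<bar>min (X w) (Y w)\<bar> \<le> max K L" if "w \<in> space M" for w
    using K[OF that] L[OF that] by (auto simp: min_def le_max_iff_disj)
  then show ?thesis using bmeas_measurable[OF assms(1)] bmeas_measurable[OF assms(2)]
    by (intro bmeasI[of _ _ "max K L"]) auto
qed

lemma bmeas_max:
  assumes "X \<in> bmeas M" "Y \<in> bmeas M" shows "(\<lambda>w. max (X w) (Y w)) \<in> bmeas M"
proof -
  have "(\<lambda>w. - min (- X w) (- Y w)) \<in> bmeas M"
    by (intro bmeas_uminus bmeas_min assms)
  moreover have "(\<lambda>w. - min (- X w) (- Y w)) = (\<lambda>w. max (X w) (Y w))" by (auto simp: fun_eq_iff)
  ultimately show ?thesis by simp
qed

lemma integrable_bmeas:
  assumes "finite_measure Q" "sets Q = sets M" "X \<in> bmeas M"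
  shows "integrable Q X"
proof -
  interpret finite_measure Q by fact
  obtain K where K: "\<And>w. w \<in> space M \<Longrightarrow> \<bar>X w\<bar> \<le> K" using bmeas_bound[OF assms(3)] by blast
  have [measurable]: "X \<in> borel_measurable Q"
    using bmeas_measurable[OF assms(3)] measurable_cong_sets[OF assms(2) refl] by blast
  show ?thesis
    using K sets_eq_imp_space_eq[OF assms(2)] by (intro integrable_const_bound[where B = K]) auto
qed

text \<open>A bounded function is uniformly approximated by \<open>\<lfloor>nX\<rfloor>/n\<close>.\<close>

lemma linear_bmeas_zero:
  assumes lin: "linear_on_funs (bmeas M) L"
    and bound: "\<And>X K. X \<in> bmeas M \<Longrightarrow> (\<And>w. w \<in> space M \<Longrightarrow> \<bar>X w\<bar> \<le> K) \<Longrightarrow> \<bar>L X\<bar> \<le> C * K"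
    and ind: "\<And>A. A \<in> sets M \<Longrightarrow> L (indicator A) = 0" and X: "X \<in> bmeas M"
  shows "L X = 0"
proof -
  have add: "L (\<lambda>w. Y w + Z w) = L Y + L Z" if "Y \<in> bmeas M" "Z \<in> bmeas M" for Y Z
    using lin that unfolding linear_on_funs_def by blast
  have scale: "L (\<lambda>w. c * Y w) = c * L Y" if "Y \<in> bmeas M" for Y c
    using lin that unfolding linear_on_funs_def by blast
  have sum: "(\<lambda>w. \<Sum>i\<in>I. c i * indicator (A i) w) \<in> bmeas M \<and>
      L (\<lambda>w. \<Sum>i\<in>I. c i * indicator (A i) w) = 0"
    if "finite I" "\<And>i. A i \<in> sets M" for I :: "int set" and c :: "int \<Rightarrow> real" and A
    using that(1)
  proof induction
    case empty
    then show ?case using scale[OF bmeas_const, of 0 0] bmeas_const[of 0] by simp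
  next
    case (insert i I)
    have m: "(\<lambda>w. c i * indicator (A i) w) \<in> bmeas M"
      using bmeas_scale[OF bmeas_indicator[OF that(2)[of i]], of "c i"] .
    have "L (\<lambda>w. c i * indicator (A i) w) = 0"
      using scale[OF bmeas_indicator[OF that(2)[of i]], of "c i"] ind[OF that(2)] by simp
    then show ?case
      using add[OF m conjunct1[OF insert(3)]] insert bmeas_add[OF m conjunct1[OF insert(3)]]
      by (simp del: sum_mult_indicator)
  qed
  obtain K where K: "K > 0" "\<And>w. w \<in> space M \<Longrightarrow> \<bar>X w\<bar> \<le> K" using bmeas_bound[OF X] by blast
  have [measurable]: "X \<in> borel_measurable M" using X by (rule bmeas_measurable)
  have le: "\<bar>L X\<bar> \<le> C * (1 / real (Suc n))" for n
  proof -
    define N where "N = real (Suc n)"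
    have N: "N > 0" unfolding N_def by simp
    \<comment> \<open>A finite index range containing every value of
      \<open>\<lfloor>N * X w\<rfloor>\<close>, since
      \<open>\<bar>X w\<bar> \<le> K\<close>.\<close>
    define I where "I = {- \<lceil>N * K\<rceil> .. \<lceil>N * K\<rceil>}"
    define A where "A i = {w \<in> space M. \<lfloor>N * X w\<rfloor> = i}" for i
    define S where "S w = (\<Sum>i\<in>I. (real_of_int i / N) * indicator (A i) w)" for w
    have "A i \<in> sets M" for i unfolding A_def by measurable
    then have S: "S \<in> bmeas M" "L S = 0"
      using sum[of I A "\<lambda>i. real_of_int i / N"] unfolding S_def[abs_def] I_def by auto
    have close: "\<bar>X w - S w\<bar> \<le> 1 / N" if w: "w \<in> space M" for w
    proof -
      have "\<bar>N * X w\<bar> \<le> N * K" using K(2)[OF w] N by (simp add: abs_mult)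
      then have I: "\<lfloor>N * X w\<rfloor> \<in> I" unfolding I_def by (auto simp: abs_le_iff) linarith+
      have "S w = (\<Sum>i\<in>I. if i = \<lfloor>N * X w\<rfloor> then real_of_int i / N else 0)"
        unfolding S_def using w by (intro sum.cong) (auto simp: A_def indicator_def)
      also have "\<dots> = real_of_int \<lfloor>N * X w\<rfloor> / N" using I by (simp add: I_def)
      finally have "N * (X w - S w) = N * X w - real_of_int \<lfloor>N * X w\<rfloor>" using N by (simp add: field_simps)
      then have "\<bar>N * (X w - S w)\<bar> \<le> 1" by linarith
      then have "N * \<bar>X w - S w\<bar> \<le> 1" using N by (simp only: abs_mult abs_of_pos)
      then show ?thesis using N by (simp add: pos_le_divide_eq mult.commute)
    qed
    have "L (\<lambda>w. X w + (- 1) * S w) = L X + (- 1) * L S"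
      using add[OF X bmeas_scale[OF S(1)], of "- 1"] scale[OF S(1), of "- 1"] by simp
    then have "L X = L (\<lambda>w. X w - S w)" using S(2) by simp
    then show ?thesis
      using bound[OF bmeas_diff[OF X S(1)] close] unfolding N_def by simp
  qed
  have "(\<lambda>n. C * (1 / real (Suc n))) \<longlonglongrightarrow> C * 0"
    by (intro tendsto_intros LIMSEQ_Suc lim_1_over_n[where 'a = real, simplified])
  then have "\<bar>L X\<bar> \<le> 0" using le by (intro LIMSEQ_le_const[where X = "\<lambda>n. C * (1 / real (Suc n))"]) auto
  then show ?thesis by simp
qed

section \<open>Integration against signed measures and the total variation\<close>

lemma signed_integral_linear:
  assumes \<mu>: "\<mu> \<in> ca M"
  shows "linear_on_funs (bmeas M) (signed_integral M \<mu>)"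
proof -
  note i = integrable_bmeas[OF finite_pos_variation sets_pos_variation]
  show ?thesis
    unfolding linear_on_funs_def signed_integral_def
    using i[OF \<mu> \<mu>] i[OF ca_uminus[OF \<mu>] ca_uminus[OF \<mu>]] by (simp add: algebra_simps)
qed

lemma signed_integral_indicator:
  assumes \<mu>: "\<mu> \<in> ca M" and A: "A \<in> sets M"
  shows "signed_integral M \<mu> (indicator A) = \<mu> A"
  unfolding signed_integral_def
  using A pos_var_diff[OF \<mu> A] sets.sets_into_space[OF A]
  by (simp add: measure_pos_variation[OF \<mu>] measure_pos_variation[OF ca_uminus[OF \<mu>]]
      space_pos_variation[OF \<mu>] space_pos_variation[OF ca_uminus[OF \<mu>]] Int_absorb2)

lemma signed_integral_bound:
  assumes \<mu>: "\<mu> \<in> ca M" and X: "X \<in> bmeas M" "\<And>w. w \<in> space M \<Longrightarrow> \<bar>X w\<bar> \<le> K"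
  shows "\<bar>signed_integral M \<mu> X\<bar> \<le> (pos_var M \<mu> (space M) + pos_var M (\<lambda>A. - \<mu> A) (space M)) * K"
proof -
  have *: "\<bar>integral\<^sup>L (pos_variation M \<nu>) X\<bar> \<le> pos_var M \<nu> (space M) * K" if \<nu>: "\<nu> \<in> ca M" for \<nu>
  proof -
    interpret finite_measure "pos_variation M \<nu>" by (rule finite_pos_variation[OF \<nu>])
    have int: "integrable (pos_variation M \<nu>) X"
      using \<nu> X by (intro integrable_bmeas[OF finite_pos_variation sets_pos_variation])
    have "\<bar>integral\<^sup>L (pos_variation M \<nu>) X\<bar> \<le> (\<integral>w. \<bar>X w\<bar> \<partial>pos_variation M \<nu>)"
      by (rule integral_abs_bound)
    also have "\<dots> \<le> (\<integral>w. K \<partial>pos_variation M \<nu>)"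
      using int X by (intro integral_mono) (auto simp: space_pos_variation[OF \<nu>])
    also have "\<dots> = pos_var M \<nu> (space M) * K"
      using \<nu> by (simp add: space_pos_variation measure_pos_variation)
    finally show ?thesis .
  qed
  show ?thesis using *[OF \<mu>] *[OF ca_uminus[OF \<mu>]] unfolding signed_integral_def
    by (simp add: algebra_simps)
qed

text \<open>Functionals bounded in the supremum norm are determined by their values on indicators.
  Every later identity between integrals is verified only there.\<close>

lemma linear_bmeas_eq:
  assumes lin: "linear_on_funs (bmeas M) L" "linear_on_funs (bmeas M) L'"
    and bound: "\<And>X K. X \<in> bmeas M \<Longrightarrow> (\<And>w. w \<in> space M \<Longrightarrow> \<bar>X w\<bar> \<le> K) \<Longrightarrow> \<bar>L X\<bar> \<le> C * K"
      "\<And>X K. X \<in> bmeas M \<Longrightarrow> (\<And>w. w \<in> space M \<Longrightarrow> \<bar>X w\<bar> \<le> K) \<Longrightarrow> \<bar>L' X\<bar> \<le> C' * K"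
    and ind: "\<And>A. A \<in> sets M \<Longrightarrow> L (indicator A) = L' (indicator A)" and X: "X \<in> bmeas M"
  shows "L X = L' X"
proof -
  have "(\<lambda>X. L X - L' X) X = 0"
  proof (rule linear_bmeas_zero[OF _ _ _ X])
    show "linear_on_funs (bmeas M) (\<lambda>X. L X - L' X)"
      using lin unfolding linear_on_funs_def by (auto simp: algebra_simps)
    show "\<bar>L X - L' X\<bar> \<le> (C + C') * K"
      if "X \<in> bmeas M" "\<And>w. w \<in> space M \<Longrightarrow> \<bar>X w\<bar> \<le> K" for X K
      using bound(1)[OF that] bound(2)[OF that] by (simp add: algebra_simps)
  qed (use ind in auto)
  then show ?thesis by simp
qed

text \<open>The Jordan parts of a combination are not the combination of the Jordan parts, so
  linearity in the measure cannot be read off the definition and is tested on indicators.\<close>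

lemma signed_integral_lincomb:
  assumes \<mu>: "\<mu> \<in> ca M" and \<nu>: "\<nu> \<in> ca M" and X: "X \<in> bmeas M"
  shows "signed_integral M (\<lambda>A. a * \<mu> A + b * \<nu> A) X
    = a * signed_integral M \<mu> X + b * signed_integral M \<nu> X"
proof (rule linear_bmeas_eq[OF _ _ _ _ _ X, where L = "signed_integral M (\<lambda>A. a * \<mu> A + b * \<nu> A)"
      and L' = "\<lambda>X. a * signed_integral M \<mu> X + b * signed_integral M \<nu> X"])
  have ab: "(\<lambda>A. a * \<mu> A + b * \<nu> A) \<in> ca M" by (rule ca_lincomb[OF \<mu> \<nu>])
  show "linear_on_funs (bmeas M) (signed_integral M (\<lambda>A. a * \<mu> A + b * \<nu> A))"
    by (rule signed_integral_linear[OF ab])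
  show "linear_on_funs (bmeas M) (\<lambda>X. a * signed_integral M \<mu> X + b * signed_integral M \<nu> X)"
    using signed_integral_linear[OF \<mu>] signed_integral_linear[OF \<nu>]
    unfolding linear_on_funs_def by (auto simp: algebra_simps)
  let ?v = "\<lambda>\<mu>. pos_var M \<mu> (space M) + pos_var M (\<lambda>A. - \<mu> A) (space M)"
  fix X K assume X: "X \<in> bmeas M" "\<And>w. w \<in> space M \<Longrightarrow> \<bar>X w\<bar> \<le> K"
  show "\<bar>signed_integral M (\<lambda>A. a * \<mu> A + b * \<nu> A) X\<bar> \<le> ?v (\<lambda>A. a * \<mu> A + b * \<nu> A) * K"
    by (rule signed_integral_bound[OF ab X])
  have "\<bar>a * signed_integral M \<mu> X + b * signed_integral M \<nu> X\<bar>
      \<le> \<bar>a\<bar> * \<bar>signed_integral M \<mu> X\<bar> + \<bar>b\<bar> * \<bar>signed_integral M \<nu> X\<bar>"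
    by (metis abs_mult abs_triangle_ineq)
  also have "\<dots> \<le> \<bar>a\<bar> * (?v \<mu> * K) + \<bar>b\<bar> * (?v \<nu> * K)"
    by (intro add_mono mult_left_mono signed_integral_bound \<mu> \<nu> X) auto
  finally show "\<bar>a * signed_integral M \<mu> X + b * signed_integral M \<nu> X\<bar>
      \<le> (\<bar>a\<bar> * ?v \<mu> + \<bar>b\<bar> * ?v \<nu>) * K"
    by (simp add: algebra_simps)
qed (simp add: signed_integral_indicator[OF ca_lincomb[OF \<mu> \<nu>]] signed_integral_indicator[OF \<mu>]
      signed_integral_indicator[OF \<nu>])

lemma signed_integral_measure:
  assumes Q: "finite_measure Q" "sets Q = sets M" and X: "X \<in> bmeas M"
  shows "signed_integral M (measure Q) X = integral\<^sup>L Q X"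
proof (rule linear_bmeas_eq[OF _ _ _ _ _ X, where L = "signed_integral M (measure Q)"
      and L' = "integral\<^sup>L Q"])
  interpret finite_measure Q by fact
  note ca = measure_in_ca[OF Q] and i = integrable_bmeas[OF Q]
  have sp: "space Q = space M" using Q(2) by (rule sets_eq_imp_space_eq)
  show "linear_on_funs (bmeas M) (signed_integral M (measure Q))"
    by (rule signed_integral_linear[OF ca])
  show "linear_on_funs (bmeas M) (integral\<^sup>L Q)"
    unfolding linear_on_funs_def using i by simp
  fix X K assume X: "X \<in> bmeas M" "\<And>w. w \<in> space M \<Longrightarrow> \<bar>X w\<bar> \<le> K"
  show "\<bar>signed_integral M (measure Q) X\<bar> \<le> (pos_var M (measure Q) (space M)
      + pos_var M (\<lambda>A. - measure Q A) (space M)) * K"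
    by (rule signed_integral_bound[OF ca X])
  have "\<bar>integral\<^sup>L Q X\<bar> \<le> (\<integral>w. \<bar>X w\<bar> \<partial>Q)" by (rule integral_abs_bound)
  also have "\<dots> \<le> (\<integral>w. K \<partial>Q)"
    using i[OF X(1)] X by (intro integral_mono) (auto simp: sp)
  finally show "\<bar>integral\<^sup>L Q X\<bar> \<le> measure Q (space Q) * K" by simp
next
  fix A assume "A \<in> sets M"
  then show "signed_integral M (measure Q) (indicator A) = integral\<^sup>L Q (indicator A)"
    using signed_integral_indicator[OF measure_in_ca[OF Q]] Q
      sets.sets_into_space sets_eq_imp_space_eq[OF Q(2)] by (simp add: Int_absorb2)
qed

text \<open>The real supremum in \<open>tv_norm\<close> is meaningful only over a bounded set; the
  sums over partitions are bounded by the two variations of the whole space. After that a partition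
  into two pieces already exceeds \<mu> B.\<close>

lemma pos_var_le_tv_norm:
  assumes \<mu>: "\<mu> \<in> ca M"
  shows "pos_var M \<mu> (space M) \<le> tv_norm M \<mu>"
proof (rule pos_var_least)
  let ?D = "{D. finite D \<and> D \<subseteq> sets M \<and> partition_on (space M) D}"
  have "(\<Sum>A\<in>D. \<bar>\<mu> A\<bar>) \<le> pos_var M \<mu> (space M) + pos_var M (\<lambda>A. - \<mu> A) (space M)"
    if "D \<in> ?D" for D
  proof -
    have D: "finite D" "D \<subseteq> sets M" "\<Union>D = space M" "disjoint D"
      using that partition_onD1 partition_onD2 by fastforce+
    have sum: "(\<Sum>A\<in>D. pos_var M \<nu> A) = pos_var M \<nu> (space M)" if \<nu>: "\<nu> \<in> ca M" for \<nu>
    proof -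
      interpret finite_measure "pos_variation M \<nu>" by (rule finite_pos_variation[OF \<nu>])
      have "measure (pos_variation M \<nu>) (\<Union>A\<in>D. A) = (\<Sum>A\<in>D. measure (pos_variation M \<nu>) A)"
        using D by (intro finite_measure_finite_Union)
          (auto simp: sets_pos_variation[OF \<nu>] disjoint_family_on_def disjoint_def)
      moreover have "(\<Sum>A\<in>D. measure (pos_variation M \<nu>) A) = (\<Sum>A\<in>D. pos_var M \<nu> A)"
        using D by (intro sum.cong measure_pos_variation[OF \<nu>]) auto
      ultimately show ?thesis using D by (simp add: measure_pos_variation[OF \<nu>])
    qed
    have "\<bar>\<mu> A\<bar> \<le> pos_var M \<mu> A + pos_var M (\<lambda>A. - \<mu> A) A" if "A \<in> D" for A
    proof -
      have "A \<in> sets M" using D that by auto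
      then have "\<mu> A \<le> pos_var M \<mu> A" "- \<mu> A \<le> pos_var M (\<lambda>A. - \<mu> A) A"
        by (auto intro: pos_var_upper[OF \<mu>] pos_var_upper[OF ca_uminus[OF \<mu>]])
      then show ?thesis
        using pos_var_nonneg[OF \<mu>, of A] pos_var_nonneg[OF ca_uminus[OF \<mu>], of A] by linarith
    qed
    then have "(\<Sum>A\<in>D. \<bar>\<mu> A\<bar>) \<le> (\<Sum>A\<in>D. pos_var M \<mu> A + pos_var M (\<lambda>A. - \<mu> A) A)"
      by (rule sum_mono)
    then show ?thesis by (simp add: sum.distrib sum[OF \<mu>] sum[OF ca_uminus[OF \<mu>]])
  qed
  then have bdd: "bdd_above ((\<lambda>D. \<Sum>A\<in>D. \<bar>\<mu> A\<bar>) ` ?D)" by (rule bdd_aboveI2)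
  fix B assume B: "B \<in> sets M" "B \<subseteq> space M"
  \<comment> \<open>\<open>partition_on\<close> forbids empty blocks, so a possible empty piece is
    removed; when \<open>B\<close> itself is empty its value is 0.\<close>
  let ?P = "{B, space M - B} - {{}}"
  have "\<mu> B \<le> (\<Sum>A\<in>?P. \<bar>\<mu> A\<bar>)"
  proof (cases "B = {}")
    case True
    then show ?thesis using ca_empty[OF \<mu>] by (simp add: sum_nonneg)
  next
    case False
    then have "\<bar>\<mu> B\<bar> \<le> (\<Sum>A\<in>?P. \<bar>\<mu> A\<bar>)" by (intro member_le_sum) auto
    then show ?thesis by simp
  qed
  also have "\<dots> \<le> tv_norm M \<mu>"
    unfolding tv_norm_def
    using B by (intro cSUP_upper bdd) (auto simp: partition_on_def disjoint_def)
  finally show "\<mu> B \<le> tv_norm M \<mu>" .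
qed

lemma tv_norm_uminus: "tv_norm M (\<lambda>A. - \<mu> A) = tv_norm M \<mu>"
  unfolding tv_norm_def by simp

text \<open>The factor 2 comes from estimating each Jordan part by the full norm. Any constant would
  do: the bound serves to obtain compact coordinate intervals and a bounded limit
  functional.\<close>

lemma signed_integral_tv_bound:
  assumes \<mu>: "\<mu> \<in> ca M" and X: "X \<in> bmeas M" "\<And>w. w \<in> space M \<Longrightarrow> \<bar>X w\<bar> \<le> K" and K: "0 \<le> K"
  shows "\<bar>signed_integral M \<mu> X\<bar> \<le> 2 * K * tv_norm M \<mu>"
proof -
  have "pos_var M \<mu> (space M) + pos_var M (\<lambda>A. - \<mu> A) (space M) \<le> 2 * tv_norm M \<mu>"
    using pos_var_le_tv_norm[OF \<mu>] pos_var_le_tv_norm[OF ca_uminus[OF \<mu>]] tv_norm_uminus[of M \<mu>]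
    by simp
  from mult_right_mono[OF this K] signed_integral_bound[OF \<mu> X]
  show ?thesis by (simp add: algebra_simps)
qed

subsection \<open>Quasi-sure statements and dominated measures\<close>

text \<open>The Riesz--Fischer step: the sum of the absolute increments has finite integral, hence
  is finite almost everywhere, and the sequence telescopes.\<close>

lemma AE_Cauchy_if_summable_increments:
  fixes X :: "nat \<Rightarrow> 'a \<Rightarrow> real"
  assumes int: "\<And>n. integrable N (X n)"
    and summ: "summable (\<lambda>n. \<integral>w. \<bar>X (Suc n) w - X n w\<bar> \<partial>N)"
  shows "AE w in N. Cauchy (\<lambda>n. X n w)"
proof -
  have [measurable]: "X n \<in> borel_measurable N" for n using int by auto
  have "(\<integral>\<^sup>+w. (\<Sum>n. ennreal \<bar>X (Suc n) w - X n w\<bar>) \<partial>N)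
      = (\<Sum>n. \<integral>\<^sup>+w. ennreal \<bar>X (Suc n) w - X n w\<bar> \<partial>N)"
    by (rule nn_integral_suminf) measurable
  also have "\<dots> = (\<Sum>n. ennreal (\<integral>w. \<bar>X (Suc n) w - X n w\<bar> \<partial>N))"
    using int by (intro suminf_cong nn_integral_eq_integral) auto
  also have "\<dots> = ennreal (\<Sum>n. \<integral>w. \<bar>X (Suc n) w - X n w\<bar> \<partial>N)"
    using summ by (intro suminf_ennreal_eq summable_sums) auto
  finally have "(\<integral>\<^sup>+w. (\<Sum>n. ennreal \<bar>X (Suc n) w - X n w\<bar>) \<partial>N) \<noteq> \<infinity>" by simp
  then have "AE w in N. (\<Sum>n. ennreal \<bar>X (Suc n) w - X n w\<bar>) \<noteq> \<infinity>"
    by (intro nn_integral_PInf_AE) measurable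
  then show ?thesis
  proof eventually_elim
    case (elim w)
    then have "summable (\<lambda>n. \<bar>X (Suc n) w - X n w\<bar>)"
      by (intro summable_suminf_not_top) auto
    then have "summable (\<lambda>n. X (Suc n) w - X n w)" by (rule summable_rabs_cancel)
    then have "(\<lambda>n. (\<Sum>k<n. X (Suc k) w - X k w) + X 0 w) \<longlonglongrightarrow> (\<Sum>n. X (Suc n) w - X n w) + X 0 w"
      by (intro tendsto_add summable_LIMSEQ tendsto_const)
    then have "(\<lambda>n. X n w) \<longlonglongrightarrow> (\<Sum>n. X (Suc n) w - X n w) + X 0 w"
      by (simp only: sum_lessThan_telescope[of "\<lambda>k. X k w"] diff_add_cancel)
    then show ?case by (rule LIMSEQ_imp_Cauchy)
  qed
qed

text \<open>Convergence to \<open>Y\<close> is split into the Cauchy property and the equation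
  \<open>lim = Y\<close>, both of which are measurable conditions.\<close>

lemma sets_Collect_LIMSEQ:
  fixes X :: "nat \<Rightarrow> 'a \<Rightarrow> real"
  assumes [measurable]: "\<And>n. X n \<in> borel_measurable M" "Y \<in> borel_measurable M"
  shows "{w \<in> space M. (\<lambda>n. X n w) \<longlonglongrightarrow> Y w} \<in> sets M"
proof -
  have "(\<lambda>n. X n w) \<longlonglongrightarrow> Y w \<longleftrightarrow> Cauchy (\<lambda>n. X n w) \<and> lim (\<lambda>n. X n w) = Y w" for w
    by (metis LIMSEQ_imp_Cauchy limI Cauchy_convergent convergent_LIMSEQ_iff)
  then show ?thesis by simp measurable
qed

lemma capacity_zero_iff:
  assumes "\<P> \<subseteq> prob_measures M" "\<P> \<noteq> {}"
  shows "capacity \<P> A = 0 \<longleftrightarrow> (\<forall>P\<in>\<P>. measure P A = 0)"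
proof
  have "measure P A \<le> 1" if "P \<in> \<P>" for P
    using that assms prob_space.prob_le_1 unfolding prob_measures_def by blast
  then have "bdd_above ((\<lambda>P. measure P A) ` \<P>)" by (rule bdd_aboveI2)
  then have "P \<in> \<P> \<Longrightarrow> measure P A \<le> capacity \<P> A" for P
    unfolding capacity_def by (intro cSUP_upper)
  then show "capacity \<P> A = 0 \<Longrightarrow> \<forall>P\<in>\<P>. measure P A = 0"
    by (metis antisym measure_nonneg)
  show "\<forall>P\<in>\<P>. measure P A = 0 \<Longrightarrow> capacity \<P> A = 0"
    using assms unfolding capacity_def by simp
qed

section \<open>Capacity-null sets and dominated probability measures\<close>

locale robust =
  fixes M :: "'a measure" and \<P> :: "'a measure set"
  assumes \<P>_sub: "\<P> \<subseteq> prob_measures M" and \<P>_nonempty: "\<P> \<noteq> {}"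
begin

abbreviation "probs \<equiv> ca_c_prob M \<P>"

lemma \<P>_prob: "P \<in> \<P> \<Longrightarrow> prob_space P" and \<P>_sets: "P \<in> \<P> \<Longrightarrow> sets P = sets M"
  and \<P>_space: "P \<in> \<P> \<Longrightarrow> space P = space M"
  using \<P>_sub sets_eq_imp_space_eq[of P M] unfolding prob_measures_def by auto

lemmas capacity_zero = capacity_zero_iff[OF \<P>_sub \<P>_nonempty]

lemma probsI:
  assumes Q: "prob_space Q" "sets Q = sets M"
    and "\<And>A. A \<in> sets M \<Longrightarrow> capacity \<P> A = 0 \<Longrightarrow> measure Q A = 0"
  shows "Q \<in> probs"
  using assms measure_in_ca[OF prob_space.finite_measure[OF Q(1)] Q(2)]
  unfolding ca_c_prob_def prob_measures_def ca_c_def by auto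

lemma probsD:
  assumes "Q \<in> probs"
  shows probs_prob: "prob_space Q" and probs_sets: "sets Q = sets M"
    and probs_space: "space Q = space M" and probs_finite: "finite_measure Q"
    and probs_null: "A \<in> sets M \<Longrightarrow> capacity \<P> A = 0 \<Longrightarrow> measure Q A = 0"
    and probs_ca_c: "measure Q \<in> ca_c M \<P>"
proof -
  show 1: "prob_space Q" and 2: "sets Q = sets M" and "measure Q \<in> ca_c M \<P>"
    "A \<in> sets M \<Longrightarrow> capacity \<P> A = 0 \<Longrightarrow> measure Q A = 0"
    using assms unfolding ca_c_prob_def prob_measures_def ca_c_def by auto
  show "space Q = space M" using 2 by (rule sets_eq_imp_space_eq)
  show "finite_measure Q" using 1 by (rule prob_space.finite_measure)
qed

lemma \<P>_probs: "P \<in> \<P> \<Longrightarrow> P \<in> probs"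
  using \<P>_prob \<P>_sets capacity_zero by (intro probsI) auto

lemma probs_nonempty: "\<exists>P. P \<in> probs"
  using \<P>_nonempty \<P>_probs by auto

lemma probs_integrable: "P \<in> probs \<Longrightarrow> X \<in> bmeas M \<Longrightarrow> integrable P X"
  by (intro integrable_bmeas[OF probs_finite probs_sets])

lemma probs_measurable: "P \<in> probs \<Longrightarrow> X \<in> borel_measurable M \<Longrightarrow> X \<in> borel_measurable P"
  using measurable_cong_sets[OF probs_sets refl] by blast

lemma probs_signed_integral:
  "P \<in> probs \<Longrightarrow> X \<in> bmeas M \<Longrightarrow> signed_integral M (measure P) X = integral\<^sup>L P X"
  by (intro signed_integral_measure probs_finite probs_sets)

lemma qsI: "(\<And>w. w \<in> space M \<Longrightarrow> \<phi> w) \<Longrightarrow> qs \<P> \<phi>"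
  unfolding qs_def using \<P>_space by (auto intro!: AE_I2)

lemma qs_mp: "qs \<P> \<phi> \<Longrightarrow> (\<And>w. w \<in> space M \<Longrightarrow> \<phi> w \<Longrightarrow> \<psi> w) \<Longrightarrow> qs \<P> \<psi>"
  unfolding qs_def using \<P>_space by (metis (no_types, lifting) AE_mp AE_I2)

lemma qs_conj: "qs \<P> \<phi> \<Longrightarrow> qs \<P> \<psi> \<Longrightarrow> qs \<P> (\<lambda>w. \<phi> w \<and> \<psi> w)"
  unfolding qs_def by auto

text \<open>A q.s. statement speaks about members of \<P> only. Measurability of the event lets its
  complement be tested by the capacity, and so the statement reaches every measure that kills
  capacity-null sets.\<close>

lemma qs_imp_AE:
  assumes \<nu>: "sets \<nu> = sets M"
    and null: "\<And>A. A \<in> sets M \<Longrightarrow> capacity \<P> A = 0 \<Longrightarrow> emeasure \<nu> A = 0"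
    and m: "{w \<in> space M. \<phi> w} \<in> sets M" and "qs \<P> \<phi>"
  shows "AE w in \<nu>. \<phi> w"
proof -
  let ?N = "{w \<in> space M. \<not> \<phi> w}"
  have "?N = space M - {w \<in> space M. \<phi> w}" by auto
  then have N: "?N \<in> sets M" using m by (metis sets.compl_sets)
  have "measure P ?N = 0" if P: "P \<in> \<P>" for P
  proof -
    have "AE w in P. \<phi> w" using assms P unfolding qs_def by auto
    then have "emeasure P {w \<in> space P. \<not> \<phi> w} = 0"
      using N \<P>_sets[OF P] \<P>_space[OF P] by (subst (asm) AE_iff_measurable[OF _ refl]) auto
    then show ?thesis using \<P>_space[OF P] by (simp add: measure_def)
  qed
  then have "emeasure \<nu> ?N = 0" using null[OF N] capacity_zero by auto
  then show ?thesis
    using N \<nu> sets_eq_imp_space_eq[OF \<nu>] by (subst AE_iff_measurable[OF _ refl]) auto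
qed

lemma qs_imp_AE_probs:
  "Q \<in> probs \<Longrightarrow> {w \<in> space M. \<phi> w} \<in> sets M \<Longrightarrow> qs \<P> \<phi> \<Longrightarrow> AE w in Q. \<phi> w"
  by (rule qs_imp_AE)
    (auto simp: probs_sets finite_measure.emeasure_eq_measure[OF probs_finite] probs_null)

lemma probs_integral_mono:
  assumes P: "P \<in> probs" and X: "X \<in> bmeas M" and Y: "Y \<in> bmeas M" and le: "qs \<P> (\<lambda>w. X w \<le> Y w)"
  shows "integral\<^sup>L P X \<le> integral\<^sup>L P Y"
proof -
  have [measurable]: "X \<in> borel_measurable M" "Y \<in> borel_measurable M"
    using X Y by (auto intro: bmeas_measurable)
  show ?thesis
    by (intro integral_mono_AE probs_integrable P X Y qs_imp_AE_probs[OF P _ le]) measurable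
qed

lemma probs_integral_const: "P \<in> probs \<Longrightarrow> integral\<^sup>L P (\<lambda>_. c :: real) = c"
proof -
  assume "P \<in> probs"
  then interpret prob_space P by (rule probs_prob)
  show ?thesis by (simp add: prob_space)
qed

text \<open>The source of new elements of \<open>probs\<close>: a normalised bounded density creates
  no new null-set obstruction. It is used with indicators, giving conditional measures, and with the
  distance to a nearest point.\<close>

lemma probs_density:
  assumes Q: "Q \<in> probs" and Z: "Z \<in> bmeas M" "\<And>w. w \<in> space M \<Longrightarrow> 0 \<le> Z w"
    and c: "0 < integral\<^sup>L Q Z"
  shows "\<exists>P\<in>probs. \<forall>X\<in>bmeas M. integral\<^sup>L P X = (\<integral>w. Z w * X w \<partial>Q) / integral\<^sup>L Q Z"
proof -
  interpret prob_space Q using Q by (rule probs_prob)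
  let ?c = "integral\<^sup>L Q Z"
  have sQ: "space Q = space M" "sets Q = sets M" using Q by (auto simp: probs_space probs_sets)
  have [measurable]: "Z \<in> borel_measurable Q"
    using Z by (intro probs_measurable[OF Q] bmeas_measurable)
  define P where "P = density Q (\<lambda>w. ennreal (Z w / ?c))"
  have nonneg: "AE w in Q. 0 \<le> Z w / ?c" using Z(2) c by (intro AE_I2) (simp add: sQ)
  have "P \<in> probs"
  proof (rule probsI)
    have "(\<integral>\<^sup>+w. ennreal (Z w / ?c) \<partial>Q) = ennreal (\<integral>w. Z w / ?c \<partial>Q)"
      using probs_integrable[OF Q Z(1)] nonneg by (intro nn_integral_eq_integral) auto
    also have "\<dots> = 1" using c by simp
    finally show "prob_space P" unfolding P_def
      by (intro prob_spaceI) (simp add: emeasure_density cong: nn_integral_cong)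
    show "sets P = sets M" unfolding P_def using sQ by simp
    fix A assume A: "A \<in> sets M" "capacity \<P> A = 0"
    then have "A \<in> null_sets Q"
      using sQ probs_null[OF Q A] by (auto simp: null_sets_def emeasure_eq_measure)
    then have "A \<in> null_sets P"
      using absolutely_continuousI_density[of "\<lambda>w. ennreal (Z w / ?c)" Q]
      unfolding P_def absolutely_continuous_def by auto
    then show "measure P A = 0" by (auto simp: measure_def null_sets_def)
  qed
  moreover have "integral\<^sup>L P X = (\<integral>w. Z w * X w \<partial>Q) / ?c" if X: "X \<in> bmeas M" for X
  proof -
    have [measurable]: "X \<in> borel_measurable Q"
      using X by (intro probs_measurable[OF Q] bmeas_measurable)
    show ?thesis unfolding P_def using nonneg by (subst integral_real_density) auto
  qed
  ultimately show ?thesis by blast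
qed

text \<open>If \<open>X < c\<close> on a set \<open>B\<close> of positive \<open>P\<close>-measure,
  then conditioning \<open>P\<close> on \<open>B\<close> gives an element of \<open>probs\<close>
  whose integral of \<open>X\<close> is below \<open>c\<close>. This turns weak information about a
  cluster point into a q.s. inequality.\<close>

lemma qs_le_if_integrals_le:
  assumes X: "X \<in> bmeas M" and le: "\<And>P. P \<in> probs \<Longrightarrow> c \<le> integral\<^sup>L P X"
  shows "qs \<P> (\<lambda>w. c \<le> X w)"
proof -
  have "AE w in P. c \<le> X w" if P: "P \<in> \<P>" for P
  proof (rule ccontr)
    interpret prob_space P using P by (rule \<P>_prob)
    have [measurable]: "X \<in> borel_measurable P"
      using X by (intro probs_measurable[OF \<P>_probs[OF P]] bmeas_measurable)
    define B where "B = {w \<in> space P. X w < c}"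
    have [measurable]: "B \<in> sets P" unfolding B_def by measurable
    assume "\<not> (AE w in P. c \<le> X w)"
    then have "measure P B \<noteq> 0"
      by (subst (asm) AE_iff_measurable[OF _ refl]) (auto simp: B_def not_le emeasure_eq_measure)
    then have B1: "measure P B > 0" by (simp add: zero_less_measure_iff)
    have "\<exists>Q\<in>probs. \<forall>Y\<in>bmeas M. integral\<^sup>L Q Y
        = (\<integral>w. indicator B w * Y w \<partial>P) / integral\<^sup>L P (indicator B)"
    proof (rule probs_density[OF \<P>_probs[OF P]])
      show "indicator B \<in> bmeas M" using \<open>B \<in> sets P\<close> unfolding \<P>_sets[OF P] by (rule bmeas_indicator)
      show "0 < integral\<^sup>L P (indicator B :: 'a \<Rightarrow> real)" using B1 by simp
    qed simp
    then obtain Q where Q: "Q \<in> probs"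
      "integral\<^sup>L Q X = (\<integral>w. indicator B w * X w \<partial>P) / measure P B"
      using X by auto
    have iX: "integrable P X" by (rule probs_integrable[OF \<P>_probs[OF P] X])
    have ib: "integrable P (\<lambda>w. (c - X w) * indicator B w)"
      using iX by (intro integrable_real_mult_indicator) auto
    have "c * measure P B \<le> (\<integral>w. indicator B w * X w \<partial>P)"
      using le[OF Q(1)] B1 Q(2) by (simp add: pos_le_divide_eq)
    moreover have "(\<integral>w. (c - X w) * indicator B w \<partial>P) = c * measure P B - (\<integral>w. indicator B w * X w \<partial>P)"
    proof -
      have "(\<integral>w. (c - X w) * indicator B w \<partial>P) = (\<integral>w. c * indicator B w - indicator B w * X w \<partial>P)"
        by (simp add: algebra_simps)
      also have "\<dots> = (\<integral>w. c * indicator B w \<partial>P) - (\<integral>w. indicator B w * X w \<partial>P)"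
      proof (rule Bochner_Integration.integral_diff)
        show "integrable P (\<lambda>w. c * indicator B w)"
          by (intro integrable_mult_right integrable_real_indicator) (auto simp: emeasure_eq_measure)
        show "integrable P (\<lambda>w. indicator B w * X w)"
          using integrable_real_mult_indicator[OF \<open>B \<in> sets P\<close> iX] by (simp add: mult.commute)
      qed
      finally show ?thesis by simp
    qed
    moreover have "0 \<le> (\<integral>w. (c - X w) * indicator B w \<partial>P)"
      by (intro Bochner_Integration.integral_nonneg) (auto simp: B_def indicator_def)
    ultimately have "(\<integral>w. (c - X w) * indicator B w \<partial>P) = 0" by simp
    then have "AE w in P. (c - X w) * indicator B w = 0"
      using ib by (subst (asm) integral_nonneg_eq_0_iff_AE) (auto simp: B_def indicator_def)
    then have "AE w in P. w \<notin> B" by eventually_elim (auto simp: B_def indicator_def split: if_splits)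
    then have "AE w in P. c \<le> X w" by (rule AE_mp) (auto simp: B_def intro!: AE_I2)
    with \<open>\<not> (AE w in P. c \<le> X w)\<close> show False ..
  qed
  then show ?thesis unfolding qs_def by blast
qed

lemma probs_integral_cong:
  assumes P: "P \<in> probs" and X: "X \<in> bmeas M" and Y: "Y \<in> bmeas M" and "qs \<P> (\<lambda>w. X w = Y w)"
  shows "integral\<^sup>L P X = integral\<^sup>L P Y"
proof (rule antisym)
  show "integral\<^sup>L P X \<le> integral\<^sup>L P Y"
    by (rule probs_integral_mono[OF P X Y qs_mp[OF assms(4)]]) simp
  show "integral\<^sup>L P Y \<le> integral\<^sup>L P X"
    by (rule probs_integral_mono[OF P Y X qs_mp[OF assms(4)]]) simp
qed

lemma ca_cD: "\<mu> \<in> ca_c M \<P> \<Longrightarrow> \<mu> \<in> ca M"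
  "\<mu> \<in> ca_c M \<P> \<Longrightarrow> A \<in> sets M \<Longrightarrow> capacity \<P> A = 0 \<Longrightarrow> \<mu> A = 0"
  unfolding ca_c_def by auto

lemma ca_c_lincomb:
  "\<mu> \<in> ca_c M \<P> \<Longrightarrow> \<nu> \<in> ca_c M \<P> \<Longrightarrow> (\<lambda>A. a * \<mu> A + b * \<nu> A) \<in> ca_c M \<P>"
  unfolding ca_c_def using ca_lincomb by auto

lemma ca_c_uminus: "\<mu> \<in> ca_c M \<P> \<Longrightarrow> (\<lambda>A. - \<mu> A) \<in> ca_c M \<P>"
  unfolding ca_c_def using ca_uminus by auto

text \<open>Every measurable subset of a capacity-null set is again capacity-null, so \<mu> vanishes
  on all the sets entering the supremum.\<close>

lemma pos_variation_null:
  assumes \<mu>: "\<mu> \<in> ca_c M \<P>" and A: "A \<in> sets M" "capacity \<P> A = 0"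
  shows "emeasure (pos_variation M \<mu>) A = 0"
proof -
  have "\<mu> B = 0" if B: "B \<in> sets M" "B \<subseteq> A" for B
  proof (rule ca_cD(2)[OF \<mu> B(1)])
    have "measure P B = 0" if P: "P \<in> \<P>" for P
    proof -
      interpret prob_space P using P by (rule \<P>_prob)
      have "measure P B \<le> measure P A" using A B \<P>_sets[OF P] by (intro finite_measure_mono) auto
      also have "\<dots> = 0" using A P capacity_zero by auto
      finally show ?thesis by (simp add: measure_le_0_iff)
    qed
    then show "capacity \<P> B = 0" using capacity_zero by blast
  qed
  then have "pos_var M \<mu> A \<le> 0" by (intro pos_var_least) auto
  then show ?thesis using emeasure_pos_variation[OF ca_cD(1)[OF \<mu>] A(1)] by (simp add: ennreal_neg)
qed

lemma qs_imp_AE_pos_variation: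
  assumes \<mu>: "\<mu> \<in> ca_c M \<P>" and "{w \<in> space M. \<phi> w} \<in> sets M" "qs \<P> \<phi>"
  shows "AE w in pos_variation M \<mu>. \<phi> w"
  by (rule qs_imp_AE[OF sets_pos_variation[OF ca_cD(1)[OF \<mu>]] pos_variation_null[OF \<mu>] assms(2,3)])

text \<open>Dominated convergence for each Jordan part. It links bounded q.s. convergence to
  \<sigma>(\<open>L^\<infinity>_c\<close>, \<open>ca_c\<close>) and underlies all implications
  towards the Fatou property.\<close>

lemma signed_integral_tendsto:
  fixes X :: "nat \<Rightarrow> 'a \<Rightarrow> real"
  assumes \<mu>: "\<mu> \<in> ca_c M \<P>" and X: "\<And>n. X n \<in> bmeas M" and Y: "Y \<in> bmeas M"
    and bound: "\<And>n. qs \<P> (\<lambda>w. \<bar>X n w\<bar> \<le> K)" and lim: "qs \<P> (\<lambda>w. (\<lambda>n. X n w) \<longlonglongrightarrow> Y w)"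
  shows "(\<lambda>n. signed_integral M \<mu> (X n)) \<longlonglongrightarrow> signed_integral M \<mu> Y"
proof -
  have X': "X n \<in> borel_measurable M" "Y \<in> borel_measurable M" for n
    using X Y by (auto intro: bmeas_measurable)
  note [measurable] = X'
  have "(\<lambda>n. integral\<^sup>L (pos_variation M \<nu>) (X n)) \<longlonglongrightarrow> integral\<^sup>L (pos_variation M \<nu>) Y"
    if \<nu>: "\<nu> \<in> ca_c M \<P>" for \<nu>
  proof -
    note ca = ca_cD(1)[OF \<nu>]
    interpret finite_measure "pos_variation M \<nu>" by (rule finite_pos_variation[OF ca])
    have m: "Z \<in> borel_measurable (pos_variation M \<nu>)" if "Z \<in> borel_measurable M" for Z :: "'a \<Rightarrow> real"
      using that measurable_cong_sets[OF sets_pos_variation[OF ca] refl] by blast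
    note AE = qs_imp_AE_pos_variation[OF \<nu>]
    show ?thesis
    proof (rule integral_dominated_convergence[where w = "\<lambda>_. K"])
      have "{w \<in> space M. (\<lambda>n. X n w) \<longlonglongrightarrow> Y w} \<in> sets M"
        using X' by (rule sets_Collect_LIMSEQ)
      then show "AE w in pos_variation M \<nu>. (\<lambda>n. X n w) \<longlonglongrightarrow> Y w" by (rule AE[OF _ lim])
      show "AE w in pos_variation M \<nu>. norm (X n w) \<le> K" for n
        using AE[OF _ bound[of n]] X' by simp
      show "integrable (pos_variation M \<nu>) (\<lambda>_. K)" by simp
    qed (rule m, rule X')+
  qed
  from this[OF \<mu>] this[OF ca_c_uminus[OF \<mu>]] show ?thesis
    unfolding signed_integral_def by (intro tendsto_diff)
qed

lemma probs_integral_tendsto: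
  fixes X :: "nat \<Rightarrow> 'a \<Rightarrow> real"
  assumes P: "P \<in> probs" and X: "\<And>n. X n \<in> bmeas M" and Y: "Y \<in> bmeas M"
    and bound: "\<And>n. qs \<P> (\<lambda>w. \<bar>X n w\<bar> \<le> K)" and lim: "qs \<P> (\<lambda>w. (\<lambda>n. X n w) \<longlonglongrightarrow> Y w)"
  shows "(\<lambda>n. integral\<^sup>L P (X n)) \<longlonglongrightarrow> integral\<^sup>L P Y"
  using signed_integral_tendsto[OF probs_ca_c[OF P] X Y bound lim]
  by (simp add: probs_signed_integral[OF P] X Y)

end

subsection \<open>Acceptance sets and separation on bounded pieces\<close>

lemma bmeas_mult:
  assumes "X \<in> bmeas M" "Y \<in> bmeas M" shows "(\<lambda>w. X w * Y w) \<in> bmeas M"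
proof -
  obtain K where K: "\<And>w. w \<in> space M \<Longrightarrow> \<bar>X w\<bar> \<le> K" using bmeas_bound[OF assms(1)] by blast
  obtain L where L: "\<And>w. w \<in> space M \<Longrightarrow> \<bar>Y w\<bar> \<le> L" using bmeas_bound[OF assms(2)] by blast
  have "\<bar>X w * Y w\<bar> \<le> K * L" if "w \<in> space M" for w
    using K[OF that] L[OF that] by (auto simp: abs_mult intro!: mult_mono)
  then show ?thesis using bmeas_measurable[OF assms(1)] bmeas_measurable[OF assms(2)]
    by (intro bmeasI[of _ _ "K * L"]) auto
qed

lemma bmeas_power2: "X \<in> bmeas M \<Longrightarrow> (\<lambda>w. (X w)\<^sup>2) \<in> bmeas M"
  unfolding power2_eq_square by (rule bmeas_mult)

lemmas bmeas_intros = bmeas_const bmeas_add bmeas_scale bmeas_uminus bmeas_diff bmeas_mult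
  bmeas_power2 bmeas_min bmeas_max bmeas_indicator

text \<open>The pieces on which Krein--Smulian works. They are bounded by 0 from above because
  members of a downward closed set can be capped there; the bounds hold everywhere, not just q.s.,
  to match \<open>A_limit\<close>.\<close>

definition band :: "'a measure \<Rightarrow> real \<Rightarrow> ('a \<Rightarrow> real) set" where
  "band M K = {X \<in> bmeas M. \<forall>w\<in>space M. - K \<le> X w \<and> X w \<le> 0}"

text \<open>The properties retained from a level set, for functions in place of classes. They are
  kept abstract because they are needed both for the level set and for its translate by
  \<open>X0\<close>.\<close>

locale acceptance = robust M \<P> for M :: "'a measure" and \<P> +
  fixes A :: "('a \<Rightarrow> real) set"
  assumes A_bmeas: "A \<subseteq> bmeas M"
    and A_convex: "convex_funs A"
    and A_down: "\<And>X Y. Y \<in> bmeas M \<Longrightarrow> X \<in> A \<Longrightarrow> qs \<P> (\<lambda>w. Y w \<le> X w) \<Longrightarrow> Y \<in> A"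
    and A_limit: "\<And>(X :: nat \<Rightarrow> 'a \<Rightarrow> real) Y K. (\<And>n. X n \<in> A) \<Longrightarrow> Y \<in> bmeas M \<Longrightarrow>
      (\<And>n w. w \<in> space M \<Longrightarrow> \<bar>X n w\<bar> \<le> K) \<Longrightarrow>
      (\<And>w. w \<in> space M \<Longrightarrow> (\<lambda>n. X n w) \<longlonglongrightarrow> Y w) \<Longrightarrow> Y \<in> A"
    and A_sensitive: "\<And>X. X \<in> bmeas M \<Longrightarrow> X \<notin> A \<Longrightarrow>
      \<exists>Q\<in>ca_c_prob M \<P>. \<forall>Y\<in>A. \<not> (AE w in Q. X w = Y w)"
begin

lemma A_le: "Y \<in> bmeas M \<Longrightarrow> X \<in> A \<Longrightarrow> (\<And>w. w \<in> space M \<Longrightarrow> Y w \<le> X w) \<Longrightarrow> Y \<in> A"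
  by (rule A_down) (auto intro: qsI)

lemma band_convex:
  "X \<in> A \<inter> band M K \<Longrightarrow> Y \<in> A \<inter> band M K \<Longrightarrow> l \<in> {0..1} \<Longrightarrow>
    (\<lambda>w. l * X w + (1 - l) * Y w) \<in> A \<inter> band M K"
proof (unfold band_def, safe)
  assume *: "X \<in> A" "Y \<in> A" "X \<in> bmeas M" "Y \<in> bmeas M" and l: "l \<in> {0..1}"
    and X: "\<forall>w\<in>space M. - K \<le> X w \<and> X w \<le> 0" and Y: "\<forall>w\<in>space M. - K \<le> Y w \<and> Y w \<le> 0"
  show "(\<lambda>w. l * X w + (1 - l) * Y w) \<in> A" using A_convex * l unfolding convex_funs_def by blast
  show "(\<lambda>w. l * X w + (1 - l) * Y w) \<in> bmeas M" by (intro bmeas_intros *)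
  fix w assume w: "w \<in> space M"
  have "l * (- K) + (1 - l) * (- K) \<le> l * X w + (1 - l) * Y w"
    using X Y l w by (intro add_mono mult_left_mono) auto
  then show "- K \<le> l * X w + (1 - l) * Y w" by (simp add: algebra_simps)
  have "l * X w + (1 - l) * Y w \<le> l * 0 + (1 - l) * 0"
    using X Y l w by (intro add_mono mult_left_mono) auto
  then show "l * X w + (1 - l) * Y w \<le> 0" by simp
qed

text \<open>The parallelogram identity makes a minimising sequence Cauchy in \<open>L^2(Q)\<close>,
  and a fast one converges \<open>Q\<close>-almost everywhere. Since \<open>A_limit\<close> demands
  convergence at every point, the sequence is altered off the convergence set.\<close>

lemma exists_nearest:
  assumes Q: "Q \<in> probs" and X0: "X0 \<in> bmeas M" and ne: "A \<inter> band M K \<noteq> {}"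
  shows "\<exists>p\<in>A \<inter> band M K. \<forall>X\<in>A \<inter> band M K.
    (\<integral>w. (X0 w - p w)\<^sup>2 \<partial>Q) \<le> (\<integral>w. (X0 w - X w)\<^sup>2 \<partial>Q)"
proof -
  let ?D = "A \<inter> band M K"
  define g where "g X = (\<integral>w. (X0 w - X w)\<^sup>2 \<partial>Q)" for X
  define d where "d = Inf (g ` ?D)"
  have D: "X \<in> bmeas M" "X \<in> A" "\<And>w. w \<in> space M \<Longrightarrow> - K \<le> X w" "\<And>w. w \<in> space M \<Longrightarrow> X w \<le> 0"
    if "X \<in> ?D" for X using that unfolding band_def by auto
  have "0 \<le> g X" for X unfolding g_def by simp
  then have bdd: "bdd_below (g ` ?D)" by (intro bdd_belowI2[where m = 0])
  have dle: "d \<le> g X" if "X \<in> ?D" for X unfolding d_def using that bdd by (intro cINF_lower)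
  have "\<exists>X\<in>?D. g X < d + (1 / 16) ^ n" for n :: nat
  proof -
    have "Inf (g ` ?D) < d + (1 / 16) ^ n" unfolding d_def by simp
    then show ?thesis using ne by (auto simp: cInf_less_iff[OF _ bdd])
  qed
  \<comment> \<open>With excess \<open>16^-n\<close> the squared increments integrate to at most
    \<open>4 * 16^-n\<close>, which leads to the summable bound \<open>5/2 * 4^-n\<close> for the
    absolute increments.\<close>
  then obtain X where X: "\<And>n. X n \<in> ?D" "\<And>n. g (X n) < d + (1 / 16) ^ n" by metis
  have Xb: "X n \<in> bmeas M" for n using D(1)[OF X(1)] .
  note int = probs_integrable[OF Q]
  have incr: "(\<integral>w. \<bar>X (Suc n) w - X n w\<bar> \<partial>Q) \<le> 5 / 2 * (1 / 4) ^ n" for n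
  proof -
    define m where "m = (\<lambda>w. (1 / 2) * X n w + (1 - 1 / 2) * X (Suc n) w)"
    have m: "m \<in> ?D" unfolding m_def by (rule band_convex[OF X(1) X(1)]) auto
    have mb: "m \<in> bmeas M" using D(1)[OF m] .
    have "(X (Suc n) w - X n w)\<^sup>2 =
        2 * (X0 w - X n w)\<^sup>2 + 2 * (X0 w - X (Suc n) w)\<^sup>2 - 4 * (X0 w - m w)\<^sup>2" for w
      unfolding m_def by (simp add: power2_eq_square field_simps)
    then have "(\<integral>w. (X (Suc n) w - X n w)\<^sup>2 \<partial>Q)
        = (\<integral>w. 2 * (X0 w - X n w)\<^sup>2 + 2 * (X0 w - X (Suc n) w)\<^sup>2 - 4 * (X0 w - m w)\<^sup>2 \<partial>Q)" by simp
    also have "\<dots> = 2 * g (X n) + 2 * g (X (Suc n)) - 4 * g m"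
      unfolding g_def using X0 Xb mb
      by (subst Bochner_Integration.integral_diff Bochner_Integration.integral_add;
          (intro int bmeas_intros)?; simp)+
    also have "\<dots> \<le> 4 * (1 / 16) ^ n"
    proof -
      have "(0 :: real) \<le> (1 / 16) ^ n" "(1 / 16 :: real) ^ Suc n = (1 / 16) ^ n / 16" by simp_all
      then show ?thesis using X(2)[of n] X(2)[of "Suc n"] dle[OF m] by linarith
    qed
    finally have sq: "(\<integral>w. (X (Suc n) w - X n w)\<^sup>2 \<partial>Q) \<le> 4 * (1 / 16) ^ n" .
    \<comment> \<open>Expanding \<open>(4^n \<bar>x\<bar> - 1)^2 \<ge> 0\<close>; this takes the
      place of the Cauchy--Schwarz inequality.\<close>
    have pt: "\<bar>x\<bar> \<le> (4 ^ n * x\<^sup>2 + (1 / 4) ^ n) / 2" for x :: real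
    proof -
      have "0 \<le> (4 ^ n * \<bar>x\<bar> - 1)\<^sup>2 / 4 ^ n" by simp
      also have "\<dots> = 4 ^ n * x\<^sup>2 - 2 * \<bar>x\<bar> + (1 / 4) ^ n"
        by (simp add: power2_eq_square field_simps power_divide)
      finally show ?thesis by simp
    qed
    have "(\<integral>w. \<bar>X (Suc n) w - X n w\<bar> \<partial>Q)
        \<le> (\<integral>w. (4 ^ n * (X (Suc n) w - X n w)\<^sup>2 + (1 / 4) ^ n) * (1 / 2) \<partial>Q)"
      using pt by (intro integral_mono integrable_abs int bmeas_intros Xb) auto
    also have "\<dots> = (4 ^ n * (\<integral>w. (X (Suc n) w - X n w)\<^sup>2 \<partial>Q) + (1 / 4) ^ n) * (1 / 2)"
      by (subst integral_mult_left_zero, subst Bochner_Integration.integral_add)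
        (auto intro!: int bmeas_intros Xb simp: prob_space.prob_space[OF probs_prob[OF Q]])
    also have "\<dots> \<le> (4 ^ n * (4 * (1 / 16) ^ n) + (1 / 4) ^ n) * (1 / 2)"
      using sq by simp
    also have "4 ^ n * (1 / 16 :: real) ^ n = (1 / 4) ^ n"
      by (simp flip: power_mult_distrib)
    then have "(4 ^ n * (4 * (1 / 16) ^ n) + (1 / 4) ^ n) * (1 / 2) = 5 / 2 * (1 / 4 :: real) ^ n" by simp
    finally show ?thesis .
  qed
  have "summable (\<lambda>n. \<integral>w. \<bar>X (Suc n) w - X n w\<bar> \<partial>Q)"
  proof (rule summable_comparison_test)
    show "\<exists>N. \<forall>n\<ge>N. norm (\<integral>w. \<bar>X (Suc n) w - X n w\<bar> \<partial>Q) \<le> 5 / 2 * (1 / 4) ^ n"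
      using incr by simp
    show "summable (\<lambda>n. 5 / 2 * (1 / 4 :: real) ^ n)" by (intro summable_mult summable_geometric) simp
  qed
  then have AEC: "AE w in Q. Cauchy (\<lambda>n. X n w)"
    by (intro AE_Cauchy_if_summable_increments int Xb)
  define G where "G = {w \<in> space M. Cauchy (\<lambda>n. X n w)}"
  have Xm [measurable]: "X n \<in> borel_measurable M" for n using bmeas_measurable[OF Xb] .
  have [measurable]: "G \<in> sets M" unfolding G_def by measurable
  \<comment> \<open>Replacing values by the lower bound \<open>-K\<close> only decreases the
    functions, so they remain in \<open>A\<close>, and it changes nothing \<open>Q\<close>-almost
    everywhere.\<close>
  define X' where "X' n w = (if w \<in> G then X n w else - K)" for n w
  define p where "p w = lim (\<lambda>n. X' n w)" for w
  have X'm [measurable]: "X' n \<in> borel_measurable M" for n unfolding X'_def by measurable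
  have X'r: "- K \<le> X' n w" "X' n w \<le> X n w" "\<bar>X' n w\<bar> \<le> K" if "w \<in> space M" for n w
    using D(3,4)[OF X(1) that, of n] unfolding X'_def by auto
  have lim: "(\<lambda>n. X' n w) \<longlonglongrightarrow> p w" for w
    unfolding p_def convergent_LIMSEQ_iff[symmetric] X'_def G_def
    by (cases "w \<in> space M \<and> Cauchy (\<lambda>n. X n w)") (auto simp: Cauchy_convergent convergent_const)
  have X'b: "X' n \<in> bmeas M" for n using X'r(3) by (intro bmeasI) auto
  have X'A: "X' n \<in> A" for n by (rule A_le[OF X'b D(2)[OF X(1)] X'r(2)])
  have pr: "- K \<le> p w" "p w \<le> 0" "\<bar>p w\<bar> \<le> K" if w: "w \<in> space M" for w
  proof -
    show "- K \<le> p w" by (rule LIMSEQ_le_const[OF lim]) (use X'r(1)[OF w] in auto)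
    show "p w \<le> 0"
      by (rule LIMSEQ_le_const2[OF lim]) (use X'r(2)[OF w] D(4)[OF X(1) w] order_trans in blast)
    with \<open>- K \<le> p w\<close> show "\<bar>p w\<bar> \<le> K" by simp
  qed
  have "p \<in> borel_measurable M" using lim by (rule borel_measurable_LIMSEQ_real) simp
  then have pb: "p \<in> bmeas M" using pr(3) by (rule bmeasI)
  have pA: "p \<in> A" by (rule A_limit[OF X'A pb X'r(3) lim])
  have pD: "p \<in> ?D" using pA pb pr unfolding band_def by auto
  obtain B where B: "\<And>w. w \<in> space M \<Longrightarrow> \<bar>X0 w\<bar> \<le> B" using bmeas_bound[OF X0] by blast
  have "(\<lambda>n. g (X' n)) \<longlonglongrightarrow> g p"
    unfolding g_def
  proof (rule probs_integral_tendsto[OF Q])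
    show "qs \<P> (\<lambda>w. \<bar>(X0 w - X' n w)\<^sup>2\<bar> \<le> (B + K)\<^sup>2)" for n
    proof (rule qsI)
      fix w assume w: "w \<in> space M"
      have "\<bar>X0 w - X' n w\<bar> \<le> B + K" using B[OF w] X'r(3)[OF w, of n] by linarith
      then have "\<bar>X0 w - X' n w\<bar>\<^sup>2 \<le> (B + K)\<^sup>2" by (intro power_mono) auto
      then show "\<bar>(X0 w - X' n w)\<^sup>2\<bar> \<le> (B + K)\<^sup>2" by simp
    qed
    show "qs \<P> (\<lambda>w. (\<lambda>n. (X0 w - X' n w)\<^sup>2) \<longlonglongrightarrow> (X0 w - p w)\<^sup>2)"
      by (rule qsI) (intro tendsto_intros lim)
  qed (intro bmeas_intros X0 X'b pb)+
  moreover have "g (X' n) = g (X n)" for n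
    unfolding g_def
  proof (rule integral_cong_AE)
    show "AE w in Q. (X0 w - X' n w)\<^sup>2 = (X0 w - X n w)\<^sup>2"
      using AEC AE_space[of Q] by eventually_elim (auto simp: X'_def G_def probs_space[OF Q])
  qed (intro probs_measurable[OF Q] bmeas_measurable bmeas_intros X0 X'b Xb)+
  ultimately have "(\<lambda>n. g (X n)) \<longlonglongrightarrow> g p" by simp
  moreover have "(\<lambda>n. d + (1 / 16) ^ n) \<longlonglongrightarrow> d + 0"
    by (intro tendsto_intros LIMSEQ_power_zero) simp
  ultimately have "g p \<le> d + 0" using X(2) by (intro LIMSEQ_le) (auto intro: less_imp_le)
  then have "\<forall>X\<in>?D. g p \<le> g X" using dle by force
  then show ?thesis using pD unfolding g_def by blast
qed

text \<open>With \<open>p\<close> nearest to \<open>X0\<close> and \<open>Z = X0 - p\<close>, the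
  first-order condition is \<open>E_Q[Z (X - p)] \<le> 0\<close>. As \<open>Z\<close> is
  nonnegative, \<open>Z / E_Q[Z]\<close> is a density, and the gap is
  \<open>E_Q[Z^2] / E_Q[Z]\<close>, positive because sensitivity forbids \<open>X0 = p\<close>
  \<open>Q\<close>-a.e.\<close>

lemma separate_band:
  assumes X0: "X0 \<in> bmeas M" "X0 \<notin> A" and K: "\<And>w. w \<in> space M \<Longrightarrow> - K \<le> X0 w"
  shows "\<exists>P\<in>probs. \<exists>e>0. \<forall>X\<in>A \<inter> band M K. integral\<^sup>L P X \<le> integral\<^sup>L P X0 - e"
proof (cases "A \<inter> band M K = {}")
  case True
  then show ?thesis using probs_nonempty by (auto intro!: exI[of _ "1 :: real"])
next
  case False
  let ?D = "A \<inter> band M K"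
  obtain Q where Q: "Q \<in> probs" "\<And>Y. Y \<in> A \<Longrightarrow> \<not> (AE w in Q. X0 w = Y w)"
    using A_sensitive[OF X0] by blast
  note int = probs_integrable[OF Q(1)]
  obtain p0 where p0: "p0 \<in> ?D"
    "\<And>X. X \<in> ?D \<Longrightarrow> (\<integral>w. (X0 w - p0 w)\<^sup>2 \<partial>Q) \<le> (\<integral>w. (X0 w - X w)\<^sup>2 \<partial>Q)"
    using exists_nearest[OF Q(1) X0(1) False] by blast
  \<comment> \<open>Taking the minimum with \<open>X0\<close> brings the point no farther from
    \<open>X0\<close> and makes \<open>Z\<close> nonnegative. It remains in the band because
    \<open>X0 \<ge> -K\<close>.\<close>
  define p where "p = (\<lambda>w. min (p0 w) (X0 w))"
  define Z where "Z = (\<lambda>w. X0 w - p w)"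
  have p0b: "p0 \<in> bmeas M" "p0 \<in> A" using p0(1) unfolding band_def by auto
  have pb: "p \<in> bmeas M" unfolding p_def by (intro bmeas_intros p0b X0)
  have pA: "p \<in> A" by (rule A_le[OF pb p0b(2)]) (simp add: p_def)
  have pD: "p \<in> ?D" using pb pA p0(1) K unfolding band_def p_def by (auto simp: min_le_iff_disj)
  have Zb: "Z \<in> bmeas M" unfolding Z_def by (intro bmeas_intros X0 pb)
  have Z0: "0 \<le> Z w" for w unfolding Z_def p_def by simp
  have "(Z w)\<^sup>2 \<le> (X0 w - p0 w)\<^sup>2" for w unfolding Z_def p_def by (simp add: min_def)
  then have "(\<integral>w. (Z w)\<^sup>2 \<partial>Q) \<le> (\<integral>w. (X0 w - p0 w)\<^sup>2 \<partial>Q)"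
    by (intro integral_mono int bmeas_intros Zb X0 p0b)
  then have near: "(\<integral>w. (Z w)\<^sup>2 \<partial>Q) \<le> (\<integral>w. (X0 w - X w)\<^sup>2 \<partial>Q)" if "X \<in> ?D" for X
    using p0(2)[OF that] by simp
  have notAE: "\<not> (AE w in Q. Z w = 0)" using Q(2)[OF pA] unfolding Z_def by simp
  have EZ: "0 < integral\<^sup>L Q Z"
  proof -
    have "integral\<^sup>L Q Z \<noteq> 0"
      using notAE integral_nonneg_eq_0_iff_AE[OF int[OF Zb]] Z0 by simp
    moreover have "0 \<le> integral\<^sup>L Q Z" using Z0 by simp
    ultimately show ?thesis by simp
  qed
  have EZ2: "0 < (\<integral>w. (Z w)\<^sup>2 \<partial>Q)"
  proof -
    have "(\<integral>w. (Z w)\<^sup>2 \<partial>Q) \<noteq> 0"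
      using notAE integral_nonneg_eq_0_iff_AE[OF int[OF bmeas_power2[OF Zb]]] by simp
    moreover have "0 \<le> (\<integral>w. (Z w)\<^sup>2 \<partial>Q)" by simp
    ultimately show ?thesis by linarith
  qed
  \<comment> \<open>Moving from \<open>p\<close> towards \<open>X\<close> by \<open>t\<close>
    changes the squared distance by \<open>-2 t a + t^2 b\<close>, so minimality would give
    \<open>2 a \<le> t b\<close> for all \<open>t\<close> in (0, 1].\<close>
  have obtuse: "(\<integral>w. Z w * (X w - p w) \<partial>Q) \<le> 0" if X: "X \<in> ?D" for X
  proof (rule ccontr)
    define a where "a = (\<integral>w. Z w * (X w - p w) \<partial>Q)"
    define b where "b = (\<integral>w. (X w - p w)\<^sup>2 \<partial>Q)"
    assume "\<not> ?thesis"
    then have a: "a > 0" unfolding a_def by simp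
    have b: "b \<ge> 0" unfolding b_def by simp
    have Xb: "X \<in> bmeas M" using X unfolding band_def by auto
    have key: "2 * a \<le> t * b" if t: "0 < t" "t \<le> 1" for t
    proof -
      have W: "(\<lambda>w. t * X w + (1 - t) * p w) \<in> ?D" by (rule band_convex[OF X pD]) (use t in auto)
      have "(X0 w - (t * X w + (1 - t) * p w))\<^sup>2
          = (Z w)\<^sup>2 - (2 * t) * (Z w * (X w - p w)) + t\<^sup>2 * (X w - p w)\<^sup>2" for w
        unfolding Z_def by (simp add: power2_eq_square algebra_simps)
      then have "(\<integral>w. (Z w)\<^sup>2 \<partial>Q) \<le>
          (\<integral>w. (Z w)\<^sup>2 - (2 * t) * (Z w * (X w - p w)) + t\<^sup>2 * (X w - p w)\<^sup>2 \<partial>Q)"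
        using near[OF W] by simp
      also have "\<dots> = (\<integral>w. (Z w)\<^sup>2 \<partial>Q) - 2 * t * a + t\<^sup>2 * b"
        unfolding a_def b_def using Xb pb Zb
        by (subst Bochner_Integration.integral_add Bochner_Integration.integral_diff;
            (intro int bmeas_intros)?; simp)+
      finally have "t * (2 * a) \<le> t * (t * b)" by (simp add: power2_eq_square algebra_simps)
      then show ?thesis using t by simp
    qed
    \<comment> \<open>Adding 1 to \<open>b\<close> covers \<open>b = 0\<close>; this choice gives
      \<open>t b \<le> a < 2 a\<close>.\<close>
    define t where "t = min 1 (a / (b + 1))"
    have t: "0 < t" "t \<le> 1" unfolding t_def using a b by auto
    have "t * b \<le> a / (b + 1) * b" unfolding t_def using b by (intro mult_right_mono) auto
    also have "\<dots> \<le> a" using a b by (simp add: field_simps)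
    finally show False using key[OF t] a by simp
  qed
  obtain P where P: "P \<in> probs"
    "\<And>X. X \<in> bmeas M \<Longrightarrow> integral\<^sup>L P X = (\<integral>w. Z w * X w \<partial>Q) / integral\<^sup>L Q Z"
    using probs_density[OF Q(1) Zb Z0 EZ] by blast
  define e where "e = (\<integral>w. (Z w)\<^sup>2 \<partial>Q) / integral\<^sup>L Q Z"
  have "integral\<^sup>L P X \<le> integral\<^sup>L P X0 - e" if X: "X \<in> ?D" for X
  proof -
    have Xb: "X \<in> bmeas M" using X unfolding band_def by auto
    have "(\<integral>w. Z w * X w \<partial>Q) - (\<integral>w. Z w * p w \<partial>Q) = (\<integral>w. Z w * (X w - p w) \<partial>Q)"
      unfolding right_diff_distrib
      by (subst Bochner_Integration.integral_diff) (auto intro!: int bmeas_intros Xb pb Zb)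
    also have "\<dots> \<le> 0" by (rule obtuse[OF X])
    finally have 1: "(\<integral>w. Z w * X w \<partial>Q) \<le> (\<integral>w. Z w * p w \<partial>Q)" by simp
    have "(Z w)\<^sup>2 = Z w * X0 w - Z w * p w" for w
      unfolding Z_def by (simp add: power2_eq_square algebra_simps)
    then have "(\<integral>w. (Z w)\<^sup>2 \<partial>Q) = (\<integral>w. Z w * X0 w - Z w * p w \<partial>Q)" by simp
    also have "\<dots> = (\<integral>w. Z w * X0 w \<partial>Q) - (\<integral>w. Z w * p w \<partial>Q)"
      by (subst Bochner_Integration.integral_diff) (auto intro!: int bmeas_intros X0 pb Zb)
    finally have "(\<integral>w. Z w * X w \<partial>Q) \<le> (\<integral>w. Z w * X0 w \<partial>Q) - (\<integral>w. (Z w)\<^sup>2 \<partial>Q)"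
      using 1 by simp
    from divide_right_mono[OF this less_imp_le[OF EZ]]
    show ?thesis unfolding P(2)[OF Xb] P(2)[OF X0(1)] e_def by (simp add: diff_divide_distrib)
  qed
  moreover have "e > 0" unfolding e_def using EZ EZ2 by simp
  ultimately show ?thesis using P(1) by blast
qed

end

subsection \<open>Weak-star compactness\<close>

context robust begin

text \<open>Tychonoff's theorem provides a cluster point in the algebraic dual of \<open>ca\<^sub>c\<close>; the
  hypothesis \<open>ca\<^sub>c\<^sup>* = L\<^sup>\<infinity>\<^sub>c\<close> represents it by a function.\<close>

lemma cluster_point:
  assumes dual: "dual_is_Linf M \<P>"
    and H: "\<And>F. finite F \<Longrightarrow> F \<subseteq> probs \<Longrightarrow> H F \<noteq> {}"
      "\<And>F X. finite F \<Longrightarrow> F \<subseteq> probs \<Longrightarrow> X \<in> H F \<Longrightarrow> X \<in> band M K"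
      "\<And>F F'. finite F' \<Longrightarrow> F' \<subseteq> probs \<Longrightarrow> F \<subseteq> F' \<Longrightarrow> H F' \<subseteq> H F"
  shows "\<exists>X\<in>bmeas M. \<forall>F P. finite F \<and> F \<subseteq> probs \<and> P \<in> probs \<longrightarrow>
    integral\<^sup>L P X \<in> closure ((\<lambda>X. integral\<^sup>L P X) ` H F)"
proof -
  \<comment> \<open>Coordinates outside \<open>ca_c\<close> are set to 0, so the compact box can be
    a product over the whole type of set functions.\<close>
  define \<Phi> where "\<Phi> X \<mu> = (if \<mu> \<in> ca_c M \<P> then signed_integral M \<mu> X else 0)" for X \<mu>
  define b where "b \<mu> = (if \<mu> \<in> ca_c M \<P> then 2 * \<bar>K\<bar> * tv_norm M \<mu> else 0)" for \<mu>
  define Box where "Box = Pi\<^sub>E UNIV (\<lambda>\<mu>. {- b \<mu> .. b \<mu>})"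
  define I where "I = {F. finite F \<and> F \<subseteq> probs}"
  have "compact Box"
  proof -
    have "compactin (product_topology (\<lambda>_. euclidean) UNIV) Box"
      unfolding Box_def by (subst compactin_PiE) auto
    then show ?thesis unfolding euclidean_product_topology by simp
  qed
  have Hb: "X \<in> bmeas M" "\<And>w. w \<in> space M \<Longrightarrow> \<bar>X w\<bar> \<le> \<bar>K\<bar>" if "X \<in> H F" "F \<in> I" for X F
    using H(2)[of F X] that unfolding I_def band_def by fastforce+
  have Box: "\<Phi> X \<in> Box" if "X \<in> H F" "F \<in> I" for X F
  proof -
    have "\<bar>\<Phi> X \<mu>\<bar> \<le> b \<mu>" for \<mu>
      unfolding \<Phi>_def b_def using signed_integral_tv_bound[OF ca_cD(1) Hb[OF that]] by auto
    then show ?thesis unfolding Box_def by (auto simp: abs_le_iff minus_le_iff)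
  qed
  \<comment> \<open>Finite intersections are nonempty because one point of \<open>H\<close> at the
    union of the indices lies in all the sets, \<open>H\<close> being antitone.\<close>
  have "Box \<inter> (\<Inter>F\<in>I. closure (\<Phi> ` H F)) \<noteq> {}"
  proof (rule compact_imp_fip_image[OF \<open>compact Box\<close>])
    fix I' assume I': "finite I'" "I' \<subseteq> I"
    then have U: "\<Union>I' \<in> I" unfolding I_def by auto
    then obtain X where X: "X \<in> H (\<Union>I')" using H(1)[of "\<Union>I'"] unfolding I_def by blast
    have "X \<in> H F" if "F \<in> I'" for F
      using H(3)[of "\<Union>I'" F] U that X unfolding I_def by auto
    then have "\<Phi> X \<in> closure (\<Phi> ` H F)" if "F \<in> I'" for F
      using that by (intro subsetD[OF closure_subset] imageI)
    moreover have "\<Phi> X \<in> Box" using Box[OF X U] .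
    ultimately show "Box \<inter> (\<Inter>F\<in>I'. closure (\<Phi> ` H F)) \<noteq> {}" by blast
  qed simp
  then obtain \<phi> where \<phi>: "\<phi> \<in> Box" "\<And>F. F \<in> I \<Longrightarrow> \<phi> \<in> closure (\<Phi> ` H F)" by blast
  have "{} \<in> I" unfolding I_def by simp
  have cont: "continuous_on S (\<lambda>\<phi>. \<phi> \<mu>)" for S :: "(('a set \<Rightarrow> real) \<Rightarrow> real) set" and \<mu>
    by (rule continuous_on_subset[OF continuous_on_product_coordinates subset_UNIV])
  have "\<phi> \<in> ca_c_dual M \<P>"
    unfolding ca_c_dual_def
  proof (intro CollectI conjI ballI allI exI)
    fix \<mu> \<nu> a b assume \<mu>\<nu>: "\<mu> \<in> ca_c M \<P>" "\<nu> \<in> ca_c M \<P>"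
    \<comment> \<open>Each linearity relation involves three coordinates, hence is closed in the
      product topology and passes to the cluster point.\<close>
    let ?T = "{\<phi> :: ('a set \<Rightarrow> real) \<Rightarrow> real. \<phi> (\<lambda>A. a * \<mu> A + b * \<nu> A) = a * \<phi> \<mu> + b * \<phi> \<nu>}"
    have "closed ?T" by (intro closed_Collect_eq continuous_intros cont)
    moreover have "\<Phi> ` H {} \<subseteq> ?T"
      using signed_integral_lincomb[OF ca_cD(1)[OF \<mu>\<nu>(1)] ca_cD(1)[OF \<mu>\<nu>(2)] Hb(1)[OF _ \<open>{} \<in> I\<close>]]
        ca_c_lincomb[OF \<mu>\<nu>] \<mu>\<nu> unfolding \<Phi>_def by auto
    ultimately have "closure (\<Phi> ` H {}) \<subseteq> ?T" by (intro closure_minimal)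
    then show "\<phi> (\<lambda>A. a * \<mu> A + b * \<nu> A) = a * \<phi> \<mu> + b * \<phi> \<nu>" using \<phi>(2)[OF \<open>{} \<in> I\<close>] by auto
  next
    fix \<mu> assume \<mu>: "\<mu> \<in> ca_c M \<P>"
    have "\<phi> \<mu> \<in> {- b \<mu> .. b \<mu>}" using \<phi>(1) unfolding Box_def by auto
    then show "\<bar>\<phi> \<mu>\<bar> \<le> 2 * \<bar>K\<bar> * tv_norm M \<mu>" using \<mu> unfolding b_def by (auto simp: abs_le_iff)
  qed
  then obtain X where X: "X \<in> bmeas M" "\<And>\<mu>. \<mu> \<in> ca_c M \<P> \<Longrightarrow> \<phi> \<mu> = signed_integral M \<mu> X"
    using dual unfolding dual_is_Linf_def by blast
  have "integral\<^sup>L P X \<in> closure ((\<lambda>X. integral\<^sup>L P X) ` H F)" if F: "F \<in> I" and P: "P \<in> probs" for F P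
  proof -
    have "(\<lambda>\<phi>. \<phi> (measure P)) ` closure (\<Phi> ` H F) \<subseteq> closure ((\<lambda>X. integral\<^sup>L P X) ` H F)"
    proof (rule image_closure_subset[OF cont closed_closure])
      have "(\<lambda>\<phi>. \<phi> (measure P)) ` \<Phi> ` H F = (\<lambda>X. integral\<^sup>L P X) ` H F"
        unfolding image_image \<Phi>_def using probs_ca_c[OF P] probs_signed_integral[OF P] Hb(1)[OF _ F]
        by (auto intro!: image_cong)
      then show "(\<lambda>\<phi>. \<phi> (measure P)) ` \<Phi> ` H F \<subseteq> closure ((\<lambda>X. integral\<^sup>L P X) ` H F)"
        using closure_subset by simp
    qed
    moreover have "\<phi> (measure P) = integral\<^sup>L P X"
      using X probs_ca_c[OF P] probs_signed_integral[OF P] by simp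
    ultimately show ?thesis using \<phi>(2)[OF F] by auto
  qed
  then show ?thesis using X(1) unfolding I_def by blast
qed

end

subsection \<open>A Krein--Smulian argument\<close>

context acceptance begin

text \<open>A pair (P, s) stands for the half-space \<open>-s \<le> E_P[X]\<close>. The condition
  says that the intersection of these half-spaces misses the part of \<open>A\<close> in the
  band.\<close>

definition avoids :: "('a measure \<times> real) set \<Rightarrow> real \<Rightarrow> bool" where
  "avoids C r \<longleftrightarrow> (\<forall>X\<in>A \<inter> band M r. \<exists>(P, s)\<in>C. integral\<^sup>L P X < - s)"

text \<open>If no finite \<open>F\<close> sufficed, compactness would yield a cluster point
  \<open>Y\<close> obeying the old constraints and \<open>-r \<le> E_P[Y]\<close> for every
  \<open>P\<close>. Then \<open>Y\<close> lies q.s. in the smaller band, where the old constraints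
  already exclude \<open>A\<close>; yet \<open>Y\<close> agrees q.s. with a member of
  \<open>A\<close>.\<close>

lemma avoids_extend:
  assumes dual: "dual_is_Linf M \<P>" and C: "fst ` C \<subseteq> probs" and av: "avoids C r" and r: "0 \<le> r" "r \<le> r'"
  shows "\<exists>F. finite F \<and> F \<subseteq> probs \<and> avoids (C \<union> F \<times> {r}) r'"
proof (rule ccontr)
  assume "\<not> ?thesis"
  then have not_av: "\<not> avoids (C \<union> F \<times> {r}) r'" if "finite F" "F \<subseteq> probs" for F using that by blast
  define H where "H F = {X \<in> A \<inter> band M r'. (\<forall>(P, s)\<in>C. - s \<le> integral\<^sup>L P X) \<and>
    (\<forall>P\<in>F. - r \<le> integral\<^sup>L P X)}" for F
  have ne: "H F \<noteq> {}" if F: "finite F" "F \<subseteq> probs" for F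
  proof -
    obtain X where "X \<in> A \<inter> band M r'" "\<forall>(P, s)\<in>C \<union> F \<times> {r}. \<not> integral\<^sup>L P X < - s"
      using not_av[OF F] unfolding avoids_def by blast
    then have "X \<in> H F" unfolding H_def by (auto simp: not_less)
    then show ?thesis by blast
  qed
  have sub: "X \<in> band M r'" if "X \<in> H F" for X F using that unfolding H_def by auto
  have anti: "H F' \<subseteq> H F" if "F \<subseteq> F'" for F F' using that unfolding H_def by auto
  have "\<exists>Y\<in>bmeas M. \<forall>F P. finite F \<and> F \<subseteq> probs \<and> P \<in> probs \<longrightarrow>
      integral\<^sup>L P Y \<in> closure ((\<lambda>X. integral\<^sup>L P X) ` H F)"
    by (rule cluster_point[OF dual, where H = H and K = r'], fact ne, rule sub, assumption,
        rule anti, assumption)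
  then obtain Y where Y: "Y \<in> bmeas M"
    "\<And>F P. finite F \<Longrightarrow> F \<subseteq> probs \<Longrightarrow> P \<in> probs \<Longrightarrow>
      integral\<^sup>L P Y \<in> closure ((\<lambda>X. integral\<^sup>L P X) ` H F)"
    by blast
  have lower: "c \<le> integral\<^sup>L P Y"
    if "finite F" "F \<subseteq> probs" "P \<in> probs" "\<And>X. X \<in> H F \<Longrightarrow> c \<le> integral\<^sup>L P X" for F P c
  proof -
    have "closure ((\<lambda>X. integral\<^sup>L P X) ` H F) \<subseteq> {c..}" using that(4) by (intro closure_minimal) auto
    then show ?thesis using Y(2)[OF that(1-3)] by auto
  qed
  have upper: "integral\<^sup>L P Y \<le> c"
    if "P \<in> probs" "\<And>X. X \<in> H {} \<Longrightarrow> integral\<^sup>L P X \<le> c" for P c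
  proof -
    have "closure ((\<lambda>X. integral\<^sup>L P X) ` H {}) \<subseteq> {..c}" using that(2) by (intro closure_minimal) auto
    then show ?thesis using Y(2)[OF _ _ that(1), of "{}"] by auto
  qed
  have "qs \<P> (\<lambda>w. - r \<le> Y w)"
  proof (rule qs_le_if_integrals_le[OF Y(1)])
    fix P assume "P \<in> probs"
    then show "- r \<le> integral\<^sup>L P Y" by (intro lower[of "{P}"]) (auto simp: H_def)
  qed
  moreover have "qs \<P> (\<lambda>w. 0 \<le> - Y w)"
  proof (rule qs_le_if_integrals_le[OF bmeas_uminus[OF Y(1)]])
    fix P assume P: "P \<in> probs"
    have "integral\<^sup>L P X \<le> 0" if "X \<in> H {}" for X
    proof -
      have "integral\<^sup>L P X \<le> (\<integral>w. 0 \<partial>P)"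
        using sub[OF that] by (intro probs_integral_mono[OF P _ bmeas_const] qsI) (auto simp: band_def)
      then show ?thesis by simp
    qed
    then show "0 \<le> (\<integral>w. - Y w \<partial>P)" using upper[OF P, of 0] by simp
  qed
  ultimately have "qs \<P> (\<lambda>w. - r \<le> Y w \<and> 0 \<le> - Y w)" by (rule qs_conj)
  \<comment> \<open>\<open>Y\<close> obeys its bounds only q.s.; clipping makes them hold everywhere
    and leaves all integrals unchanged.\<close>
  define W where "W = (\<lambda>w. max (- r) (min 0 (Y w)))"
  have Wb: "W \<in> bmeas M" unfolding W_def by (intro bmeas_intros Y)
  have band: "W \<in> band M r" using Wb r unfolding band_def W_def by auto
  have EW: "integral\<^sup>L P W = integral\<^sup>L P Y" if "P \<in> probs" for P
    by (rule probs_integral_cong[OF that Wb Y(1) qs_mp[OF \<open>qs \<P> (\<lambda>w. - r \<le> Y w \<and> 0 \<le> - Y w)\<close>]])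
      (auto simp: W_def)
  \<comment> \<open>Weak closedness of the larger piece in disguise: a measure separating
    \<open>W\<close> from it would keep its gap in the limit, but \<open>Y\<close> is that limit and
    has the same integrals as \<open>W\<close>.\<close>
  have "W \<in> A"
  proof (rule ccontr)
    assume "W \<notin> A"
    then obtain P e where P: "P \<in> probs" "e > 0"
      "\<And>X. X \<in> A \<inter> band M r' \<Longrightarrow> integral\<^sup>L P X \<le> integral\<^sup>L P W - e"
      using separate_band[OF Wb, of r'] r unfolding W_def by fastforce
    have "integral\<^sup>L P Y \<le> integral\<^sup>L P W - e" by (rule upper[OF P(1) P(3)]) (simp add: H_def)
    then show False using EW[OF P(1)] P(2) by simp
  qed
  then obtain P s where Ps: "(P, s) \<in> C" "integral\<^sup>L P W < - s"
    using av band unfolding avoids_def by blast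
  have P: "P \<in> probs" using C Ps(1) by force
  have "- s \<le> integral\<^sup>L P Y" using Ps(1) by (intro lower[of "{}"] P) (auto simp: H_def)
  then show False using Ps(2) EW[OF P] by simp
qed

text \<open>The stages start at a radius with nothing to exclude and grow by one. Each stage adds
  finitely many constraints, all with \<open>s\<close> equal to the current radius, so only finitely
  many lie below a given \<open>R\<close>. A general \<open>X\<close> in \<open>A\<close> is reached
  through \<open>min X 0\<close>, which lies in some band.\<close>

lemma constraint_family:
  assumes dual: "dual_is_Linf M \<P>" and zero: "(\<lambda>_. 0) \<notin> A"
  shows "\<exists>C d. d > 0 \<and> C \<subseteq> probs \<times> {d..} \<and> (\<forall>R. finite {(P, s) \<in> C. s < R}) \<and>
    (\<forall>X\<in>A. \<exists>(P, s)\<in>C. s < (\<integral>w. max 0 (- X w) \<partial>P))"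
proof -
  \<comment> \<open>Otherwise the constants \<open>-1/(n+1)\<close> would belong to \<open>A\<close>
    and converge to 0.\<close>
  have "\<exists>d>0. (\<lambda>_. - d) \<notin> A"
  proof (rule ccontr)
    assume "\<not> ?thesis"
    then have n: "(\<lambda>_. - (1 / real (Suc n))) \<in> A" for n by auto
    have "(\<lambda>n. - (1 / real (Suc n))) \<longlonglongrightarrow> - 0"
      by (intro tendsto_minus LIMSEQ_Suc lim_1_over_n[where 'a = real, simplified])
    then have lim: "(\<lambda>n. - (1 / real (Suc n))) \<longlonglongrightarrow> 0" by simp
    have "\<bar>- (1 / real (Suc n))\<bar> \<le> 1" for n by simp
    from A_limit[OF n bmeas_const this lim] have "(\<lambda>_. 0) \<in> A" .
    then show False using zero by simp
  qed
  then obtain d where d: "d > 0" "(\<lambda>_. - d) \<notin> A" by blast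
  define r where "r n = d + real n" for n
  \<comment> \<open>At radius \<open>d\<close> the empty family works: a member of \<open>A\<close>
    above \<open>-d\<close> would put the constant \<open>-d\<close> into \<open>A\<close>. The
    clause for \<open>n = 0\<close> anchors the later induction for \<open>tail\<close>.\<close>
  have "\<exists>C. \<forall>n. (C n \<subseteq> probs \<times> {d..} \<and> finite (C n) \<and> avoids (C n) (r n) \<and> (n = 0 \<longrightarrow> C n = {})) \<and>
     (\<exists>F\<subseteq>probs. C (Suc n) = C n \<union> F \<times> {r n})"
  proof (rule dependent_nat_choice)
    have "avoids {} (r 0)"
      unfolding avoids_def
    proof safe
      fix X assume X: "X \<in> A" "X \<in> band M (r 0)"
      have "(\<lambda>_. - d) \<in> A" by (rule A_le[OF bmeas_const X(1)]) (use X(2) in \<open>auto simp: band_def r_def\<close>)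
      then show "\<exists>(P, s)\<in>{}. integral\<^sup>L P X < - s" using d by simp
    qed
    then show "\<exists>C. C \<subseteq> probs \<times> {d..} \<and> finite C \<and> avoids C (r 0) \<and> ((0::nat) = 0 \<longrightarrow> C = {})" by blast
  next
    fix C :: "('a measure \<times> real) set" and n
    assume C: "C \<subseteq> probs \<times> {d..} \<and> finite C \<and> avoids C (r n) \<and> (n = 0 \<longrightarrow> C = {})"
    have "fst ` C \<subseteq> probs" using C by auto
    then obtain F where F: "finite F" "F \<subseteq> probs" "avoids (C \<union> F \<times> {r n}) (r (Suc n))"
      using avoids_extend[OF dual, of C "r n" "r (Suc n)"] C d unfolding r_def by auto
    moreover have "d \<le> r n" unfolding r_def by simp
    ultimately have "C \<union> F \<times> {r n} \<subseteq> probs \<times> {d..} \<and> finite (C \<union> F \<times> {r n}) \<and>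
      avoids (C \<union> F \<times> {r n}) (r (Suc n)) \<and> (Suc n = 0 \<longrightarrow> C \<union> F \<times> {r n} = {})"
      using C by auto
    then show "\<exists>C'. (C' \<subseteq> probs \<times> {d..} \<and> finite C' \<and> avoids C' (r (Suc n)) \<and> (Suc n = 0 \<longrightarrow> C' = {})) \<and>
      (\<exists>F\<subseteq>probs. C' = C \<union> F \<times> {r n})" using F(2) by blast
  qed
  then obtain C where *: "\<forall>n. (C n \<subseteq> probs \<times> {d..} \<and> finite (C n) \<and> avoids (C n) (r n) \<and>
      (n = 0 \<longrightarrow> C n = {})) \<and> (\<exists>F\<subseteq>probs. C (Suc n) = C n \<union> F \<times> {r n})" ..
  then have C: "C n \<subseteq> probs \<times> {d..}" "finite (C n)" "avoids (C n) (r n)" "n = 0 \<longrightarrow> C n = {}"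
    "\<exists>F\<subseteq>probs. C (Suc n) = C n \<union> F \<times> {r n}" for n
    using *[THEN spec, of n] by simp_all
  have "C n \<subseteq> C (Suc n)" for n using C(5)[of n] by auto
  then have mono: "m \<le> n \<Longrightarrow> C m \<subseteq> C n" for m n using lift_Suc_mono_le[of C] by blast
  \<comment> \<open>Constraints absent at stage \<open>m\<close> were added at a radius of at least
    \<open>r m\<close>, whence the finiteness claim.\<close>
  have tail: "C n \<subseteq> C m \<union> UNIV \<times> {r m..}" for n m
  proof (induction n)
    case 0
    then show ?case using C(4) by simp
  next
    case (Suc n)
    show ?case
    proof (cases "n < m")
      case True
      then show ?thesis using mono[of "Suc n" m] by auto
    next
      case False
      then have "r m \<le> r n" unfolding r_def by simp
      then show ?thesis using Suc C(5)[of n] by auto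
    qed
  qed
  show ?thesis
  proof (intro exI[of _ "\<Union>n. C n"] exI[of _ d] conjI allI ballI)
    show "d > 0" by fact
    show "(\<Union>n. C n) \<subseteq> probs \<times> {d..}" using C(1) by auto
    fix R :: real
    obtain m where "R \<le> real m" using real_arch_simple by blast
    then have m: "R \<le> r m" using d unfolding r_def by simp
    have "{(P, s) \<in> \<Union>n. C n. s < R} \<subseteq> C m" using tail[of _ m] m by fastforce
    then show "finite {(P, s) \<in> \<Union>n. C n. s < R}" using C(2) finite_subset by blast
  next
    fix X assume X: "X \<in> A"
    have Xb: "X \<in> bmeas M" using X A_bmeas by auto
    obtain K where K: "\<And>w. w \<in> space M \<Longrightarrow> \<bar>X w\<bar> \<le> K" using bmeas_bound[OF Xb] by blast
    obtain n where "K \<le> real n" using real_arch_simple by blast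
    then have n: "K \<le> r n" using d unfolding r_def by simp
    define Y where "Y = (\<lambda>w. min (X w) 0)"
    have Yb: "Y \<in> bmeas M" unfolding Y_def by (intro bmeas_intros Xb)
    have "Y \<in> A" by (rule A_le[OF Yb X]) (simp add: Y_def)
    moreover have "- r n \<le> Y w \<and> Y w \<le> 0" if "w \<in> space M" for w
      using K[OF that] n d unfolding Y_def r_def by (auto simp: min_def)
    then have "Y \<in> band M (r n)" using Yb unfolding band_def by simp
    ultimately obtain P s where Ps: "(P, s) \<in> C n" "integral\<^sup>L P Y < - s"
      using C(3)[of n] unfolding avoids_def by blast
    have "(\<integral>w. max 0 (- X w) \<partial>P) = (\<integral>w. - Y w \<partial>P)"
      unfolding Y_def by (intro Bochner_Integration.integral_cong) auto
    then have "s < (\<integral>w. max 0 (- X w) \<partial>P)" using Ps(2) by simp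
    then show "\<exists>(P, s)\<in>\<Union>n. C n. s < (\<integral>w. max 0 (- X w) \<partial>P)" using Ps(1) by blast
  qed
qed

text \<open>Continuity at \<open>{}\<close>: all but finitely many members of \<open>C\<close> have \<open>s \<ge> R\<close>, and these
  contribute at most \<open>1 / R\<close> to the value on any set.\<close>

lemma dominated_functional_is_integral:
  assumes C: "C \<subseteq> probs \<times> {d..}" "d > 0" "\<And>R. finite {(P, s) \<in> C. s < R}"
    and lin: "linear_on_funs (bmeas M) \<phi>"
    and pos: "\<And>X. X \<in> bmeas M \<Longrightarrow> (\<And>w. w \<in> space M \<Longrightarrow> 0 \<le> X w) \<Longrightarrow> 0 \<le> \<phi> X"
    and dom: "\<And>X c. X \<in> bmeas M \<Longrightarrow> 0 \<le> c \<Longrightarrow>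
      (\<And>P s. (P, s) \<in> C \<Longrightarrow> (\<integral>w. max 0 (X w) \<partial>P) / s \<le> c) \<Longrightarrow> \<phi> X \<le> c"
    and nz: "X1 \<in> bmeas M" "\<phi> X1 \<noteq> 0"
  shows "\<exists>P\<in>probs. \<exists>m>0. \<forall>X\<in>bmeas M. \<phi> X = m * integral\<^sup>L P X"
proof -
  have add: "\<phi> (\<lambda>w. X w + Y w) = \<phi> X + \<phi> Y" if "X \<in> bmeas M" "Y \<in> bmeas M" for X Y
    using lin that unfolding linear_on_funs_def by blast
  have Cd: "P \<in> probs" "d \<le> s" "0 < s" if "(P, s) \<in> C" for P s using C(1,2) that by auto
  have bound': "\<phi> X \<le> 1 / d * K"
    if X: "X \<in> bmeas M" "\<And>w. w \<in> space M \<Longrightarrow> \<bar>X w\<bar> \<le> K" for X K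
  proof -
    obtain P0 where P0: "P0 \<in> probs" using probs_nonempty by blast
    have "space M \<noteq> {}" using prob_space.not_empty[OF probs_prob[OF P0]] probs_space[OF P0] by simp
    then have K: "0 \<le> K" using X(2) by force
    show ?thesis
    proof (rule dom[OF X(1)])
      show "0 \<le> 1 / d * K" using K C(2) by simp
      fix P s assume Ps: "(P, s) \<in> C"
      have "(\<integral>w. max 0 (X w) \<partial>P) \<le> (\<integral>w. K \<partial>P)"
        using X(2) K by (intro probs_integral_mono Cd(1)[OF Ps] bmeas_intros X qsI) (fastforce simp: abs_le_iff)
      then have "(\<integral>w. max 0 (X w) \<partial>P) \<le> K" by (simp only: probs_integral_const[OF Cd(1)[OF Ps]])
      then have "(\<integral>w. max 0 (X w) \<partial>P) / s \<le> K / d"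
        using Cd(2,3)[OF Ps] C(2) K by (intro frac_le) auto
      then show "(\<integral>w. max 0 (X w) \<partial>P) / s \<le> 1 / d * K" by simp
    qed
  qed
  have bound: "\<bar>\<phi> X\<bar> \<le> 1 / d * K"
    if X: "X \<in> bmeas M" "\<And>w. w \<in> space M \<Longrightarrow> \<bar>X w\<bar> \<le> K" for X K
    using bound'[OF X] bound'[OF bmeas_uminus[OF X(1)], of K] X(2) linear_on_funs_neg[OF lin X(1)]
    by (auto simp: abs_le_iff)
  define m where "m S = \<phi> (indicator S)" for S
  have m0: "0 \<le> m S" if "S \<in> sets M" for S
    unfolding m_def by (rule pos[OF bmeas_indicator[OF that]]) simp
  have mUn: "m (S \<union> T) = m S + m T" if "S \<in> sets M" "T \<in> sets M" "S \<inter> T = {}" for S T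
  proof -
    have "(indicator (S \<union> T) :: 'a \<Rightarrow> real) = (\<lambda>w. indicator S w + indicator T w)"
      using that(3) by (auto simp: indicator_def fun_eq_iff)
    then show ?thesis unfolding m_def using add[OF bmeas_indicator bmeas_indicator] that by simp
  qed
  have mle: "m S \<le> c" if S: "S \<in> sets M" "0 \<le> c" "\<And>P s. (P, s) \<in> C \<Longrightarrow> measure P S / s \<le> c" for S c
    unfolding m_def
  proof (rule dom[OF bmeas_indicator[OF S(1)] S(2)])
    fix P s assume Ps: "(P, s) \<in> C"
    have "max 0 (indicator S w :: real) = indicator S w" for w by (simp add: indicator_def)
    moreover have "S \<inter> space P = S"
      using S(1) sets.sets_into_space probs_space[OF Cd(1)[OF Ps]] by blast
    ultimately show "(\<integral>w. max 0 (indicator S w) \<partial>P) / s \<le> c" using S(3)[OF Ps] by simp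
  qed
  \<comment> \<open>If the total mass were 0, monotonicity would kill every indicator and then
    \<phi> itself, contrary to \<open>nz\<close>.\<close>
  have mspace: "m (space M) > 0"
  proof (rule ccontr)
    assume "\<not> ?thesis"
    then have "m (space M) = 0" using m0[of "space M"] by simp
    then have "m S = 0" if "S \<in> sets M" for S
      using mUn[of S "space M - S"] m0[OF that] m0[of "space M - S"] that sets.sets_into_space[OF that]
      by (simp add: Un_absorb1 Un_Diff_cancel)
    then have "\<phi> X1 = 0"
      by (intro linear_bmeas_zero[OF lin bound _ nz(1)]) (simp_all add: m_def)
    then show False using nz by simp
  qed
  define c where "c = m (space M)"
  define f where "f S = ennreal (m S / c)" for S
  define P where "P = measure_of (space M) (sets M) f"
  have c: "c > 0" unfolding c_def by (rule mspace)
  have mempty: "m {} = 0" using mUn[of "{}" "{}"] by simp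
  have positive: "positive (sets M) f" unfolding positive_def f_def by (simp add: mempty)
  have ca: "countably_additive (sets M) f"
  proof (rule sets.empty_continuous_imp_countably_additive[OF positive])
    show "additive (sets M) f"
      unfolding additive_def f_def using m0 c by (auto simp: mUn add_divide_distrib ennreal_plus)
    show "\<forall>S\<in>sets M. f S \<noteq> \<infinity>" unfolding f_def by simp
    fix S :: "nat \<Rightarrow> 'a set" assume S: "range S \<subseteq> sets M" "decseq S" "(\<Inter>i. S i) = {}"
    have Sm: "S i \<in> sets M" for i using S(1) by auto
    have "(\<lambda>i. m (S i)) \<longlonglongrightarrow> 0"
    proof (rule order_tendstoI)
      fix e :: real assume e: "0 < e"
      \<comment> \<open>Chosen so that \<open>1 / R = e / 2\<close>; the finitely many constraints
        with \<open>s < R\<close> are handled by continuity of each \<open>P\<close> along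
        \<open>S\<close>.\<close>
      define R where "R = 2 / e"
      have ev: "\<forall>\<^sub>F i in sequentially. measure P (S i) / s < e / 2" if "(P, s) \<in> C" for P s
      proof -
        interpret prob_space P using Cd(1)[OF that] by (rule probs_prob)
        have "(\<lambda>i. measure P (S i)) \<longlonglongrightarrow> measure P (\<Inter>i. S i)"
          using S probs_sets[OF Cd(1)[OF that]] by (intro finite_Lim_measure_decseq) auto
        then have "(\<lambda>i. measure P (S i) / s) \<longlonglongrightarrow> 0 / s"
          using S(3) Cd(3)[OF that] by (intro tendsto_divide tendsto_const) auto
        then show ?thesis using e by (intro order_tendstoD(2)[where y = 0]) auto
      qed
      have "\<forall>\<^sub>F i in sequentially. \<forall>x\<in>{(P, s) \<in> C. s < R}. measure (fst x) (S i) / snd x < e / 2"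
        using ev by (intro eventually_ball_finite[OF C(3)]) auto
      then show "\<forall>\<^sub>F i in sequentially. m (S i) < e"
      proof eventually_elim
        case (elim i)
        have "m (S i) \<le> e / 2"
        proof (rule mle[OF Sm])
          fix P s assume Ps: "(P, s) \<in> C"
          show "measure P (S i) / s \<le> e / 2"
          proof (cases "s < R")
            case True
            then show ?thesis using elim Ps by force
          next
            case False
            have "measure P (S i) / s \<le> 1 / R"
              using False e prob_space.prob_le_1[OF probs_prob[OF Cd(1)[OF Ps]]]
              by (intro frac_le) (auto simp: R_def)
            then show ?thesis unfolding R_def by simp
          qed
        qed (use e in simp)
        then show ?case using e by simp
      qed
    next
      fix e :: real assume "e < 0"
      then have "e < m (S i)" for i using m0[OF Sm[of i]] by linarith
      then show "\<forall>\<^sub>F i in sequentially. e < m (S i)" by simp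
    qed
    then have "(\<lambda>i. ennreal (m (S i) / c)) \<longlonglongrightarrow> ennreal (0 / c)"
      using c by (intro tendsto_ennrealI tendsto_divide tendsto_const) auto
    then show "(\<lambda>i. f (S i)) \<longlonglongrightarrow> 0" unfolding f_def by simp
  qed
  have sP: "sets P = sets M" "space P = space M"
    unfolding P_def by (simp_all add: sets.space_closed sets_measure_of_conv space_measure_of_conv sets.sigma_sets_eq)
  have eP: "emeasure P S = f S" if "S \<in> sets M" for S
    using that by (intro emeasure_measure_of[OF P_def sets.space_closed]) (simp_all add: sP positive ca)
  have mP: "measure P S = m S / c" if "S \<in> sets M" for S
    using eP[OF that] m0[OF that] c unfolding measure_def f_def by simp
  have "P \<in> probs"
  proof (rule probsI[OF _ sP(1)])
    show "prob_space P" using c by (intro prob_spaceI) (simp add: sP eP f_def c_def)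
    fix S assume S: "S \<in> sets M" "capacity \<P> S = 0"
    have "m S \<le> 0" using probs_null[OF Cd(1) S] by (intro mle[OF S(1)]) auto
    then show "measure P S = 0" using m0[OF S(1)] mP[OF S(1)] by simp
  qed
  moreover have "\<phi> X = c * integral\<^sup>L P X" if X: "X \<in> bmeas M" for X
  proof (rule linear_bmeas_eq[OF lin _ bound _ _ X, where L' = "\<lambda>X. c * integral\<^sup>L P X" and C' = c])
    note int = probs_integrable[OF \<open>P \<in> probs\<close>]
    show "linear_on_funs (bmeas M) (\<lambda>X. c * integral\<^sup>L P X)"
      unfolding linear_on_funs_def using int by (simp add: algebra_simps)
    show "\<bar>c * integral\<^sup>L P X\<bar> \<le> c * K" if X: "X \<in> bmeas M" "\<And>w. w \<in> space M \<Longrightarrow> \<bar>X w\<bar> \<le> K" for X K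
    proof -
      have "\<bar>integral\<^sup>L P X\<bar> \<le> (\<integral>w. \<bar>X w\<bar> \<partial>P)" by (rule integral_abs_bound)
      also have "\<dots> \<le> (\<integral>w. K \<partial>P)" using int X bmeas_const
        by (intro integral_mono) (auto simp: sP)
      finally have "\<bar>integral\<^sup>L P X\<bar> \<le> K" by (simp only: probs_integral_const[OF \<open>P \<in> probs\<close>])
      then show ?thesis using c by (simp add: abs_mult)
    qed
    show "\<phi> (indicator S) = c * integral\<^sup>L P (indicator S)" if "S \<in> sets M" for S
      using mP[OF that] c sets.sets_into_space[OF that] by (simp add: m_def sP Int_absorb2)
  qed
  ultimately show ?thesis using c by blast
qed

text \<open>The gauge \<open>p X = sup E_P[X^-] / s\<close> over the constraints is at least 1 on
  \<open>A\<close>. Hahn--Banach gives \<psi> below \<open>p\<close> with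
  \<open>\<psi> \<ge> 1\<close> on \<open>A\<close>; its negative is \<open>m E_P\<close> for some
  \<open>P\<close> in \<open>probs\<close>, and the gap is \<open>1 / m\<close>.\<close>

lemma separate_zero:
  assumes dual: "dual_is_Linf M \<P>" and zero: "(\<lambda>_. 0) \<notin> A"
  shows "\<exists>P\<in>probs. \<exists>e>0. \<forall>X\<in>A. integral\<^sup>L P X \<le> - e"
proof (cases "A = {}")
  case True
  then show ?thesis using probs_nonempty by (auto intro!: exI[of _ "1 :: real"])
next
  case False
  obtain C d where C: "d > 0" "C \<subseteq> probs \<times> {d..}" "\<And>R. finite {(P, s) \<in> C. s < R}"
    "\<And>X. X \<in> A \<Longrightarrow> \<exists>(P, s)\<in>C. s < (\<integral>w. max 0 (- X w) \<partial>P)"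
    using constraint_family[OF dual zero] by blast
  define t where "t x X = (\<integral>w. max 0 (- X w) \<partial>fst x) / snd x" for x :: "'a measure \<times> real" and X :: "'a \<Rightarrow> real"
  define p where "p X = (SUP x\<in>C. t x X)" for X
  have Cd: "fst x \<in> probs" "d \<le> snd x" "0 < snd x" if "x \<in> C" for x using C(1,2) that by auto
  have "C \<noteq> {}" using False C(4) by blast
  have bdd: "bdd_above ((\<lambda>x. t x X) ` C)" if X: "X \<in> bmeas M" for X
  proof -
    obtain K where K: "K > 0" "\<And>w. w \<in> space M \<Longrightarrow> \<bar>X w\<bar> \<le> K" using bmeas_bound[OF X] by blast
    have "t x X \<le> K / d" if x: "x \<in> C" for x
    proof -
      have "(\<integral>w. max 0 (- X w) \<partial>fst x) \<le> (\<integral>w. K \<partial>fst x)"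
        using K by (intro probs_integral_mono Cd(1)[OF x] bmeas_intros X qsI) (fastforce simp: abs_le_iff)
      then have "(\<integral>w. max 0 (- X w) \<partial>fst x) \<le> K" by (simp only: probs_integral_const[OF Cd(1)[OF x]])
      then show ?thesis unfolding t_def using Cd(2,3)[OF x] C(1) K by (intro frac_le) auto
    qed
    then show ?thesis by (rule bdd_aboveI2)
  qed
  have t_le: "t x X \<le> p X" if "x \<in> C" "X \<in> bmeas M" for x X
    unfolding p_def using that bdd by (intro cSUP_upper) auto
  have p_le: "p X \<le> c" if "\<And>x. x \<in> C \<Longrightarrow> t x X \<le> c" for X c
    unfolding p_def using \<open>C \<noteq> {}\<close> that by (intro cSUP_least) auto
  have sub: "sublinear_on (bmeas M) p"
    unfolding sublinear_on_def
  proof (intro conjI ballI allI impI)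
    fix X Y assume XY: "X \<in> bmeas M" "Y \<in> bmeas M"
    show "p (\<lambda>w. X w + Y w) \<le> p X + p Y"
    proof (rule p_le)
      fix x assume x: "x \<in> C"
      note int = probs_integrable[OF Cd(1)[OF x]]
      have "(\<integral>w. max 0 (- (X w + Y w)) \<partial>fst x) \<le> (\<integral>w. max 0 (- X w) + max 0 (- Y w) \<partial>fst x)"
        by (intro integral_mono int bmeas_intros XY) auto
      also have "\<dots> = (\<integral>w. max 0 (- X w) \<partial>fst x) + (\<integral>w. max 0 (- Y w) \<partial>fst x)"
        by (intro Bochner_Integration.integral_add int bmeas_intros XY)
      finally have "t x (\<lambda>w. X w + Y w) \<le> t x X + t x Y"
        unfolding t_def using Cd(3)[OF x] by (simp add: divide_right_mono flip: add_divide_distrib)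
      then show "t x (\<lambda>w. X w + Y w) \<le> p X + p Y" using t_le[OF x XY(1)] t_le[OF x XY(2)] by simp
    qed
  next
    fix X and c :: real assume X: "X \<in> bmeas M" and c: "0 \<le> c"
    show "p (\<lambda>w. c * X w) \<le> c * p X"
    proof (rule p_le)
      fix x assume x: "x \<in> C"
      have "max 0 (- (c * X w)) = c * max 0 (- X w)" for w
        using c by (simp add: max_mult_distrib_left)
      then have "t x (\<lambda>w. c * X w) = c * t x X" unfolding t_def by simp
      then show "t x (\<lambda>w. c * X w) \<le> c * p X" using t_le[OF x X] c by (simp add: mult_left_mono)
    qed
  qed
  have p1: "1 \<le> p X" if X: "X \<in> A" for X
  proof -
    obtain P s where Ps: "(P, s) \<in> C" "s < (\<integral>w. max 0 (- X w) \<partial>P)" using C(4)[OF X] by blast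
    then have "1 \<le> t (P, s) X" unfolding t_def using Cd(3)[OF Ps(1)] by simp
    then show ?thesis using t_le[OF Ps(1)] X A_bmeas by force
  qed
  obtain \<psi> where \<psi>: "linear_on_funs (bmeas M) \<psi>" "\<And>X. X \<in> bmeas M \<Longrightarrow> \<psi> X \<le> p X" "\<And>X. X \<in> A \<Longrightarrow> 1 \<le> \<psi> X"
    using Hahn_Banach_separation[OF fun_subspace_bmeas sub A_bmeas A_convex False, of 1] p1 by metis
  have neg: "\<psi> (\<lambda>w. - X w) = - \<psi> X" if "X \<in> bmeas M" for X by (rule linear_on_funs_neg[OF \<psi>(1) that])
  obtain X1 where X1: "X1 \<in> A" using False by auto
  have "\<exists>P\<in>probs. \<exists>m>0. \<forall>X\<in>bmeas M. - \<psi> X = m * integral\<^sup>L P X"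
  proof (rule dominated_functional_is_integral[OF C(2,1,3)])
    show "linear_on_funs (bmeas M) (\<lambda>X. - \<psi> X)" using \<psi>(1) unfolding linear_on_funs_def by auto
    fix X assume X: "X \<in> bmeas M"
    \<comment> \<open>A nonnegative \<open>X\<close> has vanishing negative part, hence
      \<open>p X \<le> 0\<close>.\<close>
    show "0 \<le> - \<psi> X" if "\<And>w. w \<in> space M \<Longrightarrow> 0 \<le> X w"
    proof -
      have "p X \<le> 0"
      proof (rule p_le)
        fix x assume x: "x \<in> C"
        have "(\<integral>w. max 0 (- X w) \<partial>fst x) = (\<integral>w. 0 \<partial>fst x)"
          using that probs_space[OF Cd(1)[OF x]] by (intro Bochner_Integration.integral_cong) auto
        then show "t x X \<le> 0" unfolding t_def by simp
      qed
      then show ?thesis using \<psi>(2)[OF X] by simp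
    qed
    fix c :: real assume c: "0 \<le> c" "\<And>P s. (P, s) \<in> C \<Longrightarrow> (\<integral>w. max 0 (X w) \<partial>P) / s \<le> c"
    have "p (\<lambda>w. - X w) \<le> c" by (rule p_le) (use c(2) in \<open>auto simp: t_def\<close>)
    then show "- \<psi> X \<le> c" using \<psi>(2)[OF bmeas_uminus[OF X]] neg[OF X] by simp
  next
    show "X1 \<in> bmeas M" using X1 A_bmeas by auto
    show "- \<psi> X1 \<noteq> 0" using \<psi>(3)[OF X1] by simp
  qed
  then obtain P m where P: "P \<in> probs" "m > 0" "\<And>X. X \<in> bmeas M \<Longrightarrow> - \<psi> X = m * integral\<^sup>L P X" by blast
  have "integral\<^sup>L P X \<le> - (1 / m)" if X: "X \<in> A" for X
  proof -
    have "m * integral\<^sup>L P X \<le> - 1" using P(3)[of X] \<psi>(3)[OF X] X A_bmeas by auto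
    then show ?thesis using P(2) by (simp add: field_simps)
  qed
  then show ?thesis using P(1,2) by (intro bexI[of _ P] exI[of _ "1 / m"]) auto
qed

text \<open>All the axioms of \<open>acceptance\<close> survive translation by a bounded function,
  so the case of the point 0 is enough; cutting off at 0 is what made that point convenient.\<close>

theorem separate:
  assumes dual: "dual_is_Linf M \<P>" and X0: "X0 \<in> bmeas M" "X0 \<notin> A"
  shows "\<exists>P\<in>probs. \<exists>e>0. \<forall>X\<in>A. integral\<^sup>L P X \<le> integral\<^sup>L P X0 - e"
proof -
  define B where "B = {Y \<in> bmeas M. (\<lambda>w. Y w + X0 w) \<in> A}"
  interpret B: acceptance M \<P> B
  proof
    show "B \<subseteq> bmeas M" unfolding B_def by auto
    show "convex_funs B"
      unfolding convex_funs_def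
    proof (intro ballI)
      fix X Y and l :: real assume XY: "X \<in> B" "Y \<in> B" and l: "l \<in> {0..1}"
      have "(\<lambda>w. l * (X w + X0 w) + (1 - l) * (Y w + X0 w)) \<in> A"
        using A_convex XY l unfolding B_def convex_funs_def by auto
      moreover have "(\<lambda>w. l * (X w + X0 w) + (1 - l) * (Y w + X0 w)) = (\<lambda>w. (l * X w + (1 - l) * Y w) + X0 w)"
        by (simp add: algebra_simps)
      moreover have "(\<lambda>w. l * X w + (1 - l) * Y w) \<in> bmeas M"
        using XY unfolding B_def by (intro bmeas_intros) auto
      ultimately show "(\<lambda>w. l * X w + (1 - l) * Y w) \<in> B" unfolding B_def by simp
    qed
    show "Y \<in> B" if Y: "Y \<in> bmeas M" and X: "X \<in> B" and le: "qs \<P> (\<lambda>w. Y w \<le> X w)" for X Y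
    proof -
      have "(\<lambda>w. Y w + X0 w) \<in> A"
      proof (rule A_down)
        show "(\<lambda>w. Y w + X0 w) \<in> bmeas M" by (intro bmeas_intros Y X0)
        show "(\<lambda>w. X w + X0 w) \<in> A" using X unfolding B_def by simp
        show "qs \<P> (\<lambda>w. Y w + X0 w \<le> X w + X0 w)" by (rule qs_mp[OF le]) simp
      qed
      then show ?thesis using Y unfolding B_def by simp
    qed
    show "Y \<in> B" if X: "\<And>n. X n \<in> B" and Y: "Y \<in> bmeas M"
      and bd: "\<And>n w. w \<in> space M \<Longrightarrow> \<bar>X n w\<bar> \<le> K"
      and lim: "\<And>w. w \<in> space M \<Longrightarrow> (\<lambda>n. X n w) \<longlonglongrightarrow> Y w" for X :: "nat \<Rightarrow> 'a \<Rightarrow> real" and Y K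
    proof -
      obtain L where L: "\<And>w. w \<in> space M \<Longrightarrow> \<bar>X0 w\<bar> \<le> L" using bmeas_bound[OF X0(1)] by blast
      have "(\<lambda>w. Y w + X0 w) \<in> A"
      proof (rule A_limit[where X = "\<lambda>n w. X n w + X0 w" and K = "K + L"])
        show "(\<lambda>w. X n w + X0 w) \<in> A" for n using X unfolding B_def by simp
        show "\<bar>X n w + X0 w\<bar> \<le> K + L" if "w \<in> space M" for n w
          using bd[OF that, of n] L[OF that] by linarith
        show "(\<lambda>n. X n w + X0 w) \<longlonglongrightarrow> Y w + X0 w" if "w \<in> space M" for w
          by (intro tendsto_intros lim that)
      qed (intro bmeas_intros Y X0)
      then show ?thesis using Y unfolding B_def by simp
    qed
    show "\<exists>Q\<in>probs. \<forall>Y\<in>B. \<not> (AE w in Q. X w = Y w)" if X: "X \<in> bmeas M" "X \<notin> B" for X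
    proof -
      have "(\<lambda>w. X w + X0 w) \<in> bmeas M" "(\<lambda>w. X w + X0 w) \<notin> A"
        using X X0 unfolding B_def by (auto intro: bmeas_add)
      then obtain Q where Q: "Q \<in> probs" "\<And>Y. Y \<in> A \<Longrightarrow> \<not> (AE w in Q. X w + X0 w = Y w)"
        using A_sensitive by blast
      have "\<not> (AE w in Q. X w = Y w)" if "Y \<in> B" for Y
        using Q(2)[of "\<lambda>w. Y w + X0 w"] that unfolding B_def by simp
      then show ?thesis using Q(1) by blast
    qed
  qed
  have "(\<lambda>_. 0) \<notin> B" using X0 unfolding B_def by simp
  then obtain P e where P: "P \<in> probs" "e > 0" "\<And>X. X \<in> B \<Longrightarrow> integral\<^sup>L P X \<le> - e"
    using B.separate_zero[OF dual] by blast
  have "integral\<^sup>L P X \<le> integral\<^sup>L P X0 - e" if X: "X \<in> A" for X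
  proof -
    have Xb: "X \<in> bmeas M" using X A_bmeas by auto
    have "(\<lambda>w. X w - X0 w) \<in> B" using X Xb X0 unfolding B_def by (auto intro: bmeas_diff)
    from P(3)[OF this] show ?thesis
      using probs_integrable[OF P(1) Xb] probs_integrable[OF P(1) X0(1)] by simp
  qed
  then show ?thesis using P(1,2) by blast
qed

end

subsection \<open>Level sets and lower semicontinuity\<close>

lemma cls_eq: "X \<in> bmeas M \<Longrightarrow> cls M \<Q> X = {Y \<in> bmeas M. qs \<Q> (\<lambda>w. X w = Y w)}"
  unfolding cls_def qs_rel_def by auto

lemma qs_trans: "qs \<Q> (\<lambda>w. X w = Y w) \<Longrightarrow> qs \<Q> (\<lambda>w. Y w = Z w) \<Longrightarrow> qs \<Q> (\<lambda>w. X w = Z w)"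
proof -
  assume *: "qs \<Q> (\<lambda>w. X w = Y w)" "qs \<Q> (\<lambda>w. Y w = Z w)"
  have "AE w in P. X w = Z w" if "P \<in> \<Q>" for P
  proof -
    have "AE w in P. X w = Y w" "AE w in P. Y w = Z w" using * that unfolding qs_def by auto
    then show ?thesis by eventually_elim simp
  qed
  then show ?thesis unfolding qs_def by blast
qed

lemma qs_sym: "qs \<Q> (\<lambda>w. X w = Y w) \<Longrightarrow> qs \<Q> (\<lambda>w. Y w = X w)"
  by (simp only: eq_commute)

lemma qs_refl: "qs \<Q> (\<lambda>w. X w = X w)"
  unfolding qs_def by simp

lemma cls_eq_iff:
  assumes X: "X \<in> bmeas M" and Y: "Y \<in> bmeas M"
  shows "cls M \<Q> X = cls M \<Q> Y \<longleftrightarrow> qs \<Q> (\<lambda>w. X w = Y w)"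
proof
  assume "cls M \<Q> X = cls M \<Q> Y"
  then have "Y \<in> cls M \<Q> X" using Y qs_refl[of \<Q> Y] by (simp add: cls_eq)
  then show "qs \<Q> (\<lambda>w. X w = Y w)" using X by (simp add: cls_eq)
next
  assume *: "qs \<Q> (\<lambda>w. X w = Y w)"
  have "qs \<Q> (\<lambda>w. X w = Z w) \<longleftrightarrow> qs \<Q> (\<lambda>w. Y w = Z w)" for Z
    using qs_trans[OF *, of Z] qs_trans[OF qs_sym[OF *], of Z] by blast
  then show "cls M \<Q> X = cls M \<Q> Y" using X Y by (simp add: cls_eq)
qed

lemma cls_in_Linf: "X \<in> bmeas M \<Longrightarrow> cls M \<P> X \<in> Linf M \<P>"
  unfolding Linf_def cls_def by (rule quotientI)

lemma Linf_cases:
  assumes "Z \<in> Linf M \<P>" obtains X where "X \<in> bmeas M" "Z = cls M \<P> X"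
  using assms unfolding Linf_def cls_def by (rule quotientE)

text \<open>Separation is available at real levels only. Approaching a value from below by reals
  treats finite and infinite values of \<open>f\<close> alike.\<close>

lemma ereal_le_if_reals_below_le:
  fixes x y :: ereal
  assumes "\<And>a::real. ereal a < x \<Longrightarrow> ereal a \<le> y"
  shows "x \<le> y"
proof (rule ccontr)
  assume "\<not> x \<le> y"
  then obtain a where "y < ereal a" "ereal a < x" using ereal_dense2[of y x] by (auto simp: not_le)
  then show False using assms[of a] by simp
qed

context robust begin

text \<open>The representative selected by \<open>SOME\<close> agrees with the given one q.s., hence
  \<open>Q\<close>-a.e. because \<open>Q\<close> is dominated. Read contrapositively, distinct
  images under \<open>jmap\<close> forbid \<open>Q\<close>-a.e. equality, the form of sensitivity in
  \<open>A_sensitive\<close>.\<close>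

lemma jmap_cls_cong:
  assumes Q: "Q \<in> probs" and X: "X \<in> bmeas M" and Y: "Y \<in> bmeas M"
    and eq: "AE w in Q. X w = Y w"
  shows "jmap M Q (cls M \<P> X) = jmap M Q (cls M \<P> Y)"
proof -
  have rep: "jmap M Q (cls M \<P> X) = cls M {Q} X" if X: "X \<in> bmeas M" for X
  proof -
    define X' where "X' = (SOME X'. X' \<in> cls M \<P> X)"
    have "X' \<in> cls M \<P> X" unfolding X'_def
      by (rule someI[of _ X]) (use X qs_refl[of \<P> X] in \<open>simp add: cls_eq\<close>)
    then have X': "X' \<in> bmeas M" "qs \<P> (\<lambda>w. X w = X' w)" using X by (auto simp: cls_eq)
    have [measurable]: "X \<in> borel_measurable M" "X' \<in> borel_measurable M"
      using X X'(1) by (auto intro: bmeas_measurable)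
    have "AE w in Q. X w = X' w" by (rule qs_imp_AE_probs[OF Q _ X'(2)]) measurable
    then have "cls M {Q} X = cls M {Q} X'" using cls_eq_iff[OF X X'(1)] by (simp add: qs_def)
    then show ?thesis unfolding jmap_def X'_def by simp
  qed
  have "cls M {Q} X = cls M {Q} Y" using eq cls_eq_iff[OF X Y] by (simp add: qs_def)
  then show ?thesis using rep X Y by simp
qed

text \<open>The constant sequence \<open>X\<close> converges q.s. to \<open>Y\<close>, and limits of
  reals are unique.\<close>

lemma signed_integral_cong:
  assumes \<mu>: "\<mu> \<in> ca_c M \<P>" and X: "X \<in> bmeas M" and Y: "Y \<in> bmeas M"
    and eq: "qs \<P> (\<lambda>w. X w = Y w)"
  shows "signed_integral M \<mu> X = signed_integral M \<mu> Y"
proof -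
  obtain K where "\<And>w. w \<in> space M \<Longrightarrow> \<bar>X w\<bar> \<le> K" using bmeas_bound[OF X] by blast
  then have "(\<lambda>n::nat. signed_integral M \<mu> X) \<longlonglongrightarrow> signed_integral M \<mu> Y"
    by (intro signed_integral_tendsto[OF \<mu> X Y, where K = K] qsI qs_mp[OF eq]) auto
  then show ?thesis by (simp add: LIMSEQ_const_iff)
qed

text \<open>The slack 1 spares a proof that the infimum in the norm is attained; only uniform
  boundedness matters.\<close>

lemma qs_abs_le_if_Linf_norm_le:
  assumes X: "X \<in> bmeas M" and "Linf_norm \<P> X \<le> K"
  shows "qs \<P> (\<lambda>w. \<bar>X w\<bar> \<le> K + 1)"
proof -
  let ?S = "{m. \<forall>P\<in>\<P>. measure P {w \<in> space P. \<bar>X w\<bar> \<le> m} = 1}"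
  obtain B where B: "\<And>w. w \<in> space M \<Longrightarrow> \<bar>X w\<bar> \<le> B" using bmeas_bound[OF X] by blast
  have "measure P {w \<in> space P. \<bar>X w\<bar> \<le> B} = 1" if P: "P \<in> \<P>" for P
  proof -
    have "{w \<in> space P. \<bar>X w\<bar> \<le> B} = space P" using B \<P>_space[OF P] by auto
    then show ?thesis using prob_space.prob_space[OF \<P>_prob[OF P]] by simp
  qed
  then have "?S \<noteq> {}" by blast
  moreover have "Inf ?S < K + 1" using assms(2) unfolding Linf_norm_def by simp
  ultimately obtain m where m: "m \<in> ?S" "m < K + 1" using cInf_lessD[of ?S "K + 1"] by auto
  have "AE w in P. \<bar>X w\<bar> \<le> K + 1" if P: "P \<in> \<P>" for P
  proof -
    have "AE w in P. w \<in> {w \<in> space P. \<bar>X w\<bar> \<le> m}"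
      using m(1) P by (intro prob_space.AE_prob_1[OF \<P>_prob[OF P]]) auto
    then show ?thesis by eventually_elim (use m(2) in auto)
  qed
  then show ?thesis unfolding qs_def by blast
qed

lemma Linf_norm_le:
  assumes X: "X \<in> bmeas M" and le: "qs \<P> (\<lambda>w. \<bar>X w\<bar> \<le> K)"
  shows "Linf_norm \<P> X \<le> K"
  unfolding Linf_norm_def
proof (rule cInf_lower)
  let ?S = "{m. \<forall>P\<in>\<P>. measure P {w \<in> space P. \<bar>X w\<bar> \<le> m} = 1}"
  have "measure P {w \<in> space P. \<bar>X w\<bar> \<le> K} = 1" if P: "P \<in> \<P>" for P
  proof -
    interpret prob_space P using P by (rule \<P>_prob)
    have [measurable]: "X \<in> borel_measurable P"
      using X by (intro probs_measurable[OF \<P>_probs[OF P]] bmeas_measurable)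
    show ?thesis using le P unfolding qs_def by (subst prob_Collect_eq_1) auto
  qed
  then show "K \<in> ?S" by blast
  obtain P where P: "P \<in> \<P>" using \<P>_nonempty by auto
  have "0 \<le> m" if "m \<in> ?S" for m
  proof (rule ccontr)
    assume "\<not> 0 \<le> m"
    then have *: "{w \<in> space P. \<bar>X w\<bar> \<le> m} = {}" by auto
    have "measure P {w \<in> space P. \<bar>X w\<bar> \<le> m} = 1" using that P by blast
    then show False unfolding * by simp
  qed
  then show "bdd_below ?S" by (intro bdd_belowI[where m = 0])
qed

text \<open>Induction over the generation of open sets. A subbasic set is an image under
  \<open>cls\<close>, so membership only yields some representative \<open>Y'\<close>, and q.s.
  invariance of the integral brings the condition back to \<open>Y\<close>.\<close>

lemma weak_top_eventually:
  fixes X :: "nat \<Rightarrow> 'a \<Rightarrow> real"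
  assumes X: "\<And>n. X n \<in> bmeas M" and Y: "Y \<in> bmeas M"
    and bound: "\<And>n. qs \<P> (\<lambda>w. \<bar>X n w\<bar> \<le> K)" and lim: "qs \<P> (\<lambda>w. (\<lambda>n. X n w) \<longlonglongrightarrow> Y w)"
    and U: "openin (weak_top M \<P>) U" "cls M \<P> Y \<in> U"
  shows "\<forall>\<^sub>F n in sequentially. cls M \<P> (X n) \<in> U"
proof -
  let ?S = "{cls M \<P> ` {X \<in> bmeas M. signed_integral M \<mu> X \<in> U} | \<mu> U. \<mu> \<in> ca_c M \<P> \<and> open U}"
  have "generate_topology_on ?S U"
    using U(1) unfolding weak_top_def by (rule openin_topology_generated_by)
  then show ?thesis using U(2)
  proof induction
    case Empty
    then show ?case by simp
  next
    case (Int a b)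
    then show ?case by (auto intro: eventually_conj)
  next
    case (UN K)
    then obtain k where k: "k \<in> K" "cls M \<P> Y \<in> k" by blast
    from UN.IH[OF k] show ?case by eventually_elim (use k in blast)
  next
    case (Basis s)
    then obtain \<mu> V where s: "s = cls M \<P> ` {X \<in> bmeas M. signed_integral M \<mu> X \<in> V}"
      and \<mu>: "\<mu> \<in> ca_c M \<P>" and V: "open V" by blast
    obtain Y' where Y': "Y' \<in> bmeas M" "signed_integral M \<mu> Y' \<in> V" "cls M \<P> Y = cls M \<P> Y'"
      using Basis(2) unfolding s by blast
    have "signed_integral M \<mu> Y \<in> V"
      using signed_integral_cong[OF \<mu> Y Y'(1)] Y' cls_eq_iff[OF Y Y'(1)] by metis
    then have "\<forall>\<^sub>F n in sequentially. signed_integral M \<mu> (X n) \<in> V"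
      by (rule topological_tendstoD[OF signed_integral_tendsto[OF \<mu> X Y bound lim] V])
    then show ?case unfolding s by eventually_elim (use X in blast)
  qed
qed

lemma topspace_weak_top: "topspace (weak_top M \<P>) = Linf M \<P>"
proof
  show "topspace (weak_top M \<P>) \<subseteq> Linf M \<P>"
    unfolding weak_top_def topology_generated_by_topspace by (auto intro: cls_in_Linf)
  obtain P where P: "P \<in> probs" using probs_nonempty by blast
  show "Linf M \<P> \<subseteq> topspace (weak_top M \<P>)"
  proof
    fix Z assume "Z \<in> Linf M \<P>"
    then obtain X where X: "X \<in> bmeas M" "Z = cls M \<P> X" by (rule Linf_cases)
    then have "Z \<in> cls M \<P> ` {X \<in> bmeas M. signed_integral M (measure P) X \<in> UNIV}" by blast
    then show "Z \<in> topspace (weak_top M \<P>)"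
      unfolding weak_top_def topology_generated_by_topspace using probs_ca_c[OF P] open_UNIV by blast
  qed
qed

end

section \<open>From semicontinuity to continuity from below, and back by separation\<close>

locale monotone_functional = robust M \<P> for M :: "'a measure" and \<P> +
  fixes f :: "('a \<Rightarrow> real) set \<Rightarrow> ereal"
  assumes f_proper: "\<forall>Z\<in>Linf M \<P>. f Z \<noteq> -\<infinity>"
    and f_mono: "monotone_fun M \<P> f"
begin

abbreviation F :: "('a \<Rightarrow> real) \<Rightarrow> ereal" where "F X \<equiv> f (cls M \<P> X)"

lemma F_mono: "X \<in> bmeas M \<Longrightarrow> Y \<in> bmeas M \<Longrightarrow> qs \<P> (\<lambda>w. X w \<le> Y w) \<Longrightarrow> F X \<le> F Y"
  using f_mono unfolding monotone_fun_def by blast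

lemma F_not_minf: "X \<in> bmeas M \<Longrightarrow> F X \<noteq> -\<infinity>"
  using f_proper cls_in_Linf by blast

lemma weak_lsc_imp_fatou:
  assumes "weak_lsc M \<P> f" shows "fatou_property M \<P> f"
  unfolding fatou_property_def
proof (intro allI impI)
  fix X :: "nat \<Rightarrow> 'a \<Rightarrow> real" and Y
  assume X: "\<forall>n. X n \<in> bmeas M" and Y: "Y \<in> bmeas M"
    and "\<exists>K. \<forall>n. Linf_norm \<P> (X n) \<le> K" and lim: "qs \<P> (\<lambda>w. (\<lambda>n. X n w) \<longlonglongrightarrow> Y w)"
  then obtain K where K: "Linf_norm \<P> (X n) \<le> K" for n by blast
  note bound = qs_abs_le_if_Linf_norm_le[OF X[rule_format] K]
  show "F Y \<le> liminf (\<lambda>n. F (X n))"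
    unfolding le_Liminf_iff
  proof (intro allI impI)
    fix y assume "y < F Y"
    then obtain a where a: "y < ereal a" "ereal a < F Y" using ereal_dense2 by blast
    let ?U = "Linf M \<P> - level_set M \<P> f a"
    have "openin (weak_top M \<P>) ?U"
      using assms unfolding weak_lsc_def closedin_def topspace_weak_top by blast
    moreover have "cls M \<P> Y \<in> ?U" using a cls_in_Linf[OF Y] unfolding level_set_def by auto
    ultimately have "\<forall>\<^sub>F n in sequentially. cls M \<P> (X n) \<in> ?U"
      using X by (intro weak_top_eventually[OF _ Y bound lim]) auto
    then show "\<forall>\<^sub>F n in sequentially. y < F (X n)"
      by eventually_elim (use a in \<open>auto simp: level_set_def not_le intro: less_trans\<close>)
  qed
qed

text \<open>An increasing sequence is norm bounded, being caught between \<open>X 0\<close> and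
  \<open>Y\<close>. For the increasing values of \<open>f\<close> the liminf is the supremum, and
  monotonicity gives the reverse inequality.\<close>

lemma fatou_imp_continuous_from_below:
  assumes "fatou_property M \<P> f" shows "continuous_from_below M \<P> f"
  unfolding continuous_from_below_def
proof (intro allI impI)
  fix X :: "nat \<Rightarrow> 'a \<Rightarrow> real" and Y
  assume X: "\<forall>n. X n \<in> bmeas M" and Y: "Y \<in> bmeas M"
    and conv: "qs \<P> (\<lambda>w. incseq (\<lambda>n. X n w) \<and> (\<lambda>n. X n w) \<longlonglongrightarrow> Y w)"
  obtain K where K: "\<And>w. w \<in> space M \<Longrightarrow> \<bar>X 0 w\<bar> \<le> K" using bmeas_bound X by blast
  obtain L where L: "\<And>w. w \<in> space M \<Longrightarrow> \<bar>Y w\<bar> \<le> L" using bmeas_bound[OF Y] by blast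
  have le: "qs \<P> (\<lambda>w. X n w \<le> Y w)" for n
    by (rule qs_mp[OF conv]) (auto intro: incseq_le)
  have inc: "incseq (\<lambda>n. F (X n))"
  proof (rule incseq_SucI)
    show "F (X n) \<le> F (X (Suc n))" for n
      using X by (intro F_mono qs_mp[OF conv]) (auto simp: incseq_def)
  qed
  have "Linf_norm \<P> (X n) \<le> max K L" for n
  proof (rule Linf_norm_le[OF X[rule_format] qs_mp[OF conv]])
    fix w assume w: "w \<in> space M" and c: "incseq (\<lambda>n. X n w) \<and> (\<lambda>n. X n w) \<longlonglongrightarrow> Y w"
    have "X 0 w \<le> X n w" "X n w \<le> Y w" using c incseq_le by (auto simp: incseq_def)
    then show "\<bar>X n w\<bar> \<le> max K L" using K[OF w] L[OF w] by (auto simp: abs_le_iff)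
  qed
  then have "F Y \<le> liminf (\<lambda>n. F (X n))"
    using assms X Y qs_mp[OF conv, of "\<lambda>w. (\<lambda>n. X n w) \<longlonglongrightarrow> Y w"]
    unfolding fatou_property_def by blast
  also have sup: "(\<lambda>n. F (X n)) \<longlonglongrightarrow> (SUP n. F (X n))" by (rule LIMSEQ_SUP[OF inc])
  then have "liminf (\<lambda>n. F (X n)) = (SUP n. F (X n))"
    by (intro lim_imp_Liminf) simp_all
  finally have "F Y \<le> (SUP n. F (X n))" .
  moreover have "(SUP n. F (X n)) \<le> F Y" using X le Y by (intro SUP_least F_mono) auto
  ultimately show "incseq (\<lambda>n. F (X n)) \<and> (\<lambda>n. F (X n)) \<longlonglongrightarrow> F Y" using sup inc by simp
qed

definition level :: "real \<Rightarrow> ('a \<Rightarrow> real) set" where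
  "level a = {X \<in> bmeas M. F X \<le> ereal a}"

text \<open>The substance is closedness under bounded limits and the translation of sensitivity from
  classes to functions.\<close>

lemma acceptance_level:
  assumes qc: "quasiconvex_fun M \<P> f" and cfb: "continuous_from_below M \<P> f"
    and sens: "sensitive_fun M \<P> f"
  shows "acceptance M \<P> (level a)"
proof
  show "level a \<subseteq> bmeas M" unfolding level_def by auto
  show "convex_funs (level a)"
    unfolding convex_funs_def
  proof (intro ballI)
    fix X Y and l :: real assume XY: "X \<in> level a" "Y \<in> level a" and l: "l \<in> {0..1}"
    then have "F (\<lambda>w. l * X w + (1 - l) * Y w) \<le> max (F X) (F Y)"
      using qc unfolding quasiconvex_fun_def level_def by blast
    also have "\<dots> \<le> ereal a" using XY unfolding level_def by auto
    finally show "(\<lambda>w. l * X w + (1 - l) * Y w) \<in> level a"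
      using XY unfolding level_def by (auto intro!: bmeas_intros)
  qed
  show down: "Y \<in> level a" if "Y \<in> bmeas M" "X \<in> level a" "qs \<P> (\<lambda>w. Y w \<le> X w)" for X Y
    using that F_mono[of Y X] unfolding level_def by (auto intro: order_trans)
  show "Y \<in> level a" if X: "\<And>n. X n \<in> level a" and Y: "Y \<in> bmeas M"
    and K: "\<And>n w. w \<in> space M \<Longrightarrow> \<bar>X n w\<bar> \<le> K"
    and lim: "\<And>w. w \<in> space M \<Longrightarrow> (\<lambda>n. X n w) \<longlonglongrightarrow> Y w" for X :: "nat \<Rightarrow> 'a \<Rightarrow> real" and Y K
  proof -
    \<comment> \<open>Tail infima increase to the limit and stay in the level set by monotonicity,
      so continuity from below covers all bounded pointwise limits.\<close>
    define Z where "Z n w = (INF k. X (n + k) w)" for n w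
    have lb: "- K \<le> X n w" if "w \<in> space M" for n w using K[OF that, of n] by (simp add: abs_le_iff)
    have bdd: "bdd_below (range (\<lambda>k. X (n + k) w))" if "w \<in> space M" for n w
      using lb[OF that] by (intro bdd_belowI2)
    have ZX: "Z n w \<le> X (n + k) w" if "w \<in> space M" for n k w
      unfolding Z_def by (rule cINF_lower[OF bdd[OF that]]) simp
    have ZX0: "Z n w \<le> X n w" if "w \<in> space M" for n w using ZX[OF that, of n 0] by simp
    have geZ: "c \<le> Z n w" if "\<And>k. c \<le> X (n + k) w" for c n w
      unfolding Z_def by (rule cINF_greatest) (use that in auto)
    have Xm: "X n \<in> borel_measurable M" for n using X unfolding level_def by (auto intro: bmeas_measurable)
    have Zb: "Z n \<in> bmeas M" for n
    proof (rule bmeasI)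
      show "Z n \<in> borel_measurable M"
        unfolding Z_def[abs_def] using Xm bdd by (intro borel_measurable_cINF) auto
      show "\<bar>Z n w\<bar> \<le> K" if w: "w \<in> space M" for w
      proof -
        have "- K \<le> Z n w" by (rule geZ) (rule lb[OF w])
        moreover have "X n w \<le> K" using K[OF w, of n] by simp
        ultimately show ?thesis using ZX0[OF w, of n] by simp
      qed
    qed
    have "Z n \<in> level a" for n by (rule down[OF Zb X qsI]) (rule ZX0)
    moreover have "qs \<P> (\<lambda>w. incseq (\<lambda>n. Z n w) \<and> (\<lambda>n. Z n w) \<longlonglongrightarrow> Y w)"
    proof (rule qsI)
      fix w assume w: "w \<in> space M"
      have "incseq (\<lambda>n. Z n w)"
      proof (rule incseq_SucI)
        show "Z n w \<le> Z (Suc n) w" for n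
          by (rule geZ) (use ZX[OF w, of n "Suc k" for k] in simp)
      qed
      moreover have "(\<lambda>n. Z n w) \<longlonglongrightarrow> Y w"
      proof (rule order_tendstoI)
        fix b assume b: "b < Y w"
        \<comment> \<open>An infimum of numbers above \<open>c\<close> is only at least
          \<open>c\<close>; the midpoint restores the strict inequality.\<close>
        define c where "c = (b + Y w) / 2"
        have c: "b < c" "c < Y w" using b unfolding c_def by auto
        then obtain N where "\<And>n. n \<ge> N \<Longrightarrow> c < X n w"
          using order_tendstoD(1)[OF lim[OF w], of c] by (auto simp: eventually_sequentially)
        then have "c \<le> Z n w" if "n \<ge> N" for n
          using that by (intro geZ less_imp_le) auto
        then show "\<forall>\<^sub>F n in sequentially. b < Z n w"
          using c(1) by (auto simp: eventually_sequentially intro: less_le_trans)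
      next
        fix b assume "Y w < b"
        from order_tendstoD(2)[OF lim[OF w] this]
        show "\<forall>\<^sub>F n in sequentially. Z n w < b"
          by eventually_elim (use ZX0[OF w] le_less_trans in blast)
      qed
      ultimately show "incseq (\<lambda>n. Z n w) \<and> (\<lambda>n. Z n w) \<longlonglongrightarrow> Y w" ..
    qed
    then have "(\<lambda>n. F (Z n)) \<longlonglongrightarrow> F Y"
      using cfb Zb Y unfolding continuous_from_below_def by blast
    ultimately have "F Y \<le> ereal a" unfolding level_def by (intro LIMSEQ_le_const2) auto
    then show ?thesis using Y unfolding level_def by simp
  qed
  show "\<exists>Q\<in>probs. \<forall>Y\<in>level a. \<not> (AE w in Q. X w = Y w)" if X: "X \<in> bmeas M" "X \<notin> level a" for X
  proof -
    obtain \<Q> where \<Q>: "\<Q> \<subseteq> prob_measures M" "dominated M \<Q> \<P>"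
      "level_set M \<P> f a = {Z \<in> Linf M \<P>. \<forall>Q\<in>\<Q>. jmap M Q Z \<in> jmap M Q ` level_set M \<P> f a}"
      using sens[unfolded sensitive_fun_def sensitive_set_def, rule_format, of a] by (elim exE conjE)
    have "cls M \<P> X \<notin> level_set M \<P> f a" using X unfolding level_def level_set_def by auto
    then have "cls M \<P> X \<notin> {Z \<in> Linf M \<P>. \<forall>Q\<in>\<Q>. jmap M Q Z \<in> jmap M Q ` level_set M \<P> f a}"
      using \<Q>(3) by blast
    then obtain Q where Q: "Q \<in> \<Q>" "jmap M Q (cls M \<P> X) \<notin> jmap M Q ` level_set M \<P> f a"
      using cls_in_Linf[OF X(1)] by blast
    have Qp: "Q \<in> probs"
      using \<Q>(1,2) Q(1) unfolding prob_measures_def dominated_def by (intro probsI) auto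
    have "\<not> (AE w in Q. X w = Y w)" if Y: "Y \<in> level a" for Y
    proof
      assume "AE w in Q. X w = Y w"
      then have "jmap M Q (cls M \<P> X) = jmap M Q (cls M \<P> Y)"
        using Y by (intro jmap_cls_cong[OF Qp X(1)]) (auto simp: level_def)
      moreover have "cls M \<P> Y \<in> level_set M \<P> f a"
        using Y cls_in_Linf unfolding level_def level_set_def by blast
      ultimately show False using Q(2) by blast
    qed
    then show ?thesis using Qp by blast
  qed
qed

text \<open>The hub of the equivalences: the weak topology, \<open>R\<close> and the conjugate are
  all handled from this one statement about functions and real levels.\<close>

definition levels_separated :: bool where
  "levels_separated \<longleftrightarrow> (\<forall>X0\<in>bmeas M. \<forall>a. ereal a < F X0 \<longrightarrow>
    (\<exists>P\<in>probs. \<exists>e>0. \<forall>X\<in>bmeas M. F X \<le> ereal a \<longrightarrow> integral\<^sup>L P X \<le> integral\<^sup>L P X0 - e))"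

lemma continuous_from_below_imp_separated:
  assumes dual: "dual_is_Linf M \<P>" and "quasiconvex_fun M \<P> f" "continuous_from_below M \<P> f"
    "sensitive_fun M \<P> f"
  shows levels_separated
  unfolding levels_separated_def
proof (intro ballI allI impI)
  fix X0 a assume X0: "X0 \<in> bmeas M" "ereal a < F X0"
  interpret acceptance M \<P> "level a" by (rule acceptance_level) fact+
  have "X0 \<notin> level a" using X0 unfolding level_def by auto
  from separate[OF dual X0(1) this]
  show "\<exists>P\<in>probs. \<exists>e>0. \<forall>X\<in>bmeas M. F X \<le> ereal a \<longrightarrow> integral\<^sup>L P X \<le> integral\<^sup>L P X0 - e"
    unfolding level_def by blast
qed

text \<open>The open half-space of \<open>X\<close> with \<open>E_P[X] > E_P[X0] - e\<close> is
  subbasic, contains \<open>X0\<close> and misses the level set.\<close>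

lemma separated_imp_weak_lsc:
  assumes sep: levels_separated shows "weak_lsc M \<P> f"
  unfolding weak_lsc_def closedin_def topspace_weak_top
proof (intro allI conjI)
  fix a
  show "level_set M \<P> f a \<subseteq> Linf M \<P>" unfolding level_set_def by auto
  show "openin (weak_top M \<P>) (Linf M \<P> - level_set M \<P> f a)"
  proof (subst openin_subopen, intro ballI)
    fix Z assume "Z \<in> Linf M \<P> - level_set M \<P> f a"
    then obtain X0 where X0: "X0 \<in> bmeas M" "Z = cls M \<P> X0" "ereal a < F X0"
      by (auto elim!: Linf_cases simp: level_set_def cls_in_Linf not_le)
    then obtain P e where P: "P \<in> probs" "e > 0"
      "\<And>X. X \<in> bmeas M \<Longrightarrow> F X \<le> ereal a \<Longrightarrow> integral\<^sup>L P X \<le> integral\<^sup>L P X0 - e"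
      using sep unfolding levels_separated_def by blast
    let ?T = "cls M \<P> ` {X \<in> bmeas M. signed_integral M (measure P) X \<in> {integral\<^sup>L P X0 - e <..}}"
    have "openin (weak_top M \<P>) ?T"
      unfolding weak_top_def using probs_ca_c[OF P(1)]
      by (intro topology_generated_by_Basis) (blast intro: open_greaterThan)
    moreover have "Z \<in> ?T"
      using X0 P probs_signed_integral[OF P(1) X0(1)] by auto
    moreover have "?T \<subseteq> Linf M \<P> - level_set M \<P> f a"
      using P(3) cls_in_Linf by (fastforce simp: level_set_def probs_signed_integral[OF P(1)])
    ultimately show "\<exists>T. openin (weak_top M \<P>) T \<and> Z \<in> T \<and> T \<subseteq> Linf M \<P> - level_set M \<P> f a" by blast
  qed
qed

subsection \<open>The quasiconvex representation\<close>

text \<open>Shifting \<open>X\<close> down by a constant to reach integral \<open>t\<close> gives a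
  competitor in the inner infimum whose value is at most \<open>F X\<close>.\<close>

lemma R_fun_le:
  assumes P: "P \<in> probs" and X: "X \<in> bmeas M"
  shows "R_fun M \<P> f (integral\<^sup>L P X) (measure P) \<le> F X"
  unfolding R_fun_def
proof (rule SUP_least)
  fix t assume t: "t \<in> {..<integral\<^sup>L P X}"
  define Y where "Y = (\<lambda>w. X w + (t - integral\<^sup>L P X))"
  have Yb: "Y \<in> bmeas M" unfolding Y_def by (intro bmeas_intros X)
  interpret prob_space P using P by (rule probs_prob)
  have "signed_integral M (measure P) Y = t"
    unfolding probs_signed_integral[OF P Yb] unfolding Y_def
    using probs_integrable[OF P X] by (simp add: prob_space)
  then have "(INF Y\<in>{Y \<in> bmeas M. signed_integral M (measure P) Y = t}. F Y) \<le> F Y"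
    using Yb by (intro INF_lower) auto
  also have "\<dots> \<le> F X" using t by (intro F_mono Yb X qsI) (simp add: Y_def)
  finally show "(INF Y\<in>{Y \<in> bmeas M. signed_integral M (measure P) Y = t}. F Y) \<le> F X" .
qed

lemma separated_imp_quasiconvex_representation:
  assumes sep: levels_separated shows "quasiconvex_representation M \<P> f"
  unfolding quasiconvex_representation_def
proof (intro ballI antisym)
  fix X assume X: "X \<in> bmeas M"
  show "(SUP P\<in>probs. R_fun M \<P> f (integral\<^sup>L P X) (measure P)) \<le> F X"
    by (intro SUP_least R_fun_le X)
  show "F X \<le> (SUP P\<in>probs. R_fun M \<P> f (integral\<^sup>L P X) (measure P))"
  proof (rule ereal_le_if_reals_below_le)
    fix a assume "ereal a < F X"
    then obtain P e where P: "P \<in> probs" "e > 0"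
      "\<And>Y. Y \<in> bmeas M \<Longrightarrow> F Y \<le> ereal a \<Longrightarrow> integral\<^sup>L P Y \<le> integral\<^sup>L P X - e"
      using sep X unfolding levels_separated_def by blast
    \<comment> \<open>Strictly below \<open>E_P[X]\<close>, hence admissible in \<open>R\<close>,
      and strictly above every integral over the level set.\<close>
    let ?t = "integral\<^sup>L P X - e / 2"
    have "ereal a \<le> (INF Y\<in>{Y \<in> bmeas M. signed_integral M (measure P) Y = ?t}. F Y)"
    proof (rule INF_greatest)
      fix Y assume "Y \<in> {Y \<in> bmeas M. signed_integral M (measure P) Y = ?t}"
      then have Y: "Y \<in> bmeas M" "integral\<^sup>L P Y = ?t" using probs_signed_integral[OF P(1)] by auto
      show "ereal a \<le> F Y" using P(3)[OF Y(1)] Y(2) P(2) by (cases "F Y \<le> ereal a") auto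
    qed
    also have "\<dots> \<le> R_fun M \<P> f (integral\<^sup>L P X) (measure P)"
      unfolding R_fun_def using P(2) by (intro SUP_upper) auto
    also have "\<dots> \<le> (SUP P\<in>probs. R_fun M \<P> f (integral\<^sup>L P X) (measure P))"
      using P(1) by (intro SUP_upper)
    finally show "ereal a \<le> (SUP P\<in>probs. R_fun M \<P> f (integral\<^sup>L P X) (measure P))" .
  qed
qed

lemma fatouI:
  assumes "\<And>X Y K y. (\<And>n::nat. X n \<in> bmeas M) \<Longrightarrow> Y \<in> bmeas M \<Longrightarrow> (\<And>n. qs \<P> (\<lambda>w. \<bar>X n w\<bar> \<le> K)) \<Longrightarrow>
    qs \<P> (\<lambda>w. (\<lambda>n. X n w) \<longlonglongrightarrow> Y w) \<Longrightarrow> y < F Y \<Longrightarrow> \<forall>\<^sub>F n in sequentially. y < F (X n)"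
  shows "fatou_property M \<P> f"
  unfolding fatou_property_def le_Liminf_iff
proof (intro allI impI)
  fix X :: "nat \<Rightarrow> 'a \<Rightarrow> real" and Y y
  assume X: "\<forall>n. X n \<in> bmeas M" and Y: "Y \<in> bmeas M"
    and "\<exists>K. \<forall>n. Linf_norm \<P> (X n) \<le> K" and lim: "qs \<P> (\<lambda>w. (\<lambda>n. X n w) \<longlonglongrightarrow> Y w)"
    and y: "y < F Y"
  then obtain K where K: "Linf_norm \<P> (X n) \<le> K" for n by blast
  show "\<forall>\<^sub>F n in sequentially. y < F (X n)"
    by (rule assms[OF X[rule_format] Y qs_abs_le_if_Linf_norm_le[OF X[rule_format] K] lim y])
qed

text \<open>The supremum over \<open>t' < t\<close> makes \<open>R\<close> lower semicontinuous in
  \<open>t\<close>: a \<open>t'\<close> that works for \<open>Y\<close> eventually lies below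
  \<open>E_P[X n]\<close> and gives the same inner infimum there.\<close>

lemma quasiconvex_representation_imp_fatou:
  assumes rep: "quasiconvex_representation M \<P> f" shows "fatou_property M \<P> f"
proof (rule fatouI)
  fix X :: "nat \<Rightarrow> 'a \<Rightarrow> real" and Y K y
  assume X: "\<And>n. X n \<in> bmeas M" and Y: "Y \<in> bmeas M" and bound: "\<And>n. qs \<P> (\<lambda>w. \<bar>X n w\<bar> \<le> K)"
    and lim: "qs \<P> (\<lambda>w. (\<lambda>n. X n w) \<longlonglongrightarrow> Y w)" and y: "y < F Y"
  then have "y < (SUP P\<in>probs. R_fun M \<P> f (integral\<^sup>L P Y) (measure P))"
    using rep unfolding quasiconvex_representation_def by simp
  then obtain P where P: "P \<in> probs" "y < R_fun M \<P> f (integral\<^sup>L P Y) (measure P)"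
    unfolding less_SUP_iff by blast
  then obtain t where t: "t < integral\<^sup>L P Y"
    "y < (INF Y\<in>{Y \<in> bmeas M. signed_integral M (measure P) Y = t}. F Y)"
    unfolding R_fun_def less_SUP_iff by auto
  have "\<forall>\<^sub>F n in sequentially. t < integral\<^sup>L P (X n)"
    by (rule order_tendstoD(1)[OF probs_integral_tendsto[OF P(1) X Y bound lim] t(1)])
  then show "\<forall>\<^sub>F n in sequentially. y < F (X n)"
  proof eventually_elim
    case (elim n)
    have "(INF Y\<in>{Y \<in> bmeas M. signed_integral M (measure P) Y = t}. F Y)
        \<le> R_fun M \<P> f (integral\<^sup>L P (X n)) (measure P)"
      unfolding R_fun_def using elim by (intro SUP_upper) auto
    also have "\<dots> \<le> F (X n)" by (rule R_fun_le[OF P(1) X])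
    finally show ?case using t(2) by simp
  qed
qed

end

context monotone_functional begin

subsection \<open>The convex representation\<close>

lemma convex_imp_quasiconvex:
  assumes "convex_fun M \<P> f" shows "quasiconvex_fun M \<P> f"
  unfolding quasiconvex_fun_def
proof (intro ballI)
  fix X Y and l :: real assume XY: "X \<in> bmeas M" "Y \<in> bmeas M" and l: "l \<in> {0..1}"
  let ?m = "max (F X) (F Y)"
  have "F (\<lambda>w. l * X w + (1 - l) * Y w) \<le> ereal l * F X + ereal (1 - l) * F Y"
    using assms XY l unfolding convex_fun_def by blast
  also have "\<dots> \<le> ereal l * ?m + ereal (1 - l) * ?m"
    using l by (intro add_mono ereal_mult_left_mono) auto
  also have "\<dots> = (ereal l + ereal (1 - l)) * ?m"
    using l by (subst ereal_left_distrib) auto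
  also have "\<dots> = ?m" by (simp add: one_ereal_def[symmetric])
  finally show "F (\<lambda>w. l * X w + (1 - l) * Y w) \<le> max (F X) (F Y)" .
qed

lemma F_real_cases:
  assumes "X \<in> bmeas M"
  obtains (real) r where "F X = ereal r" | (inf) "F X = \<infinity>"
  using F_not_minf[OF assms] by (cases "F X") auto

text \<open>The slope is the least of \<open>(F X - a) / (E_P[X] - t)\<close> over points beyond
  \<open>t\<close>; \<open>X2\<close> ensures that there is one. Points before \<open>t\<close>
  respect it because mixing them with points beyond reaches \<open>t\<close>, where \<open>f\<close>
  is at least \<open>a\<close>.\<close>

lemma affine_minorant:
  assumes conv: "convex_fun M \<P> f" and P: "P \<in> probs"
    and X2: "X2 \<in> bmeas M" "F X2 \<noteq> \<infinity>" "t < integral\<^sup>L P X2"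
    and lower: "\<And>Y. Y \<in> bmeas M \<Longrightarrow> t \<le> integral\<^sup>L P Y \<Longrightarrow> ereal a \<le> F Y"
  shows "\<exists>s\<ge>0. \<forall>Y\<in>bmeas M. ereal (a + s * (integral\<^sup>L P Y - t)) \<le> F Y"
proof -
  define S where "S = {(r - a) / (integral\<^sup>L P X - t) | X r. X \<in> bmeas M \<and> F X = ereal r \<and> t < integral\<^sup>L P X}"
  have "S \<noteq> {}" using X2 by (cases rule: F_real_cases[OF X2(1)]) (auto simp: S_def)
  have pos: "0 \<le> x" if "x \<in> S" for x
  proof -
    obtain X r where "x = (r - a) / (integral\<^sup>L P X - t)" "X \<in> bmeas M" "F X = ereal r" "t < integral\<^sup>L P X"
      using \<open>x \<in> S\<close> unfolding S_def by blast
    then show ?thesis using lower[of X] by auto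
  qed
  then have bdd: "bdd_below S" by (intro bdd_belowI[where m = 0])
  define s where "s = Inf S"
  have "s \<ge> 0" unfolding s_def using \<open>S \<noteq> {}\<close> pos by (intro cInf_greatest) auto
  moreover have "ereal (a + s * (integral\<^sup>L P Y - t)) \<le> F Y" if Y: "Y \<in> bmeas M" for Y
  using Y
  proof (cases rule: F_real_cases)
    case inf
    then show ?thesis by simp
  next
    case (real y)
    consider "t < integral\<^sup>L P Y" | "t = integral\<^sup>L P Y" | "integral\<^sup>L P Y < t" by linarith
    then have "a + s * (integral\<^sup>L P Y - t) \<le> y"
    proof cases
      case 1
      then have "s \<le> (y - a) / (integral\<^sup>L P Y - t)"
        unfolding s_def using Y real by (intro cInf_lower bdd) (auto simp: S_def)
      then show ?thesis using 1 by (simp add: pos_le_divide_eq)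
    next
      case 2
      then show ?thesis using lower[OF Y] real by simp
    next
      case 3
      have "(a - y) / (t - integral\<^sup>L P Y) \<le> s"
        unfolding s_def
      proof (rule cInf_greatest[OF \<open>S \<noteq> {}\<close>])
        fix x assume "x \<in> S"
        then obtain X r where X: "x = (r - a) / (integral\<^sup>L P X - t)" "X \<in> bmeas M" "F X = ereal r" "t < integral\<^sup>L P X"
          unfolding S_def by blast
        define u where "u = integral\<^sup>L P X - t"
        define v where "v = t - integral\<^sup>L P Y"
        have uv: "u > 0" "v > 0" unfolding u_def v_def using X 3 by auto
        \<comment> \<open>The mixing weight for which the integral of \<open>?Z\<close> is exactly
          \<open>t\<close>.\<close>
        define l where "l = v / (u + v)"
        have l: "l \<in> {0..1}" "1 - l = u / (u + v)" unfolding l_def using uv by (auto simp: field_simps)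
        let ?Z = "\<lambda>w. l * X w + (1 - l) * Y w"
        have Zb: "?Z \<in> bmeas M" by (intro bmeas_intros X Y)
        have "integral\<^sup>L P ?Z = l * integral\<^sup>L P X + (1 - l) * integral\<^sup>L P Y"
          using probs_integrable[OF P X(2)] probs_integrable[OF P Y] by simp
        also have "\<dots> = l * (t + u) + (1 - l) * (t - v)" unfolding u_def v_def by simp
        also have "\<dots> = t + (l * u - (1 - l) * v)" by (simp add: algebra_simps)
        also have "l * u - (1 - l) * v = 0" unfolding l(2) unfolding l_def by simp
        finally have "ereal a \<le> F ?Z" using lower[OF Zb] by simp
        also have "\<dots> \<le> ereal l * F X + ereal (1 - l) * F Y"
          using conv X(2) Y l(1) unfolding convex_fun_def by blast
        also have "\<dots> = ereal (l * r + (1 - l) * y)" using X(3) real by simp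
        finally have "a \<le> l * r + (1 - l) * y" by simp
        then have "(u + v) * a \<le> (u + v) * (l * r + (1 - l) * y)"
          using uv by (intro mult_left_mono) auto
        also have "\<dots> = ((u + v) * l) * r + ((u + v) * (1 - l)) * y"
          by (simp only: distrib_left mult.assoc)
        also have "\<dots> = v * r + u * y" unfolding l(2) unfolding l_def using uv by simp
        finally have "(u + v) * a \<le> v * r + u * y" .
        then have "(a - y) * u \<le> (r - a) * v" by (simp add: algebra_simps)
        then have "(a - y) / v \<le> (r - a) / u" using uv by (simp add: field_simps)
        then show "(a - y) / (t - integral\<^sup>L P Y) \<le> x" unfolding X(1) u_def v_def .
      qed
      then have "a - y \<le> s * (t - integral\<^sup>L P Y)" using 3 by (simp add: pos_divide_le_eq)
      then show ?thesis by (simp add: algebra_simps)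
    qed
    then show ?thesis using real by simp
  qed
  ultimately show ?thesis by blast
qed

text \<open>If \<open>X0\<close> is separated from the whole domain of \<open>f\<close> (the hyperplane in the product with
  \<open>\<real>\<close> is vertical), any affine minorant is tilted by a large multiple of the separating functional.\<close>

lemma affine_minorant_at:
  assumes conv: "convex_fun M \<P> f" and sep: levels_separated
    and X0: "X0 \<in> bmeas M" "ereal a < F X0"
  shows "\<exists>P1\<in>probs. \<exists>P2\<in>probs. \<exists>s1\<ge>0. \<exists>s2\<ge>0. \<exists>b.
    (\<forall>Y\<in>bmeas M. ereal (s1 * integral\<^sup>L P1 Y + s2 * integral\<^sup>L P2 Y - b) \<le> F Y) \<and>
    a \<le> s1 * integral\<^sup>L P1 X0 + s2 * integral\<^sup>L P2 X0 - b"
proof -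
  obtain P e where P: "P \<in> probs" "e > 0"
    "\<And>Y. Y \<in> bmeas M \<Longrightarrow> F Y \<le> ereal a \<Longrightarrow> integral\<^sup>L P Y \<le> integral\<^sup>L P X0 - e"
    using sep X0 unfolding levels_separated_def by blast
  define t where "t = integral\<^sup>L P X0 - e / 2"
  have lower: "ereal a \<le> F Y" if "Y \<in> bmeas M" "t \<le> integral\<^sup>L P Y" for Y
    using P(3)[OF that(1)] that(2) P(2) unfolding t_def by (cases "F Y \<le> ereal a") auto
  show ?thesis
  proof (cases "\<exists>X2\<in>bmeas M. F X2 \<noteq> \<infinity> \<and> t < integral\<^sup>L P X2")
    case True
    then obtain X2 where X2: "X2 \<in> bmeas M" "F X2 \<noteq> \<infinity>" "t < integral\<^sup>L P X2" by blast
    obtain s where s: "s \<ge> 0" "\<And>Y. Y \<in> bmeas M \<Longrightarrow> ereal (a + s * (integral\<^sup>L P Y - t)) \<le> F Y"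
      using affine_minorant[OF conv P(1) X2 lower] by blast
    show ?thesis
    proof (rule bexI[OF _ P(1)], rule bexI[OF _ P(1)], rule exI[of _ s], rule conjI[OF s(1)],
        rule exI[of _ 0], rule conjI[OF order_refl], rule exI[of _ "s * t - a"], intro conjI ballI)
      show "ereal (s * integral\<^sup>L P Y + 0 * integral\<^sup>L P Y - (s * t - a)) \<le> F Y" if "Y \<in> bmeas M" for Y
        using s(2)[OF that] by (simp add: algebra_simps)
      have "s * (e / 2) \<ge> 0" using s(1) P(2) by simp
      then show "a \<le> s * integral\<^sup>L P X0 + 0 * integral\<^sup>L P X0 - (s * t - a)"
        unfolding t_def by (simp add: algebra_simps)
    qed
  next
    case False
    then have dom: "integral\<^sup>L P Y \<le> t" if "Y \<in> bmeas M" "F Y \<noteq> \<infinity>" for Y using that by force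
    show ?thesis
    proof (cases "\<exists>X1\<in>bmeas M. F X1 \<noteq> \<infinity>")
      case True
      then obtain X1 where X1: "X1 \<in> bmeas M" "F X1 \<noteq> \<infinity>" by blast
      then obtain x where x: "F X1 = ereal x" by (auto elim: F_real_cases)
      \<comment> \<open>Some affine minorant is needed first. Separating at the level
        \<open>x - 1\<close> below the finite value at \<open>X1\<close> puts \<open>X1\<close>
        itself beyond the threshold, so the vertical case cannot recur.\<close>
      then have "ereal (x - 1) < F X1" by simp
      then obtain Q d where Q: "Q \<in> probs" "d > 0"
        "\<And>Y. Y \<in> bmeas M \<Longrightarrow> F Y \<le> ereal (x - 1) \<Longrightarrow> integral\<^sup>L Q Y \<le> integral\<^sup>L Q X1 - d"
        using sep X1 unfolding levels_separated_def by blast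
      define t1 where "t1 = integral\<^sup>L Q X1 - d / 2"
      have "ereal (x - 1) \<le> F Y" if "Y \<in> bmeas M" "t1 \<le> integral\<^sup>L Q Y" for Y
        using Q(3)[OF that(1)] that(2) Q(2) unfolding t1_def by (cases "F Y \<le> ereal (x - 1)") auto
      moreover have "t1 < integral\<^sup>L Q X1" unfolding t1_def using Q(2) by simp
      ultimately obtain s where s: "s \<ge> 0"
        "\<And>Y. Y \<in> bmeas M \<Longrightarrow> ereal ((x - 1) + s * (integral\<^sup>L Q Y - t1)) \<le> F Y"
        using affine_minorant[OF conv Q(1) X1] by blast
      define h where "h = (x - 1) + s * (integral\<^sup>L Q X0 - t1)"
      \<comment> \<open>Large enough that \<open>h + l * e / 2 \<ge> a\<close> at \<open>X0\<close>;
        on the domain of \<open>f\<close> the added term \<open>l (E_P[Y] - t)\<close> is at most 0,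
        so the minorant survives.\<close>
      define l where "l = max 0 (2 * (a - h) / e)"
      have l: "l \<ge> 0" "a - h \<le> l * (e / 2)"
      proof -
        have "2 * (a - h) / e * (e / 2) \<le> l * (e / 2)"
          unfolding l_def using P(2) by (intro mult_right_mono) auto
        then show "a - h \<le> l * (e / 2)" using P(2) by simp
      qed (simp add: l_def)
      show ?thesis
      proof (rule bexI[OF _ Q(1)], rule bexI[OF _ P(1)], rule exI[of _ s], rule conjI[OF s(1)],
          rule exI[of _ l], rule conjI[OF l(1)], rule exI[of _ "s * t1 - (x - 1) + l * t"],
          intro conjI ballI)
        fix Y assume Y: "Y \<in> bmeas M"
        show "ereal (s * integral\<^sup>L Q Y + l * integral\<^sup>L P Y - (s * t1 - (x - 1) + l * t)) \<le> F Y"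
        using Y
        proof (cases rule: F_real_cases)
          case (real y)
          have "l * (integral\<^sup>L P Y - t) \<le> 0"
            using dom[OF Y] real l(1) by (intro mult_nonneg_nonpos) auto
          then show ?thesis using s(2)[OF Y] real by (simp add: algebra_simps)
        qed simp
      next
        show "a \<le> s * integral\<^sup>L Q X0 + l * integral\<^sup>L P X0 - (s * t1 - (x - 1) + l * t)"
          using l(2) unfolding h_def t_def by (simp add: algebra_simps)
      qed
    next
      \<comment> \<open>Here \<open>f\<close> is identically infinite, and the constant
        \<open>a\<close>, with both weights 0, is a minorant.\<close>
      case False
      show ?thesis
        by (rule bexI[OF _ P(1)], rule bexI[OF _ P(1)], rule exI[of _ 0], rule conjI[OF order_refl],
            rule exI[of _ 0], rule conjI[OF order_refl], rule exI[of _ "- a"]) (use False in auto)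
    qed
  qed
qed

text \<open>The Fenchel--Young inequality, rearranged. Since \<open>f\<close> never takes the value
  minus infinity, the case split on \<open>F X\<close> leaves no undefined difference.\<close>

lemma fstar_ge: "X \<in> bmeas M \<Longrightarrow> ereal (signed_integral M \<mu> X) - fstar M \<P> f \<mu> \<le> F X"
proof -
  assume X: "X \<in> bmeas M"
  have up: "ereal (signed_integral M \<mu> X) - F X \<le> fstar M \<P> f \<mu>"
    unfolding fstar_def using X by (intro SUP_upper)
  show ?thesis
  using X
  proof (cases rule: F_real_cases)
    case (real r)
    then show ?thesis using up by (cases "fstar M \<P> f \<mu>") auto
  qed simp
qed

lemma fstar_le:
  assumes "\<And>Y. Y \<in> bmeas M \<Longrightarrow> ereal (signed_integral M \<mu> Y - b) \<le> F Y"
  shows "fstar M \<P> f \<mu> \<le> ereal b"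
  unfolding fstar_def
proof (rule SUP_least)
  fix Y assume Y: "Y \<in> bmeas M"
  show "ereal (signed_integral M \<mu> Y) - F Y \<le> ereal b"
    using assms[OF Y] by (cases rule: F_real_cases[OF Y]) auto
qed

lemma le_minus_fstar:
  assumes "fstar M \<P> f \<mu> \<le> ereal b" "a \<le> x - b"
  shows "ereal a \<le> ereal x - fstar M \<P> f \<mu>"
  using assms by (cases "fstar M \<P> f \<mu>") auto

text \<open>The representing measure is \<open>s1 P1 + s2 P2\<close>; two summands are allowed
  because a vertical separation contributes a second measure.\<close>

lemma separated_imp_convex_representation:
  assumes conv: "convex_fun M \<P> f" and sep: levels_separated
  shows "convex_representation M \<P> f"
  unfolding convex_representation_def
proof (intro ballI antisym)
  fix X assume X: "X \<in> bmeas M"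
  show "(SUP \<mu>\<in>ca_c_pos M \<P>. ereal (signed_integral M \<mu> X) - fstar M \<P> f \<mu>) \<le> F X"
    by (intro SUP_least fstar_ge X)
  show "F X \<le> (SUP \<mu>\<in>ca_c_pos M \<P>. ereal (signed_integral M \<mu> X) - fstar M \<P> f \<mu>)"
  proof (rule ereal_le_if_reals_below_le)
    fix a assume "ereal a < F X"
    then obtain P1 P2 s1 s2 b where P: "P1 \<in> probs" "P2 \<in> probs" "s1 \<ge> 0" "s2 \<ge> 0"
      and min: "\<And>Y. Y \<in> bmeas M \<Longrightarrow> ereal (s1 * integral\<^sup>L P1 Y + s2 * integral\<^sup>L P2 Y - b) \<le> F Y"
      and a: "a \<le> s1 * integral\<^sup>L P1 X + s2 * integral\<^sup>L P2 X - b"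
      using affine_minorant_at[OF conv sep X] by blast
    define \<mu> where "\<mu> = (\<lambda>A. s1 * measure P1 A + s2 * measure P2 A)"
    have \<mu>: "\<mu> \<in> ca_c_pos M \<P>"
      unfolding ca_c_pos_def \<mu>_def using P ca_c_lincomb[OF probs_ca_c probs_ca_c] by auto
    have int: "signed_integral M \<mu> Y = s1 * integral\<^sup>L P1 Y + s2 * integral\<^sup>L P2 Y" if "Y \<in> bmeas M" for Y
      unfolding \<mu>_def using P that
      by (simp add: signed_integral_lincomb[OF ca_cD(1)[OF probs_ca_c] ca_cD(1)[OF probs_ca_c]] probs_signed_integral)
    have "fstar M \<P> f \<mu> \<le> ereal b" by (rule fstar_le) (use int min in auto)
    then have "ereal a \<le> ereal (signed_integral M \<mu> X) - fstar M \<P> f \<mu>"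
      using a int[OF X] by (intro le_minus_fstar) auto
    also have "\<dots> \<le> (SUP \<mu>\<in>ca_c_pos M \<P>. ereal (signed_integral M \<mu> X) - fstar M \<P> f \<mu>)"
      using \<mu> by (intro SUP_upper)
    finally show "ereal a \<le> (SUP \<mu>\<in>ca_c_pos M \<P>. ereal (signed_integral M \<mu> X) - fstar M \<P> f \<mu>)" .
  qed
qed

text \<open>Each term of the supremum is continuous along bounded q.s. convergent sequences, and it
  stays below \<open>f\<close> by \<open>fstar_ge\<close>.\<close>

lemma convex_representation_imp_fatou:
  assumes rep: "convex_representation M \<P> f" shows "fatou_property M \<P> f"
proof (rule fatouI)
  fix X :: "nat \<Rightarrow> 'a \<Rightarrow> real" and Y K y
  assume X: "\<And>n. X n \<in> bmeas M" and Y: "Y \<in> bmeas M" and bound: "\<And>n. qs \<P> (\<lambda>w. \<bar>X n w\<bar> \<le> K)"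
    and lim: "qs \<P> (\<lambda>w. (\<lambda>n. X n w) \<longlonglongrightarrow> Y w)" and y: "y < F Y"
  then have "y < (SUP \<mu>\<in>ca_c_pos M \<P>. ereal (signed_integral M \<mu> Y) - fstar M \<P> f \<mu>)"
    using rep unfolding convex_representation_def by simp
  then obtain \<mu> where \<mu>: "\<mu> \<in> ca_c M \<P>" "y < ereal (signed_integral M \<mu> Y) - fstar M \<P> f \<mu>"
    unfolding less_SUP_iff ca_c_pos_def by blast
  have "\<forall>\<^sub>F n in sequentially. y < ereal (signed_integral M \<mu> (X n)) - fstar M \<P> f \<mu>"
  proof (cases "fstar M \<P> f \<mu>")
    case (real c)
    have *: "(\<lambda>n. ereal (signed_integral M \<mu> (X n) - c)) \<longlonglongrightarrow> ereal (signed_integral M \<mu> Y - c)"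
      by (intro tendsto_intros signed_integral_tendsto[OF \<mu>(1) X Y bound lim])
    show ?thesis using order_tendstoD(1)[OF *, of y] \<mu>(2) real by simp
  qed (use \<mu>(2) in auto)
  then show "\<forall>\<^sub>F n in sequentially. y < F (X n)"
    by eventually_elim (rule less_le_trans[OF _ fstar_ge[OF X]])
qed

subsection \<open>Cash additivity\<close>

text \<open>Subtracting the constants \<open>F X\<close> and \<open>F Y\<close> normalises both
  values to 0. Quasiconvexity bounds the mixture of the shifted functions by 0, and shifting back is
  the convexity inequality.\<close>

lemma cash_additive_imp_convex:
  assumes qc: "quasiconvex_fun M \<P> f" and cash: "cash_additive M \<P> f"
  shows "convex_fun M \<P> f"
  unfolding convex_fun_def
proof (intro ballI)
  fix X Y and l :: real assume XY: "X \<in> bmeas M" "Y \<in> bmeas M" and l: "l \<in> {0..1}"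
  let ?Z = "\<lambda>w. l * X w + (1 - l) * Y w"
  have shift: "F (\<lambda>w. X w + m) = F X + ereal m" if "X \<in> bmeas M" for X m
    using cash that unfolding cash_additive_def by blast
  consider "l = 0" | "l = 1" | "0 < l" "l < 1" using l by fastforce
  then show "F ?Z \<le> ereal l * F X + ereal (1 - l) * F Y"
  proof cases
    case 3
    show ?thesis
    using XY(1)
    proof (cases rule: F_real_cases)
      case inf
      then show ?thesis using 3 F_not_minf[OF XY(2)] by (cases "F Y") auto
    next
      case X: (real x)
      show ?thesis
      using XY(2)
      proof (cases rule: F_real_cases)
        case inf
        then show ?thesis using 3 X by simp
      next
        case Y: (real y)
        let ?X = "\<lambda>w. X w + (- x)" and ?Y = "\<lambda>w. Y w + (- y)"
        have Zb: "?Z \<in> bmeas M" by (intro bmeas_intros XY)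
        have XYb: "?X \<in> bmeas M" "?Y \<in> bmeas M" by (intro bmeas_intros XY)+
        have "F (\<lambda>w. l * ?X w + (1 - l) * ?Y w) \<le> max (F ?X) (F ?Y)"
          by (rule qc[unfolded quasiconvex_fun_def, rule_format, OF XYb l])
        also have "\<dots> = 0" using shift[OF XY(1), of "- x"] shift[OF XY(2), of "- y"] X Y
          by (simp add: zero_ereal_def)
        also have "(\<lambda>w. l * ?X w + (1 - l) * ?Y w) = (\<lambda>w. ?Z w + (- (l * x + (1 - l) * y)))"
          by (simp add: algebra_simps)
        finally have "F ?Z + ereal (- (l * x + (1 - l) * y)) \<le> 0" using shift[OF Zb] by simp
        then show ?thesis using X Y by (cases "F ?Z") auto
      qed
    qed
  qed (auto simp: zero_ereal_def[symmetric])
qed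

text \<open>Cash additivity moves every \<open>Y\<close> of finite value into the level set at
  \<open>a\<close> by adding \<open>a - F Y\<close>. Separation of that single level then gives
  \<open>f*(P) \<le> E_P[X] - a\<close>, with slope 1 and no tilting.\<close>

lemma separated_imp_cash_additive_representation:
  assumes cash: "cash_additive M \<P> f" and sep: levels_separated
  shows "cash_additive_representation M \<P> f"
  unfolding cash_additive_representation_def
proof (intro ballI antisym)
  fix X assume X: "X \<in> bmeas M"
  show "(SUP P\<in>probs. ereal (integral\<^sup>L P X) - fstar M \<P> f (measure P)) \<le> F X"
    using fstar_ge[OF X] by (intro SUP_least) (simp add: probs_signed_integral[OF _ X, symmetric])
  show "F X \<le> (SUP P\<in>probs. ereal (integral\<^sup>L P X) - fstar M \<P> f (measure P))"
  proof (rule ereal_le_if_reals_below_le)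
    fix a assume "ereal a < F X"
    then obtain P e where P: "P \<in> probs" "e > 0"
      "\<And>Y. Y \<in> bmeas M \<Longrightarrow> F Y \<le> ereal a \<Longrightarrow> integral\<^sup>L P Y \<le> integral\<^sup>L P X - e"
      using sep X unfolding levels_separated_def by blast
    interpret prob_space P using P(1) by (rule probs_prob)
    have "fstar M \<P> f (measure P) \<le> ereal (integral\<^sup>L P X - a)"
    proof (rule fstar_le)
      fix Y assume Y: "Y \<in> bmeas M"
      show "ereal (signed_integral M (measure P) Y - (integral\<^sup>L P X - a)) \<le> F Y"
      using Y
      proof (cases rule: F_real_cases)
        case (real y)
        have "F (\<lambda>w. Y w + (a - y)) = F Y + ereal (a - y)"
          using cash Y unfolding cash_additive_def by blast
        then have "F (\<lambda>w. Y w + (a - y)) \<le> ereal a" using real by simp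
        then have "(\<integral>w. Y w + (a - y) \<partial>P) \<le> integral\<^sup>L P X - e"
          by (intro P(3) bmeas_intros Y)
        then have "integral\<^sup>L P Y + (a - y) \<le> integral\<^sup>L P X"
          using P(2) probs_integrable[OF P(1) Y] by (simp add: prob_space)
        then show ?thesis using real probs_signed_integral[OF P(1) Y] by simp
      qed simp
    qed
    then have "ereal a \<le> ereal (integral\<^sup>L P X) - fstar M \<P> f (measure P)"
      by (rule le_minus_fstar) simp
    also have "\<dots> \<le> (SUP P\<in>probs. ereal (integral\<^sup>L P X) - fstar M \<P> f (measure P))"
      using P(1) by (intro SUP_upper)
    finally show "ereal a \<le> (SUP P\<in>probs. ereal (integral\<^sup>L P X) - fstar M \<P> f (measure P))" .
  qed
qed

end

theorem theorem4p3:
  fixes M :: "'a measure"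
    and \<P> :: "'a measure set"
    and f :: "('a \<Rightarrow> real) set \<Rightarrow> ereal"
  assumes "\<P> \<subseteq> prob_measures M"
    and "\<P> \<noteq> {}"
    and "dual_is_Linf M \<P>"
    and "\<forall>Z\<in>Linf M \<P>. f Z \<noteq> -\<infinity>"
    and "quasiconvex_fun M \<P> f \<or> convex_fun M \<P> f"
    and "monotone_fun M \<P> f"
    and "sensitive_fun M \<P> f"
  shows "(quasiconvex_fun M \<P> f \<longrightarrow>
            (weak_lsc M \<P> f \<longleftrightarrow> fatou_property M \<P> f) \<and>
            (fatou_property M \<P> f \<longleftrightarrow> continuous_from_below M \<P> f) \<and>
            (continuous_from_below M \<P> f \<longleftrightarrow> quasiconvex_representation M \<P> f))
       \<and> (convex_fun M \<P> f \<longrightarrow>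
            (weak_lsc M \<P> f \<longleftrightarrow> fatou_property M \<P> f) \<and>
            (fatou_property M \<P> f \<longleftrightarrow> continuous_from_below M \<P> f) \<and>
            (continuous_from_below M \<P> f \<longleftrightarrow> convex_representation M \<P> f))
       \<and> (cash_additive M \<P> f \<longrightarrow>
            convex_fun M \<P> f \<and>
            (weak_lsc M \<P> f \<longrightarrow> cash_additive_representation M \<P> f))"
proof -
  interpret monotone_functional M \<P> f by standard fact+
  have qc: "quasiconvex_fun M \<P> f" using assms(5) convex_imp_quasiconvex by blast
  \<comment> \<open>The cycle runs from continuity from below through
    \<open>levels_separated\<close> to weak semicontinuity, Fatou and back; the representations
    branch off the hub and return by Fatou.\<close>
  have sep: "continuous_from_below M \<P> f \<Longrightarrow> levels_separated"
    using continuous_from_below_imp_separated[OF assms(3) qc _ assms(7)] .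
  have lsc: "weak_lsc M \<P> f \<longleftrightarrow> fatou_property M \<P> f"
    and cfb: "fatou_property M \<P> f \<longleftrightarrow> continuous_from_below M \<P> f"
    using weak_lsc_imp_fatou fatou_imp_continuous_from_below sep separated_imp_weak_lsc by blast+
  have "continuous_from_below M \<P> f \<longleftrightarrow> quasiconvex_representation M \<P> f"
    using sep separated_imp_quasiconvex_representation quasiconvex_representation_imp_fatou cfb by blast
  moreover have "continuous_from_below M \<P> f \<longleftrightarrow> convex_representation M \<P> f" if "convex_fun M \<P> f"
    using sep separated_imp_convex_representation[OF that] convex_representation_imp_fatou cfb by blast
  moreover have "convex_fun M \<P> f" if "cash_additive M \<P> f"
    by (rule cash_additive_imp_convex[OF qc that])
  moreover have "cash_additive_representation M \<P> f" if "cash_additive M \<P> f" "weak_lsc M \<P> f"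
    using that sep lsc cfb separated_imp_cash_additive_representation by blast
  ultimately show ?thesis using lsc cfb by blast
qed

end
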